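(* Let $\Omega$, $\Gamma_j$, $q_j$, $\Omega_j$ ($j=1,\ldots,n$) and the triangulation $\triangle$ be as described in the context, and let $I_\triangle$ be the interpolation operator defined there. If $u\in H^5(\Omega)\cap H^1_0(\Omega)$, then $I_\triangle u\in \mathbb{S}^{1,2}_{5,0}(\triangle)$.
   Context: **Domain.** $\mathbb{P}_d$ denotes the bivariate real polynomials of total degree at most $d$. $\Omega\subset\mathbb{R}^2$ is a bounded simply connected curvilinear polygonal domain whose boundary $\Gamma=\partial\Omega=\bigcup_{j=1}^n\overline{\Gamma}_j$ is a closed curve without self-intersections, each $\Gamma_j$ being an open arc of a conic. $Z=\{z_1,\ldots,z_n\}$ is the set of endpoints of the arcs, numbered counter-clockwise, with $z_j,z_{j+1}$ the endpoints of $\Gamma_j$ ($z_{j+n}=z_j$). The internal angle $\omega_j$ between the tangents to $\Gamma_j$ and $\Gamma_{j-1}$ at $z_j$ lies in $(0,2\pi)$, so $\Omega$ is a Lipschitz domain. For each $j$, $q_j\in\mathbb{P}_2$ is an irreducible quadratic polynomial with $\Gamma_j\subset\{x: q_j(x)=0\}$, $\nabla q_j(x)\neq0$ for $x\in\Gamma_j$, and $q_j>0$ at points of $\Omega$ near $\Gamma_j$ (all boundary arcs are assumed curved). **Triangulation.** $\triangle$ is a subdivision of $\Omega$ into triangles, where each $T\in\triangle$ has at most one edge replaced by a curved segment of $\partial\Omega$, and the intersection of any two triangles is empty, a common vertex, or a common straight edge. Triangles with a curved edge are *pie-shaped* (set $\triangle_P$); triangles that are not pie-shaped but share at least one edge with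 a pie-shaped triangle are *buffer* triangles (set $\triangle_B$); the rest are *ordinary* (set $\triangle_0$). $V_I$, $V_\partial$ denote the interior and boundary vertices. It is assumed that: (A) $Z\subset V_\partial$; (B) no interior edge has both endpoints on the boundary; (C) no two pie-shaped triangles share an edge; (D) every $T\in\triangle_P$ is star-shaped with respect to its interior vertex; (E) for any $T\in\triangle_P$ with its curved side on $\Gamma_j$, $q_j(z)>0$ for all $z\in T\setminus\Gamma_j$; (F) no two buffer triangles share an edge. In addition, every buffer triangle has exactly one boundary vertex, and both of its edges at this vertex are shared with pie-shaped triangles. For $T\in\triangle_P$, $T^*$ is the triangle obtained by joining the two boundary vertices of $T$ by a straight line. $B_T$ is the disk inscribed in $T$ if $T\in\triangle_0\cup\triangle_B$, or in $T\cap T^*$ if $T\in\triangle_P$. **Auxiliary domains.** $\Omega_j\subset\Omega$, $j=1,\dots,n$, are domains with Lipschitz boundary such that: (a) $\partial\Omega_j\cap\partial\Omega=\Gamma_j$; (b) $\partial\Omega_j\setminus\partial\Omega$ consists of finitely many straight line segments; (c) $q_j>0$ on $\overline{\Omega}_j\setminus\Gamma_j$; (d) $\Omega_j\cap\Omega_k=\emptyset$ for $j\ne k$; (e) $\overline{\Omega}_j$ contains every $T\in\triangle_P$ whose curved edge is part of $\Gamma_j$. The $q_j$ are normalized so that (f) $\max_{x\in\overline{\Omega}_j}\|\nabla q_j(x)\|_2\le1$ and $\|\nabla^2q_j\|_2\le1$, where $\nabla^2 q_j$ is the (constant) Hessian. **Spaces.** $H^m(\Omega)$ is the usual Sobolev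 space and $H^1_0(\Omega)=\{f\in H^1(\Omega): f|_{\partial\Omega}=0\}$. Let $\mathbb{S}^1_5(\triangle)=\{s\in C^1(\Omega): s|_T\in\mathbb{P}_5 \text{ for } T\in\triangle_0,\ s|_T\in\mathbb{P}_6\text{ for }T\in\triangle_P\cup\triangle_B\}$, $\mathbb{S}^{1,2}_{5,I}(\triangle)=\{s\in\mathbb{S}^1_5(\triangle): s\text{ is twice differentiable at every }v\in V_I\}$, and $\mathbb{S}^{1,2}_{5,0}(\triangle)=\{s\in\mathbb{S}^{1,2}_{5,I}(\triangle): s|_\Gamma=0\}$. **Nodal functionals.** For each edge $e$ fix a unit vector orthogonal to $e$ and let $D_{e^\perp}$ be the directional derivative along it. For a straight edge $e$ with vertices $v',v''$ put $z_e^j=v'+\frac j4(v''-v')$, $j=1,2,3$. - For $T\in\triangle_0$ with vertices $v_1,v_2,v_3$ and edges $e_1,e_2,e_3$, $\mathcal{N}_T^0$ is the set of functionals giving the values $D_x^\alpha D_y^\beta f(v_i)$, $0\le\alpha+\beta\le2$, and $D_{e_i^\perp}f(z_{e_i}^2)$, $i=1,2,3$. - For $T\in\triangle_P$ with interior vertex $v_1$ and boundary vertices $v_2,v_3$, $\mathcal{N}_T^P$ is the set of functionals giving $D_x^\alpha D_y^\beta f(v_1)$, $0\le\alpha+\beta\le2$; $D_x^\alpha D_y^\beta f(v_i)$, $0\le\alpha+\beta\le1$, $i=2,3$; and $D_x^\alpha D_y^\beta f(c_T)$, $0\le\alpha+\beta\le1$, where $c_T$ is the center of $B_T$. **Operator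 $I_\triangle$.** Let $u\in H^5(\Omega)\cap H^1_0(\Omega)$; by Sobolev embedding $u$ is identified with a function in $C^3(\overline\Omega)$. $I_\triangle u$ is defined piecewise by $I_\triangle u|_T=I_Tu$, where: - If $T\in\triangle_0$, $I_Tu=p\in\mathbb{P}_5$ is the unique polynomial with $\eta p=\eta u$ for all $\eta\in\mathcal{N}_T^0$. - If $T\in\triangle_P$ with curved edge on $\Gamma_j$, $I_Tu=pq_j$, where $p\in\mathbb{P}_4$ is the unique polynomial with $\eta p=\eta(u/q_j)$ for all $\eta\in\mathcal{N}_T^P$. (It is known that $u/q_j\in H^4(\Omega_j)$, so $u/q_j$ is identified with a function in $C^2(\overline\Omega_j)$ and the functionals are well defined for it.) - If $T\in\triangle_B$ with boundary vertex $v_1$ and interior vertices $v_2,v_3$, put $e_1=\langle v_2,v_3\rangle$, $e_2=\langle v_1,v_2\rangle$, $e_3=\langle v_1,v_3\rangle$. Let $T_1\in\triangle_0$, $T_2\in\triangle_P$, $T_3\in\triangle_P$ be the triangles sharing with $T$ the edges $e_1,e_2,e_3$, respectively. Then $I_Tu=p\in\mathbb{P}_6$ is the unique polynomial with $p(c_T)=u(c_T)$, $c_T=(v_1+v_2+v_3)/3$, and $\eta p=\eta I_{T_i}u$ for all $\eta\in\mathcal{N}_i$, $i=1,2,3$, where: $\mathcal{N}_1$ corresponds to the values $f(z_{e_1}^2)$, $D_{e_1^\perp}f(z_{e_1}^1)$, $D_{e_1^\perp}f(z_{e_1}^3)$, and $D_x^\alpha D_y^\beta f(v_i)$, $0\le\alpha+\beta\le2$,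 $i=2,3$; $\mathcal{N}_2$ corresponds to $f(z_{e_2}^2)$, $D_{e_2^\perp}f(z_{e_2}^1)$, $D_{e_2^\perp}f(z_{e_2}^3)$, and $D_x^\alpha D_y^\beta f(v_1)$, $0\le\alpha+\beta\le2$; $\mathcal{N}_3$ corresponds to $f(z_{e_3}^2)$, $D_{e_3^\perp}f(z_{e_3}^1)$, $D_{e_3^\perp}f(z_{e_3}^3)$. *)

theory Defs
  imports "HOL-Analysis.Analysis"
begin

type_synonym plane = "real ^ 2"

section \<open>Derivatives and function spaces\<close>

definition dir_deriv :: "plane \<Rightarrow> (plane \<Rightarrow> real) \<Rightarrow> plane \<Rightarrow> real" where
  "dir_deriv d f x = frechet_derivative f (at x) d"

definition partial :: "nat \<Rightarrow> nat \<Rightarrow> (plane \<Rightarrow> real) \<Rightarrow> plane \<Rightarrow> real" where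
  "partial a b f = (dir_deriv (axis 1 1) ^^ a) ((dir_deriv (axis 2 1) ^^ b) f)"

definition gradient :: "(plane \<Rightarrow> real) \<Rightarrow> plane \<Rightarrow> plane" where
  "gradient f x = (\<chi> i. dir_deriv (axis i 1) f x)"

definition hessian :: "(plane \<Rightarrow> real) \<Rightarrow> plane \<Rightarrow> real ^ 2 ^ 2" where
  "hessian f x = (\<chi> i k. dir_deriv (axis i 1) (dir_deriv (axis k 1) f) x)"

text \<open>\<open>C\<^sup>k(S)\<close> for open \<open>S\<close>.\<close>

primrec Ck_on :: "nat \<Rightarrow> plane set \<Rightarrow> (plane \<Rightarrow> real) \<Rightarrow> bool" where
  "Ck_on 0 S f = continuous_on S f"
| "Ck_on (Suc k) S f =
     (f differentiable_on S \<and> (\<forall>i. Ck_on k S (dir_deriv (axis i 1) f)))"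

text \<open>\<open>C\<^sup>k\<close> on the closure of the open set \<open>S\<close>: the partial derivatives up to order \<open>k\<close>
  extend continuously from \<open>S\<close>. Only the values of \<open>f\<close> in \<open>S\<close> matter.\<close>

definition Ck_closure :: "nat \<Rightarrow> plane set \<Rightarrow> (plane \<Rightarrow> real) \<Rightarrow> bool" where
  "Ck_closure k S f \<longleftrightarrow> Ck_on k S f \<and>
     (\<forall>a b. a + b \<le> k \<longrightarrow>
        (\<exists>g. continuous_on (closure S) g \<and> (\<forall>x\<in>S. g x = partial a b f x)))"

text \<open>\<open>g\<close> is a representative of class \<open>C\<^sup>k\<close> (up to the boundary) of the a.e.-class of \<open>f\<close> on \<open>S\<close>.
  It is unique on \<open>S\<close>, so \<open>Ck_rep\<close> is the function with which \<open>f\<close> is identified.\<close>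

definition Ck_version :: "nat \<Rightarrow> plane set \<Rightarrow> (plane \<Rightarrow> real) \<Rightarrow> (plane \<Rightarrow> real) \<Rightarrow> bool" where
  "Ck_version k S f g \<longleftrightarrow> Ck_closure k S g \<and> (AE x in lebesgue_on S. g x = f x)"

definition Ck_rep :: "nat \<Rightarrow> plane set \<Rightarrow> (plane \<Rightarrow> real) \<Rightarrow> plane \<Rightarrow> real" where
  "Ck_rep k S f = (SOME g. Ck_version k S f g)"

definition test_function :: "plane set \<Rightarrow> (plane \<Rightarrow> real) \<Rightarrow> bool" where
  "test_function S \<phi> \<longleftrightarrow> (\<forall>k. Ck_on k UNIV \<phi>) \<and>
     compact (closure {x. \<phi> x \<noteq> 0}) \<and> closure {x. \<phi> x \<noteq> 0} \<subseteq> S"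

definition L2_on :: "plane set \<Rightarrow> (plane \<Rightarrow> real) \<Rightarrow> bool" where
  "L2_on S f \<longleftrightarrow> f \<in> borel_measurable (lebesgue_on S) \<and>
     integrable (lebesgue_on S) (\<lambda>x. (f x)\<^sup>2)"

definition weak_partial ::
  "plane set \<Rightarrow> nat \<Rightarrow> nat \<Rightarrow> (plane \<Rightarrow> real) \<Rightarrow> (plane \<Rightarrow> real) \<Rightarrow> bool" where
  "weak_partial S a b f g \<longleftrightarrow> (\<forall>\<phi>. test_function S \<phi> \<longrightarrow>
     (LINT x|lebesgue_on S. f x * partial a b \<phi> x)
       = (- 1) ^ (a + b) * (LINT x|lebesgue_on S. g x * \<phi> x))"

definition sobolev :: "nat \<Rightarrow> plane set \<Rightarrow> (plane \<Rightarrow> real) set" where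
  "sobolev m S = {f. L2_on S f \<and>
     (\<forall>a b. a + b \<le> m \<longrightarrow> (\<exists>g. L2_on S g \<and> weak_partial S a b f g))}"

text \<open>Arc-length integral over the boundary curve parametrized by \<open>\<gamma> 0, \<dots>, \<gamma> (n - 1)\<close>.\<close>

definition tangent :: "(nat \<Rightarrow> real \<Rightarrow> plane) \<Rightarrow> nat \<Rightarrow> real \<Rightarrow> plane" where
  "tangent \<gamma> j t = vector_derivative (\<gamma> j) (at t within {0..1})"

definition boundary_integral ::
  "nat \<Rightarrow> (nat \<Rightarrow> real \<Rightarrow> plane) \<Rightarrow> (plane \<Rightarrow> real) \<Rightarrow> real" where
  "boundary_integral n \<gamma> h =
     (\<Sum>j<n. integral {0..1} (\<lambda>t. h (\<gamma> j t) * norm (tangent \<gamma> j t)))"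

text \<open>Zero boundary trace: the trace operator is the continuous extension to \<open>H\<^sup>1\<close> (with values in
  \<open>L\<^sup>2\<close> of the boundary) of the restriction of functions that are \<open>C\<^sup>1\<close> up to the boundary, so the
  trace vanishes iff some such sequence converges to \<open>f\<close> in \<open>H\<^sup>1\<close> and to \<open>0\<close> on the boundary.\<close>

definition zero_trace ::
  "nat \<Rightarrow> (nat \<Rightarrow> real \<Rightarrow> plane) \<Rightarrow> plane set \<Rightarrow> (plane \<Rightarrow> real) \<Rightarrow> bool" where
  "zero_trace n \<gamma> \<Omega> f \<longleftrightarrow> (\<exists>\<phi> g1 g2.
     L2_on \<Omega> g1 \<and> weak_partial \<Omega> 1 0 f g1 \<and>
     L2_on \<Omega> g2 \<and> weak_partial \<Omega> 0 1 f g2 \<and>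
     (\<forall>k::nat. Ck_closure 1 \<Omega> (\<phi> k) \<and> continuous_on (closure \<Omega>) (\<phi> k)) \<and>
     (\<lambda>k. LINT x|lebesgue_on \<Omega>. (\<phi> k x - f x)\<^sup>2) \<longlonglongrightarrow> 0 \<and>
     (\<lambda>k. LINT x|lebesgue_on \<Omega>. (partial 1 0 (\<phi> k) x - g1 x)\<^sup>2) \<longlonglongrightarrow> 0 \<and>
     (\<lambda>k. LINT x|lebesgue_on \<Omega>. (partial 0 1 (\<phi> k) x - g2 x)\<^sup>2) \<longlonglongrightarrow> 0 \<and>
     (\<lambda>k. boundary_integral n \<gamma> (\<lambda>x. (\<phi> k x)\<^sup>2)) \<longlonglongrightarrow> 0)"

definition sobolev_H10 ::
  "nat \<Rightarrow> (nat \<Rightarrow> real \<Rightarrow> plane) \<Rightarrow> plane set \<Rightarrow> (plane \<Rightarrow> real) set" where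
  "sobolev_H10 n \<gamma> \<Omega> = {f \<in> sobolev 1 \<Omega>. zero_trace n \<gamma> \<Omega> f}"

section \<open>Bivariate polynomials, as functions on the plane\<close>

definition Poly :: "nat \<Rightarrow> (plane \<Rightarrow> real) set" where
  "Poly d = {p. \<exists>c. \<forall>x. p x = (\<Sum>i\<le>d. \<Sum>j\<le>d - i. c i j * (x $ 1) ^ i * (x $ 2) ^ j)}"

text \<open>The units (and zero) of the polynomial ring are the members of \<open>Poly 0\<close>.\<close>

definition irreducible_Poly :: "(plane \<Rightarrow> real) \<Rightarrow> bool" where
  "irreducible_Poly q \<longleftrightarrow> q \<in> (\<Union>d. Poly d) \<and> q \<notin> Poly 0 \<and>
     (\<forall>a\<in>(\<Union>d. Poly d). \<forall>b\<in>(\<Union>d. Poly d).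
        q = (\<lambda>x. a x * b x) \<longrightarrow> a \<in> Poly 0 \<or> b \<in> Poly 0)"

section \<open>The domain\<close>

text \<open>The arcs are \<open>\<gamma> j\<close> for \<open>j < n\<close>, indexed from \<open>0\<close>, with corner points \<open>\<gamma> j 0\<close>.\<close>

abbreviation open_arc :: "(nat \<Rightarrow> real \<Rightarrow> plane) \<Rightarrow> nat \<Rightarrow> plane set" where
  "open_arc \<gamma> j \<equiv> \<gamma> j ` {0<..<1}"

abbreviation closed_arc :: "(nat \<Rightarrow> real \<Rightarrow> plane) \<Rightarrow> nat \<Rightarrow> plane set" where
  "closed_arc \<gamma> j \<equiv> \<gamma> j ` {0..1}"

definition rot90 :: "plane \<Rightarrow> plane" where
  "rot90 v = vector [- (v $ 2), v $ 1]"

definition complex_of_plane :: "plane \<Rightarrow> complex" where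
  "complex_of_plane v = Complex (v $ 1) (v $ 2)"

text \<open>For a counter-clockwise boundary, the internal angle at \<open>\<gamma> j 0\<close> is swept counter-clockwise
  from the outgoing tangent to the reversed incoming tangent. Both cusps, of angle \<open>0\<close> and \<open>2 * pi\<close>,
  get the value \<open>0\<close>.\<close>

definition internal_angle :: "nat \<Rightarrow> (nat \<Rightarrow> real \<Rightarrow> plane) \<Rightarrow> nat \<Rightarrow> real" where
  "internal_angle n \<gamma> j =
     Arg2pi (complex_of_plane (- tangent \<gamma> ((j + n - 1) mod n) 1) /
             complex_of_plane (tangent \<gamma> j 0))"

locale curved_domain =
  fixes n :: nat and \<Omega> :: "plane set"
    and \<gamma> :: "nat \<Rightarrow> real \<Rightarrow> plane" and q :: "nat \<Rightarrow> plane \<Rightarrow> real"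
  assumes n_pos: "n \<ge> 1"
    and domain: "open \<Omega>" "connected \<Omega>" "\<Omega> \<noteq> {}" "bounded \<Omega>" "simply_connected \<Omega>"
    and boundary: "frontier \<Omega> = (\<Union>j<n. closed_arc \<gamma> j)"
    and consecutive: "\<And>j. j < n \<Longrightarrow> \<gamma> j 1 = \<gamma> (Suc j mod n) 0"
    and simple: "\<And>j k s t. \<lbrakk>j < n; k < n; s \<in> {0..<1}; t \<in> {0..<1}; \<gamma> j s = \<gamma> k t\<rbrakk>
                   \<Longrightarrow> j = k \<and> s = t"
    and regular: "\<And>j. j < n \<Longrightarrow> \<gamma> j differentiable_on {0..1}"
                 "\<And>j. j < n \<Longrightarrow> continuous_on {0..1} (tangent \<gamma> j)"
                 "\<And>j t. \<lbrakk>j < n; t \<in> {0..1}\<rbrakk> \<Longrightarrow> tangent \<gamma> j t \<noteq> 0"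
    \<comment> \<open>the domain is on the left\<close>
    and counter_clockwise: "\<And>j t. \<lbrakk>j < n; t \<in> {0<..<1}\<rbrakk> \<Longrightarrow>
          \<exists>\<delta>>0. \<forall>\<epsilon>. 0 < \<epsilon> \<and> \<epsilon> < \<delta> \<longrightarrow> \<gamma> j t + \<epsilon> *\<^sub>R rot90 (tangent \<gamma> j t) \<in> \<Omega>"
    and angle: "\<And>j. j < n \<Longrightarrow> 0 < internal_angle n \<gamma> j \<and> internal_angle n \<gamma> j < 2 * pi"
    and q_quadratic: "\<And>j. j < n \<Longrightarrow> q j \<in> Poly 2 - Poly 1 \<and> irreducible_Poly (q j)"
    and q_zero: "\<And>j x. \<lbrakk>j < n; x \<in> open_arc \<gamma> j\<rbrakk> \<Longrightarrow> q j x = 0"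
    and q_gradient: "\<And>j x. \<lbrakk>j < n; x \<in> open_arc \<gamma> j\<rbrakk> \<Longrightarrow> gradient (q j) x \<noteq> 0"
    and q_near: "\<And>j x. \<lbrakk>j < n; x \<in> open_arc \<gamma> j\<rbrakk> \<Longrightarrow>
                   \<exists>\<epsilon>>0. \<forall>y \<in> \<Omega> \<inter> ball x \<epsilon>. q j y > 0"

section \<open>The triangulation\<close>

text \<open>\<open>Pie v j s t\<close> has the vertices \<open>v\<close>, \<open>\<gamma> j s\<close>, \<open>\<gamma> j t\<close>, the latter two being joined by
  the boundary segment \<open>\<gamma> j ` {s..t}\<close>.\<close>

datatype cell = Straight plane plane plane | is_pie: Pie plane nat real real

fun vertices :: "(nat \<Rightarrow> real \<Rightarrow> plane) \<Rightarrow> cell \<Rightarrow> plane set" where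
  "vertices \<gamma> (Straight a b c) = {a, b, c}"
| "vertices \<gamma> (Pie v j s t) = {v, \<gamma> j s, \<gamma> j t}"

text \<open>A straight edge is represented by the set of its endpoints.\<close>

fun straight_edges :: "(nat \<Rightarrow> real \<Rightarrow> plane) \<Rightarrow> cell \<Rightarrow> plane set set" where
  "straight_edges \<gamma> (Straight a b c) = {{a, b}, {b, c}, {a, c}}"
| "straight_edges \<gamma> (Pie v j s t) = {{v, \<gamma> j s}, {v, \<gamma> j t}}"

definition pie_boundary ::
  "(nat \<Rightarrow> real \<Rightarrow> plane) \<Rightarrow> plane \<Rightarrow> nat \<Rightarrow> real \<Rightarrow> real \<Rightarrow> plane set" where
  "pie_boundary \<gamma> v j s t =
     closed_segment v (\<gamma> j s) \<union> \<gamma> j ` {s..t} \<union> closed_segment (\<gamma> j t) v"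

fun region :: "(nat \<Rightarrow> real \<Rightarrow> plane) \<Rightarrow> cell \<Rightarrow> plane set" where
  "region \<gamma> (Straight a b c) = convex hull {a, b, c}"
| "region \<gamma> (Pie v j s t) = pie_boundary \<gamma> v j s t \<union> inside (pie_boundary \<gamma> v j s t)"

text \<open>The straight triangle with the same vertices (\<open>T\<^sup>*\<close> for pie-shaped \<open>T\<close>).\<close>

definition straightened :: "(nat \<Rightarrow> real \<Rightarrow> plane) \<Rightarrow> cell \<Rightarrow> plane set" where
  "straightened \<gamma> T = convex hull (vertices \<gamma> T)"

fun proper_cell :: "nat \<Rightarrow> (nat \<Rightarrow> real \<Rightarrow> plane) \<Rightarrow> cell \<Rightarrow> bool" where
  "proper_cell n \<gamma> (Straight a b c) \<longleftrightarrow> \<not> collinear {a, b, c}"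
| "proper_cell n \<gamma> (Pie v j s t) \<longleftrightarrow> j < n \<and> 0 \<le> s \<and> s < t \<and> t \<le> 1 \<and>
     \<not> collinear {v, \<gamma> j s, \<gamma> j t} \<and>
     closed_segment v (\<gamma> j s) \<inter> \<gamma> j ` {s..t} = {\<gamma> j s} \<and>
     closed_segment v (\<gamma> j t) \<inter> \<gamma> j ` {s..t} = {\<gamma> j t}"

definition share_edge :: "(nat \<Rightarrow> real \<Rightarrow> plane) \<Rightarrow> cell \<Rightarrow> cell \<Rightarrow> bool" where
  "share_edge \<gamma> T T' \<longleftrightarrow> T \<noteq> T' \<and> straight_edges \<gamma> T \<inter> straight_edges \<gamma> T' \<noteq> {}"

definition pies :: "cell set \<Rightarrow> cell set" where
  "pies \<T> = {T \<in> \<T>. is_pie T}"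

definition buffers :: "(nat \<Rightarrow> real \<Rightarrow> plane) \<Rightarrow> cell set \<Rightarrow> cell set" where
  "buffers \<gamma> \<T> = {T \<in> \<T>. \<not> is_pie T \<and> (\<exists>T'\<in>pies \<T>. share_edge \<gamma> T T')}"

definition ordinary :: "(nat \<Rightarrow> real \<Rightarrow> plane) \<Rightarrow> cell set \<Rightarrow> cell set" where
  "ordinary \<gamma> \<T> = \<T> - pies \<T> - buffers \<gamma> \<T>"

definition interior_vertices ::
  "plane set \<Rightarrow> (nat \<Rightarrow> real \<Rightarrow> plane) \<Rightarrow> cell set \<Rightarrow> plane set" where
  "interior_vertices \<Omega> \<gamma> \<T> = (\<Union>T\<in>\<T>. vertices \<gamma> T) \<inter> \<Omega>"

definition boundary_vertices ::
  "plane set \<Rightarrow> (nat \<Rightarrow> real \<Rightarrow> plane) \<Rightarrow> cell set \<Rightarrow> plane set" where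
  "boundary_vertices \<Omega> \<gamma> \<T> = (\<Union>T\<in>\<T>. vertices \<gamma> T) \<inter> frontier \<Omega>"

text \<open>Since all boundary arcs are curved, the interior edges are exactly the straight ones.
  Positivity of \<open>q j\<close> is required off the closed arc, because \<open>q j\<close> also vanishes at its endpoints.
  The assumption \<open>pie_disk\<close> says that there is a disk to inscribe; without it a cell might lie
  on the reflex side of its two straight edges. The vertices of a buffer triangle
  are listed with the boundary vertex first.\<close>

locale curved_triangulation = curved_domain n \<Omega> \<gamma> q
  for n :: nat and \<Omega> :: "plane set"
    and \<gamma> :: "nat \<Rightarrow> real \<Rightarrow> plane" and q :: "nat \<Rightarrow> plane \<Rightarrow> real" +
  fixes \<T> :: "cell set"
  assumes finite_cells: "finite \<T>"
    and proper: "\<And>T. T \<in> \<T> \<Longrightarrow> proper_cell n \<gamma> T"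
    and cover: "(\<Union>T\<in>\<T>. region \<gamma> T) = closure \<Omega>"
    and conforming: "\<And>T T'. \<lbrakk>T \<in> \<T>; T' \<in> \<T>; T \<noteq> T'\<rbrakk> \<Longrightarrow>
          region \<gamma> T \<inter> region \<gamma> T' = {} \<or>
          (\<exists>v \<in> vertices \<gamma> T \<inter> vertices \<gamma> T'. region \<gamma> T \<inter> region \<gamma> T' = {v}) \<or>
          (\<exists>a b. {a, b} \<in> straight_edges \<gamma> T \<inter> straight_edges \<gamma> T' \<and>
                 region \<gamma> T \<inter> region \<gamma> T' = closed_segment a b)"
    and cond_A: "\<And>j. j < n \<Longrightarrow> \<gamma> j 0 \<in> boundary_vertices \<Omega> \<gamma> \<T>"
    and cond_B: "\<And>T e. \<lbrakk>T \<in> \<T>; e \<in> straight_edges \<gamma> T\<rbrakk> \<Longrightarrow> \<not> e \<subseteq> frontier \<Omega>"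
    and cond_C: "\<And>T T'. \<lbrakk>T \<in> pies \<T>; T' \<in> pies \<T>\<rbrakk> \<Longrightarrow> \<not> share_edge \<gamma> T T'"
    and cond_D: "\<And>v j s t x. \<lbrakk>Pie v j s t \<in> \<T>; x \<in> region \<gamma> (Pie v j s t)\<rbrakk> \<Longrightarrow>
                   closed_segment v x \<subseteq> region \<gamma> (Pie v j s t)"
    and cond_E: "\<And>v j s t x. \<lbrakk>Pie v j s t \<in> \<T>; x \<in> region \<gamma> (Pie v j s t) - closed_arc \<gamma> j\<rbrakk> \<Longrightarrow>
                   q j x > 0"
    and cond_F: "\<And>T T'. \<lbrakk>T \<in> buffers \<gamma> \<T>; T' \<in> buffers \<gamma> \<T>\<rbrakk> \<Longrightarrow> \<not> share_edge \<gamma> T T'"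
    and buffer_vertices: "\<And>a b c. Straight a b c \<in> buffers \<gamma> \<T> \<Longrightarrow>
          a \<in> frontier \<Omega> \<and> b \<notin> frontier \<Omega> \<and> c \<notin> frontier \<Omega>"
    and buffer_edges: "\<And>a b c. Straight a b c \<in> buffers \<gamma> \<T> \<Longrightarrow>
          (\<exists>T\<in>pies \<T>. {a, b} \<in> straight_edges \<gamma> T) \<and> (\<exists>T\<in>pies \<T>. {a, c} \<in> straight_edges \<gamma> T)"
    and pie_disk: "\<And>T. T \<in> pies \<T> \<Longrightarrow> interior (region \<gamma> T \<inter> straightened \<gamma> T) \<noteq> {}"

section \<open>Auxiliary domains\<close>

definition lipschitz_boundary :: "plane set \<Rightarrow> bool" where
  "lipschitz_boundary S \<longleftrightarrow> (\<forall>x\<in>frontier S. \<exists>e r h L g.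
     norm e = 1 \<and> r > 0 \<and> h > 0 \<and> L-lipschitz_on {-r<..<r} g \<and>
     (\<forall>s\<in>{-r<..<r}. \<bar>g s\<bar> < h) \<and>
     (\<forall>s\<in>{-r<..<r}. \<forall>t\<in>{-h<..<h}.
        x + s *\<^sub>R rot90 e + t *\<^sub>R e \<in> S \<longleftrightarrow> t > g s) \<and>
     (\<forall>s\<in>{-r<..<r}. \<forall>t\<in>{-h<..<h}.
        x + s *\<^sub>R rot90 e + t *\<^sub>R e \<in> frontier S \<longleftrightarrow> t = (g s :: real)))"

text \<open>Conditions (a) and (c) are meant for the closed arc: the left-hand side in (a) is closed, and
  \<open>q j\<close> vanishes at the endpoints of the arc. In (b) the closure adds those endpoints of the
  segments that lie on the boundary of \<open>\<Omega>\<close>.\<close>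

locale auxiliary_domains = curved_triangulation n \<Omega> \<gamma> q \<T>
  for n :: nat and \<Omega> :: "plane set"
    and \<gamma> :: "nat \<Rightarrow> real \<Rightarrow> plane" and q :: "nat \<Rightarrow> plane \<Rightarrow> real" and \<T> :: "cell set" +
  fixes A :: "nat \<Rightarrow> plane set"
  assumes aux_domain: "\<And>j. j < n \<Longrightarrow> open (A j) \<and> connected (A j) \<and> A j \<noteq> {} \<and> A j \<subseteq> \<Omega>"
    and aux_lipschitz: "\<And>j. j < n \<Longrightarrow> lipschitz_boundary (A j)"
    and aux_a: "\<And>j. j < n \<Longrightarrow> frontier (A j) \<inter> frontier \<Omega> = closed_arc \<gamma> j"
    and aux_b: "\<And>j. j < n \<Longrightarrow> \<exists>F. finite F \<and>
                  closure (frontier (A j) - frontier \<Omega>) = (\<Union>(a, b)\<in>F. closed_segment a b)"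
    and aux_c: "\<And>j x. \<lbrakk>j < n; x \<in> closure (A j) - closed_arc \<gamma> j\<rbrakk> \<Longrightarrow> q j x > 0"
    and aux_d: "\<And>j k. \<lbrakk>j < n; k < n; j \<noteq> k\<rbrakk> \<Longrightarrow> A j \<inter> A k = {}"
    and aux_e: "\<And>v j s t. Pie v j s t \<in> \<T> \<Longrightarrow> region \<gamma> (Pie v j s t) \<subseteq> closure (A j)"
    and aux_f: "\<And>j x. \<lbrakk>j < n; x \<in> closure (A j)\<rbrakk> \<Longrightarrow> norm (gradient (q j) x) \<le> 1"
               "\<And>j x. j < n \<Longrightarrow> onorm ((*v) (hessian (q j) x)) \<le> 1"

section \<open>Spline spaces\<close>

definition S15 ::
  "plane set \<Rightarrow> (nat \<Rightarrow> real \<Rightarrow> plane) \<Rightarrow> cell set \<Rightarrow> (plane \<Rightarrow> real) set" where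
  "S15 \<Omega> \<gamma> \<T> = {s. Ck_on 1 \<Omega> s \<and>
     (\<forall>T\<in>ordinary \<gamma> \<T>. \<exists>p\<in>Poly 5. \<forall>x\<in>region \<gamma> T. s x = p x) \<and>
     (\<forall>T\<in>pies \<T> \<union> buffers \<gamma> \<T>. \<exists>p\<in>Poly 6. \<forall>x\<in>region \<gamma> T. s x = p x)}"

definition S125_I ::
  "plane set \<Rightarrow> (nat \<Rightarrow> real \<Rightarrow> plane) \<Rightarrow> cell set \<Rightarrow> (plane \<Rightarrow> real) set" where
  "S125_I \<Omega> \<gamma> \<T> = {s \<in> S15 \<Omega> \<gamma> \<T>.
     \<forall>v \<in> interior_vertices \<Omega> \<gamma> \<T>. gradient s differentiable (at v)}"

definition S125_0 ::
  "plane set \<Rightarrow> (nat \<Rightarrow> real \<Rightarrow> plane) \<Rightarrow> cell set \<Rightarrow> (plane \<Rightarrow> real) set" where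
  "S125_0 \<Omega> \<gamma> \<T> = {s \<in> S125_I \<Omega> \<gamma> \<T>. \<forall>x \<in> frontier \<Omega>. s x = 0}"

section \<open>Nodal functionals\<close>

text \<open>A functional is applied to an open set \<open>S\<close> and a function on \<open>S\<close> whose relevant derivatives
  extend continuously to the closure of \<open>S\<close>; at points of the closure it evaluates the extension.
  For polynomials, \<open>S = UNIV\<close>.\<close>

type_synonym nodal = "plane set \<Rightarrow> (plane \<Rightarrow> real) \<Rightarrow> real"

definition eval_partial :: "nat \<Rightarrow> nat \<Rightarrow> plane \<Rightarrow> nodal" where
  "eval_partial a b x S f = Lim (at x within S) (partial a b f)"

definition eval_dir :: "plane \<Rightarrow> plane \<Rightarrow> nodal" where
  "eval_dir d x S f = Lim (at x within S) (dir_deriv d f)"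

definition jet :: "nat \<Rightarrow> plane \<Rightarrow> nodal set" where
  "jet k x = {eval_partial a b x | a b. a + b \<le> k}"

definition edge_point :: "nat \<Rightarrow> plane \<Rightarrow> plane \<Rightarrow> plane" where
  "edge_point i a b = a + (real i / 4) *\<^sub>R (b - a)"

text \<open>\<open>\<nu> e\<close> is the unit normal vector chosen for the edge \<open>e\<close>.\<close>

definition edge_normals ::
  "(nat \<Rightarrow> real \<Rightarrow> plane) \<Rightarrow> cell set \<Rightarrow> (plane set \<Rightarrow> plane) \<Rightarrow> bool" where
  "edge_normals \<gamma> \<T> \<nu> \<longleftrightarrow> (\<forall>T\<in>\<T>. \<forall>a b. {a, b} \<in> straight_edges \<gamma> T \<longrightarrow>
     norm (\<nu> {a, b}) = 1 \<and> \<nu> {a, b} \<bullet> (b - a) = 0)"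

definition N_ordinary ::
  "(plane set \<Rightarrow> plane) \<Rightarrow> plane \<Rightarrow> plane \<Rightarrow> plane \<Rightarrow> nodal set" where
  "N_ordinary \<nu> v1 v2 v3 = jet 2 v1 \<union> jet 2 v2 \<union> jet 2 v3 \<union>
     {eval_dir (\<nu> {v1, v2}) (edge_point 2 v1 v2),
      eval_dir (\<nu> {v2, v3}) (edge_point 2 v2 v3),
      eval_dir (\<nu> {v1, v3}) (edge_point 2 v1 v3)}"

text \<open>The inscribed disk is the largest one contained in \<open>R\<close>; for the regions considered here it is
  unique.\<close>

definition inscribed_center :: "plane set \<Rightarrow> plane" where
  "inscribed_center R = (SOME c. \<exists>r. cball c r \<subseteq> R \<and> (\<forall>c' r'. cball c' r' \<subseteq> R \<longrightarrow> r' \<le> r))"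

definition N_pie :: "(nat \<Rightarrow> real \<Rightarrow> plane) \<Rightarrow> plane \<Rightarrow> nat \<Rightarrow> real \<Rightarrow> real \<Rightarrow> nodal set" where
  "N_pie \<gamma> v j s t = jet 2 v \<union> jet 1 (\<gamma> j s) \<union> jet 1 (\<gamma> j t) \<union>
     jet 1 (inscribed_center (region \<gamma> (Pie v j s t) \<inter> straightened \<gamma> (Pie v j s t)))"

definition N_edge :: "(plane set \<Rightarrow> plane) \<Rightarrow> plane \<Rightarrow> plane \<Rightarrow> nodal set" where
  "N_edge \<nu> a b = {eval_partial 0 0 (edge_point 2 a b),
     eval_dir (\<nu> {a, b}) (edge_point 1 a b), eval_dir (\<nu> {a, b}) (edge_point 3 a b)}"

section \<open>The interpolation operator\<close>

definition I_ordinary ::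
  "plane set \<Rightarrow> (plane set \<Rightarrow> plane) \<Rightarrow> (plane \<Rightarrow> real) \<Rightarrow> plane \<Rightarrow> plane \<Rightarrow> plane
     \<Rightarrow> plane \<Rightarrow> real" where
  "I_ordinary \<Omega> \<nu> u v1 v2 v3 = (THE p. p \<in> Poly 5 \<and>
     (\<forall>\<eta> \<in> N_ordinary \<nu> v1 v2 v3. \<eta> UNIV p = \<eta> \<Omega> (Ck_rep 3 \<Omega> u)))"

definition I_pie ::
  "(nat \<Rightarrow> real \<Rightarrow> plane) \<Rightarrow> (nat \<Rightarrow> plane \<Rightarrow> real) \<Rightarrow> (nat \<Rightarrow> plane set) \<Rightarrow> (plane \<Rightarrow> real)
     \<Rightarrow> plane \<Rightarrow> nat \<Rightarrow> real \<Rightarrow> real \<Rightarrow> plane \<Rightarrow> real" where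
  "I_pie \<gamma> q A u v j s t = (\<lambda>x.
     (THE p. p \<in> Poly 4 \<and>
        (\<forall>\<eta> \<in> N_pie \<gamma> v j s t. \<eta> UNIV p = \<eta> (A j) (Ck_rep 2 (A j) (\<lambda>x. u x / q j x)))) x
     * q j x)"

fun I_outer ::
  "plane set \<Rightarrow> (nat \<Rightarrow> real \<Rightarrow> plane) \<Rightarrow> (nat \<Rightarrow> plane \<Rightarrow> real) \<Rightarrow> (nat \<Rightarrow> plane set)
     \<Rightarrow> (plane set \<Rightarrow> plane) \<Rightarrow> (plane \<Rightarrow> real) \<Rightarrow> cell \<Rightarrow> plane \<Rightarrow> real" where
  "I_outer \<Omega> \<gamma> q A \<nu> u (Straight v1 v2 v3) = I_ordinary \<Omega> \<nu> u v1 v2 v3"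
| "I_outer \<Omega> \<gamma> q A \<nu> u (Pie v j s t) = I_pie \<gamma> q A u v j s t"

definition I_buffer ::
  "plane set \<Rightarrow> (nat \<Rightarrow> real \<Rightarrow> plane) \<Rightarrow> (nat \<Rightarrow> plane \<Rightarrow> real) \<Rightarrow> (nat \<Rightarrow> plane set)
     \<Rightarrow> cell set \<Rightarrow> (plane set \<Rightarrow> plane) \<Rightarrow> (plane \<Rightarrow> real) \<Rightarrow> plane \<Rightarrow> plane \<Rightarrow> plane
     \<Rightarrow> plane \<Rightarrow> real" where
  "I_buffer \<Omega> \<gamma> q A \<T> \<nu> u v1 v2 v3 =
     (let T1 = (THE T. T \<in> ordinary \<gamma> \<T> \<and> {v2, v3} \<in> straight_edges \<gamma> T);
          T2 = (THE T. T \<in> pies \<T> \<and> {v1, v2} \<in> straight_edges \<gamma> T);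
          T3 = (THE T. T \<in> pies \<T> \<and> {v1, v3} \<in> straight_edges \<gamma> T);
          I = I_outer \<Omega> \<gamma> q A \<nu> u;
          c = (1 / 3) *\<^sub>R (v1 + v2 + v3)
      in THE p. p \<in> Poly 6 \<and> p c = eval_partial 0 0 c \<Omega> (Ck_rep 3 \<Omega> u) \<and>
           (\<forall>\<eta> \<in> N_edge \<nu> v2 v3 \<union> jet 2 v2 \<union> jet 2 v3. \<eta> UNIV p = \<eta> UNIV (I T1)) \<and>
           (\<forall>\<eta> \<in> N_edge \<nu> v1 v2 \<union> jet 2 v1. \<eta> UNIV p = \<eta> UNIV (I T2)) \<and>
           (\<forall>\<eta> \<in> N_edge \<nu> v1 v3. \<eta> UNIV p = \<eta> UNIV (I T3)))"

fun I_cell ::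
  "plane set \<Rightarrow> (nat \<Rightarrow> real \<Rightarrow> plane) \<Rightarrow> (nat \<Rightarrow> plane \<Rightarrow> real) \<Rightarrow> (nat \<Rightarrow> plane set)
     \<Rightarrow> cell set \<Rightarrow> (plane set \<Rightarrow> plane) \<Rightarrow> (plane \<Rightarrow> real) \<Rightarrow> cell \<Rightarrow> plane \<Rightarrow> real" where
  "I_cell \<Omega> \<gamma> q A \<T> \<nu> u (Pie v j s t) = I_pie \<gamma> q A u v j s t"
| "I_cell \<Omega> \<gamma> q A \<T> \<nu> u (Straight v1 v2 v3) =
     (if Straight v1 v2 v3 \<in> buffers \<gamma> \<T> then I_buffer \<Omega> \<gamma> q A \<T> \<nu> u v1 v2 v3
      else I_ordinary \<Omega> \<nu> u v1 v2 v3)"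

text \<open>At points common to several cells an arbitrary one of them is used. Membership of the result
  in \<open>S15\<close> includes that this choice is immaterial, since splines agree with a polynomial on each
  closed cell.\<close>

definition I_tri ::
  "plane set \<Rightarrow> (nat \<Rightarrow> real \<Rightarrow> plane) \<Rightarrow> (nat \<Rightarrow> plane \<Rightarrow> real) \<Rightarrow> (nat \<Rightarrow> plane set)
     \<Rightarrow> cell set \<Rightarrow> (plane set \<Rightarrow> plane) \<Rightarrow> (plane \<Rightarrow> real) \<Rightarrow> plane \<Rightarrow> real" where
  "I_tri \<Omega> \<gamma> q A \<T> \<nu> u x =
     I_cell \<Omega> \<gamma> q A \<T> \<nu> u (SOME T. T \<in> \<T> \<and> x \<in> region \<gamma> T) x"

end

theory Submission
  imports Defs
begin

text \<open>Why the interpolant is a spline of class \<open>C\<^sup>1\<close> that vanishes on the boundary.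

Every piece is defined by as many functionals as its polynomial space has dimensions, so it exists and
is unique once a polynomial annihilated by all of them is shown to be zero
(\<open>unisolvent_interpolation\<close>). On straight triangles this holds because a polynomial that vanishes to
first order on the three edges is a multiple of the squared product of the barycentric coordinates
(\<open>C1_zero_on_edges\<close>), which has degree 6; on pie-shaped triangles a quadratic factor has to be
excluded (\<open>pie_unisolvent\<close>).

The central fact is \<open>piece_jet\<close>: at each of its vertices, a piece has the derivatives up to order two
of \<open>u\<close>, extended continuously from \<open>\<Omega>\<close>. On an ordinary triangle they are prescribed, and a buffer
triangle copies them from its neighbours. On a pie-shaped triangle the piece is \<open>p q\<^sub>j\<close>, whereas
\<open>u = w q\<^sub>j\<close> with \<open>w = u / q\<^sub>j\<close>. At the interior vertex \<open>p\<close> and \<open>w\<close> have the same derivatives up to order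
two. At the boundary vertices only the first derivatives are interpolated, but \<open>q\<^sub>j\<close> vanishes there
and removes the second derivatives of \<open>p\<close> and \<open>w\<close> from the Leibniz rule (\<open>jet_of_product\<close>). This covers
corners of \<open>\<Omega>\<close> where pie-shaped triangles of different conics meet.

Hence the difference of the pieces of two cells with a common edge has vanishing derivatives up to
order two at the endpoints of the edge, and the data inside the edge make it vanish to first order on
the whole edge (\<open>edge_zero_C1_degree_5\<close>, \<open>edge_zero_C1_degree_6\<close>). The two cells do use the same data:
pie-shaped triangles have only buffer triangles as neighbours, and the edge of a buffer triangle opposite
to the boundary belongs to exactly one ordinary triangle (\<open>ordinary_neighbour_of_buffer\<close>). The cells
being finitely many closed sets, agreement of the first derivatives at all common points makes the
interpolant continuously differentiable (\<open>has_derivative_finite_closed_cover\<close>), and the agreement of the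
second derivatives at the vertices makes its gradient differentiable there.

On a pie-shaped triangle the interpolant contains the factor \<open>q\<^sub>j\<close>, which is zero where the triangle
meets the boundary. A point of an open arc outside all pie-shaped triangles lies on an edge of a straight
triangle, because \<open>q\<^sub>j\<close> takes negative values next to it, and an irreducible conic has only finitely many
points on each of these finitely many edges. So the interpolant vanishes on each arc up to finitely many
points, and there by continuity.\<close>

section \<open>Bivariate polynomials\<close>

lemma Poly_iff_index:
  "p \<in> Poly d \<longleftrightarrow> (\<exists>c. \<forall>x. p x = (\<Sum>(i, j)\<in>Sigma {..d} (\<lambda>i. {..d - i}). c i j * (x $ 1) ^ i * (x $ 2) ^ j))"
  unfolding Poly_def by (simp add: sum.Sigma)

lemma Poly_add:
  assumes "f \<in> Poly d" "g \<in> Poly d" shows "(\<lambda>x. f x + g x) \<in> Poly d"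
proof -
  obtain c where c: "\<And>x. f x = (\<Sum>i\<le>d. \<Sum>j\<le>d - i. c i j * (x $ 1) ^ i * (x $ 2) ^ j)"
    using assms(1) unfolding Poly_def by blast
  obtain e where e: "\<And>x. g x = (\<Sum>i\<le>d. \<Sum>j\<le>d - i. e i j * (x $ 1) ^ i * (x $ 2) ^ j)"
    using assms(2) unfolding Poly_def by blast
  have "f x + g x = (\<Sum>i\<le>d. \<Sum>j\<le>d - i. (c i j + e i j) * (x $ 1) ^ i * (x $ 2) ^ j)" for x
    unfolding c e by (simp add: distrib_right sum.distrib)
  then show ?thesis unfolding Poly_def by (intro CollectI exI[of _ "\<lambda>i j. c i j + e i j"]) simp
qed

lemma Poly_scale:
  assumes "f \<in> Poly d" shows "(\<lambda>x. k * f x) \<in> Poly d"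
proof -
  obtain c where c: "\<And>x. f x = (\<Sum>i\<le>d. \<Sum>j\<le>d - i. c i j * (x $ 1) ^ i * (x $ 2) ^ j)"
    using assms(1) unfolding Poly_def by blast
  have "k * f x = (\<Sum>i\<le>d. \<Sum>j\<le>d - i. (k * c i j) * (x $ 1) ^ i * (x $ 2) ^ j)" for x
    unfolding c by (simp add: sum_distrib_left mult.assoc)
  then show ?thesis unfolding Poly_def by (intro CollectI exI[of _ "\<lambda>i j. k * c i j"]) simp
qed

lemma Poly_zero: "(\<lambda>x. 0) \<in> Poly d"
  unfolding Poly_def by (rule CollectI, rule exI[of _ "\<lambda>i j. 0"]) simp

lemma Poly_monomial:
  assumes "i + j \<le> d" shows "(\<lambda>x. (x $ 1) ^ i * (x $ 2) ^ j) \<in> Poly d"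
proof -
  let ?c = "\<lambda>k l. if k = i \<and> l = j then 1 else 0 :: real"
  have "(x $ 1) ^ i * (x $ 2) ^ j = (\<Sum>(k, l)\<in>Sigma {..d} (\<lambda>i. {..d - i}). ?c k l * (x $ 1) ^ k * (x $ 2) ^ l)"
    for x :: plane
  proof -
    have "(\<Sum>(k, l)\<in>Sigma {..d} (\<lambda>i. {..d - i}). ?c k l * (x $ 1) ^ k * (x $ 2) ^ l)
        = (\<Sum>z\<in>Sigma {..d} (\<lambda>i. {..d - i}). if z = (i, j) then (x $ 1) ^ i * (x $ 2) ^ j else 0)"
      by (rule sum.cong) (auto split: if_splits)
    also have "\<dots> = (x $ 1) ^ i * (x $ 2) ^ j"
      using assms by (subst sum.delta) auto
    finally show ?thesis by simp
  qed
  then show ?thesis unfolding Poly_iff_index by (intro exI[of _ ?c]) blast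
qed

lemma Poly_sum:
  assumes "finite I" "\<And>i. i \<in> I \<Longrightarrow> f i \<in> Poly d"
  shows "(\<lambda>x. \<Sum>i\<in>I. f i x) \<in> Poly d"
  using assms by (induction I rule: finite_induct) (auto intro: Poly_zero Poly_add)

text \<open>With this principle, closure under products and under differentiation and the symmetry of second
derivatives are checked on monomials, without any rearrangement of coefficient arrays.\<close>

lemma Poly_induct [consumes 1, case_names zero monomial add scale]:
  assumes p: "p \<in> Poly d" and zero: "P (\<lambda>x. 0)"
    and monomial: "\<And>i j. i + j \<le> d \<Longrightarrow> P (\<lambda>x. (x $ 1) ^ i * (x $ 2) ^ j)"
    and add: "\<And>f g. \<lbrakk>f \<in> Poly d; g \<in> Poly d; P f; P g\<rbrakk> \<Longrightarrow> P (\<lambda>x. f x + g x)"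
    and scale: "\<And>k f. \<lbrakk>f \<in> Poly d; P f\<rbrakk> \<Longrightarrow> P (\<lambda>x. k * f x)"
  shows "P p"
proof -
  obtain c where c: "\<And>x. p x = (\<Sum>(i, j)\<in>Sigma {..d} (\<lambda>i. {..d - i}). c i j * (x $ 1) ^ i * (x $ 2) ^ j)"
    using p unfolding Poly_iff_index by blast
  let ?m = "\<lambda>z x. c (fst z) (snd z) * ((x $ 1) ^ fst z * (x $ 2) ^ snd z) :: real"
  have m: "?m z \<in> Poly d \<and> P (?m z)" if "z \<in> Sigma {..d} (\<lambda>i. {..d - i})" for z
  proof -
    have "fst z + snd z \<le> d" using that by auto
    then show ?thesis
      using scale[OF Poly_monomial monomial] Poly_scale[OF Poly_monomial] by presburger
  qed
  have "P (\<lambda>x. \<Sum>z\<in>J. ?m z x) \<and> (\<lambda>x. \<Sum>z\<in>J. ?m z x) \<in> Poly d"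
    if "finite J" "J \<subseteq> Sigma {..d} (\<lambda>i. {..d - i})" for J
    using that
  proof (induction J rule: finite_induct)
    case empty then show ?case by (simp add: zero Poly_zero)
  next
    case (insert z J)
    then have J: "P (\<lambda>x. \<Sum>z\<in>J. ?m z x)" "(\<lambda>x. \<Sum>z\<in>J. ?m z x) \<in> Poly d"
      and z: "P (?m z)" "?m z \<in> Poly d" using m[of z] by auto
    show ?case using add[OF z(2) J(2) z(1) J(1)] Poly_add[OF z(2) J(2)] insert(1,2) by simp
  qed
  from this[of "Sigma {..d} (\<lambda>i. {..d - i})"]
  have "P (\<lambda>x. \<Sum>z\<in>Sigma {..d} (\<lambda>i. {..d - i}). ?m z x)" by simp
  moreover have "p = (\<lambda>x. \<Sum>z\<in>Sigma {..d} (\<lambda>i. {..d - i}). ?m z x)"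
    using c by (auto simp: fun_eq_iff split_def mult.assoc)
  ultimately show ?thesis by simp
qed

lemma Poly_mono: assumes "p \<in> Poly d" "d \<le> e" shows "p \<in> Poly e"
  using assms(1)
proof (induction rule: Poly_induct)
  case (monomial i j) then show ?case using assms(2) by (intro Poly_monomial) simp
next
  case zero show ?case by (rule Poly_zero)
next
  case (add f g) then show ?case by (simp add: Poly_add)
next
  case (scale k f) then show ?case by (simp add: Poly_scale)
qed

lemma Poly_diff: "f \<in> Poly d \<Longrightarrow> g \<in> Poly d \<Longrightarrow> (\<lambda>x. f x - g x) \<in> Poly d"
  using Poly_add[of f d "\<lambda>x. -1 * g x"] Poly_scale[of g d "-1"] by simp

lemma Poly_const: "(\<lambda>x. k) \<in> Poly d"
  using Poly_scale[OF Poly_monomial[of 0 0 d], of k] by simp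

lemma Poly_coord: "1 \<le> d \<Longrightarrow> (\<lambda>x. x $ 1) \<in> Poly d" "1 \<le> d \<Longrightarrow> (\<lambda>x. x $ 2) \<in> Poly d"
  using Poly_monomial[of 1 0 d] Poly_monomial[of 0 1 d] by simp_all

lemma Poly_mult:
  assumes "f \<in> Poly d" "g \<in> Poly e" shows "(\<lambda>x. f x * g x) \<in> Poly (d + e)"
  using assms(1)
proof (induction rule: Poly_induct)
  case zero then show ?case by (simp add: Poly_zero)
next
  case (monomial i j)
  show ?case using assms(2)
  proof (induction rule: Poly_induct)
    case zero then show ?case by (simp add: Poly_zero)
  next
    case (monomial k l)
    have "(\<lambda>x. (x $ 1) ^ i * (x $ 2) ^ j * ((x $ 1) ^ k * (x $ 2) ^ l))
      = (\<lambda>x::plane. (x $ 1) ^ (i + k) * (x $ 2) ^ (j + l))"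
      by (simp add: fun_eq_iff power_add)
    then show ?case using Poly_monomial[of "i + k" "j + l" "d + e"] \<open>i + j \<le> d\<close> monomial by simp
  next
    case (add f g) then show ?case by (simp add: distrib_left Poly_add)
  next
    case (scale k f) then show ?case using Poly_scale[OF scale(2), of k] by (simp add: mult.left_commute)
  qed
next
  case (add f g) then show ?case by (simp add: distrib_right Poly_add)
next
  case (scale k f) then show ?case using Poly_scale[OF scale(2), of k] by (simp add: mult.assoc)
qed

lemma Poly_power:
  assumes "f \<in> Poly 1" shows "(\<lambda>x. f x ^ n) \<in> Poly n"
proof (induction n)
  case 0 then show ?case using Poly_const[of 1 0] by simp
next
  case (Suc n) show ?case using Poly_mult[OF assms Suc] by simp
qed

lemma Poly_affine_compose:
  assumes "p \<in> Poly d" "f \<in> Poly 1" "g \<in> Poly 1"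
  shows "(\<lambda>x. p (vector [f x, g x])) \<in> Poly d"
  using assms(1)
proof (induction rule: Poly_induct)
  case (monomial i j)
  then show ?case
    using Poly_mono[OF Poly_mult[OF Poly_power[OF assms(2)] Poly_power[OF assms(3)], of i j]] by simp
next
  case zero show ?case by (rule Poly_zero)
next
  case (add f g) then show ?case by (simp add: Poly_add)
next
  case (scale k f) then show ?case by (simp add: Poly_scale)
qed

text \<open>In the affine coordinates of a triangle, conditions on the two edges at the vertex \<open>a\<close> concern single
rows and columns of the coefficient array. The vectors \<open>e\<close> and \<open>f\<close> may also be dependent; \<open>f = 0\<close> gives
the restriction to a line.\<close>

lemma Poly_affine_coordinates:
  assumes "p \<in> Poly d"
  obtains c where "\<And>s t. p (a + s *\<^sub>R e + t *\<^sub>R f) = (\<Sum>i\<le>d. \<Sum>j\<le>d - i. c i j * s ^ i * t ^ j)"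
proof -
  have k: "(\<lambda>y::plane. a $ k + y $ 1 * e $ k + y $ 2 * f $ k) \<in> Poly 1" for k
    using Poly_add[OF Poly_add[OF Poly_const[of "a $ k"] Poly_scale[OF Poly_coord(1), of _ "e $ k"]] Poly_scale[OF Poly_coord(2), of _ "f $ k"]]
    by (simp add: mult.commute)
  have "(\<lambda>y. p (vector [a $ 1 + y $ 1 * e $ 1 + y $ 2 * f $ 1, a $ 2 + y $ 1 * e $ 2 + y $ 2 * f $ 2])) \<in> Poly d"
    by (rule Poly_affine_compose[OF assms k k])
  then obtain c where c: "\<And>y::plane. p (vector [a $ 1 + y $ 1 * e $ 1 + y $ 2 * f $ 1, a $ 2 + y $ 1 * e $ 2 + y $ 2 * f $ 2])
     = (\<Sum>i\<le>d. \<Sum>j\<le>d - i. c i j * (y $ 1) ^ i * (y $ 2) ^ j)" unfolding Poly_def by blast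
  have "p (a + s *\<^sub>R e + t *\<^sub>R f) = (\<Sum>i\<le>d. \<Sum>j\<le>d - i. c i j * s ^ i * t ^ j)" for s t
  proof -
    have "a + s *\<^sub>R e + t *\<^sub>R f = vector [a $ 1 + s * e $ 1 + t * f $ 1, a $ 2 + s * e $ 2 + t * f $ 2]"
      by (simp add: vec_eq_iff forall_2)
    then show ?thesis using c[of "vector [s, t]"] by simp
  qed
  then show ?thesis by (rule that)
qed

lemma Poly_restrict_line:
  assumes "p \<in> Poly d"
  obtains c where "\<And>t. p (a + t *\<^sub>R e) = (\<Sum>i\<le>d. c i * t ^ i)"
proof -
  obtain c where c: "\<And>s t. p (a + s *\<^sub>R e + t *\<^sub>R 0) = (\<Sum>i\<le>d. \<Sum>j\<le>d - i. c i j * s ^ i * t ^ j)"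
    using Poly_affine_coordinates[OF assms, of a e 0] by blast
  have "p (a + s *\<^sub>R e) = (\<Sum>i\<le>d. c i 0 * s ^ i)" for s
  proof -
    have "(\<Sum>j\<le>d - i. c i j * s ^ i * 0 ^ j) = c i 0 * s ^ i" for i
      by (subst sum.atMost_shift) simp
    then show ?thesis using c[of s 0] by simp
  qed
  then show ?thesis by (rule that)
qed

lemma Poly_coefficients_zero:
  assumes "\<And>x::plane. (\<Sum>i\<le>d. \<Sum>j\<le>d - i. c i j * (x $ 1) ^ i * (x $ 2) ^ j) = 0"
    and "i \<le> d" "j \<le> d - i"
  shows "c i j = (0::real)"
proof -
  have *: "\<forall>i\<le>d. (\<Sum>j\<le>d - i. c i j * t ^ j) = 0" for t
  proof -
    have "\<forall>s. (\<Sum>i\<le>d. (\<Sum>j\<le>d - i. c i j * t ^ j) * s ^ i) = 0"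
      using assms(1)[of "vector [s, t]" for s] by (simp add: sum_distrib_left sum_distrib_right mult_ac)
    then show ?thesis unfolding Transcendental.polyfun_eq_0 by blast
  qed
  then have "\<forall>t. (\<Sum>j\<le>d - i. c i j * t ^ j) = 0" using assms(2) by blast
  then show ?thesis unfolding Transcendental.polyfun_eq_0 using assms(3) by blast
qed

section \<open>Derivatives of polynomials\<close>

lemma dir_deriv_at: "(f has_derivative f') (at x) \<Longrightarrow> dir_deriv d f x = f' d"
  unfolding dir_deriv_def by (metis frechet_derivative_at)

lemma Poly_has_gradient:
  assumes "p \<in> Poly d"
  shows "\<exists>p1\<in>Poly (d - 1). \<exists>p2\<in>Poly (d - 1). \<forall>x. (p has_derivative (\<lambda>h. h $ 1 * p1 x + h $ 2 * p2 x)) (at x)"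
  using assms
proof (induction rule: Poly_induct)
  case zero
  show ?case by (rule bexI[OF _ Poly_zero], rule bexI[OF _ Poly_zero]) auto
next
  case (monomial i j)
  let ?p1 = "\<lambda>x::plane. real i * ((x $ 1) ^ (i - 1) * (x $ 2) ^ j)"
  let ?p2 = "\<lambda>x::plane. real j * ((x $ 1) ^ i * (x $ 2) ^ (j - 1))"
  have 1: "?p1 \<in> Poly (d - 1)"
  proof (cases "i = 0")
    case True then show ?thesis by (simp add: Poly_zero)
  next
    case False then show ?thesis using monomial by (intro Poly_scale Poly_monomial) auto
  qed
  have 2: "?p2 \<in> Poly (d - 1)"
  proof (cases "j = 0")
    case True then show ?thesis by (simp add: Poly_zero)
  next
    case False then show ?thesis using monomial by (intro Poly_scale Poly_monomial) auto
  qed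
  have c: "((\<lambda>x::plane. x $ k) has_derivative (\<lambda>h. h $ k)) (at x)" for k x
    by (rule bounded_linear_imp_has_derivative[OF bounded_linear_vec_nth])
  have "((\<lambda>x. (x $ 1) ^ i * (x $ 2) ^ j) has_derivative (\<lambda>h. h $ 1 * ?p1 x + h $ 2 * ?p2 x)) (at x)" for x :: plane
    by (rule has_derivative_eq_rhs[OF has_derivative_mult[OF has_derivative_power[OF c] has_derivative_power[OF c]]])
       (simp add: fun_eq_iff algebra_simps)
  then show ?case by (intro bexI[OF _ 1] bexI[OF _ 2] allI)
next
  case (add f g)
  from add.IH(1) obtain f1 f2 where
    f: "f1 \<in> Poly (d - 1)" "f2 \<in> Poly (d - 1)" "\<And>x. (f has_derivative (\<lambda>h. h $ 1 * f1 x + h $ 2 * f2 x)) (at x)"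
    by blast
  from add.IH(2) obtain g1 g2 where
    g: "g1 \<in> Poly (d - 1)" "g2 \<in> Poly (d - 1)" "\<And>x. (g has_derivative (\<lambda>h. h $ 1 * g1 x + h $ 2 * g2 x)) (at x)" by blast
  show ?case
    by (rule bexI[OF _ Poly_add[OF f(1) g(1)]], rule bexI[OF _ Poly_add[OF f(2) g(2)]], rule allI,
        rule has_derivative_eq_rhs[OF has_derivative_add[OF f(3) g(3)]]) (simp add: fun_eq_iff algebra_simps)
next
  case (scale k f)
  then obtain f1 f2 where
    f: "f1 \<in> Poly (d - 1)" "f2 \<in> Poly (d - 1)" "\<And>x. (f has_derivative (\<lambda>h. h $ 1 * f1 x + h $ 2 * f2 x)) (at x)" by blast
  show ?case
    by (rule bexI[OF _ Poly_scale[OF f(1), of k]], rule bexI[OF _ Poly_scale[OF f(2), of k]], rule allI,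
        rule has_derivative_eq_rhs[OF has_derivative_mult_right[OF f(3)]]) (simp add: fun_eq_iff algebra_simps)
qed

lemma axis_simps [simp]:
  "axis 1 1 $ (1::2) = (1::real)" "axis 1 1 $ (2::2) = (0::real)"
  "axis 2 1 $ (1::2) = (0::real)" "axis 2 1 $ (2::2) = (1::real)"
  by (simp_all add: axis_def)

lemma partial_simps:
  "partial 0 0 f = f" "partial 1 0 f = dir_deriv (axis 1 1) f" "partial 0 1 f = dir_deriv (axis 2 1) f"
  "partial 2 0 f = dir_deriv (axis 1 1) (dir_deriv (axis 1 1) f)"
  "partial 1 1 f = dir_deriv (axis 1 1) (dir_deriv (axis 2 1) f)"
  "partial 0 2 f = dir_deriv (axis 2 1) (dir_deriv (axis 2 1) f)"
  "partial (Suc 0) 0 f = dir_deriv (axis 1 1) f" "partial 0 (Suc 0) f = dir_deriv (axis 2 1) f"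
  "partial (Suc 0) (Suc 0) f = dir_deriv (axis 1 1) (dir_deriv (axis 2 1) f)"
  by (simp_all add: partial_def numeral_2_eq_2)

lemma Poly_has_derivative:
  assumes "p \<in> Poly d"
  shows "(p has_derivative (\<lambda>h. h $ 1 * partial 1 0 p x + h $ 2 * partial 0 1 p x)) (at x)"
proof -
  obtain p1 p2 where "\<And>x. (p has_derivative (\<lambda>h. h $ 1 * p1 x + h $ 2 * p2 x)) (at x)"
    using Poly_has_gradient[OF assms] by blast
  note h = this[of x]
  show ?thesis using h by (simp add: partial_simps dir_deriv_at[OF h])
qed

lemma dir_deriv_Poly:
  assumes "p \<in> Poly d"
  shows "dir_deriv e p x = e $ 1 * partial 1 0 p x + e $ 2 * partial 0 1 p x"
  by (rule dir_deriv_at[OF Poly_has_derivative[OF assms]])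

lemma Poly_has_derivative_dir: "p \<in> Poly d \<Longrightarrow> (p has_derivative (\<lambda>h. dir_deriv h p x)) (at x)"
  using Poly_has_derivative[of p d x] by (simp only: dir_deriv_Poly[of p d])

lemma Poly_dir_deriv:
  assumes "p \<in> Poly d" shows "dir_deriv e p \<in> Poly (d - 1)"
proof -
  obtain p1 p2 where p: "p1 \<in> Poly (d - 1)" "p2 \<in> Poly (d - 1)"
     "\<And>x. (p has_derivative (\<lambda>h. h $ 1 * p1 x + h $ 2 * p2 x)) (at x)"
    using Poly_has_gradient[OF assms] by blast
  have "dir_deriv e p = (\<lambda>x. e $ 1 * p1 x + e $ 2 * p2 x)"
    by (rule ext, rule dir_deriv_at[OF p(3)])
  then show ?thesis using p by (simp add: Poly_add Poly_scale)
qed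

lemma Poly_iterated_dir_deriv:
  assumes "p \<in> Poly d" shows "(dir_deriv e ^^ m) p \<in> Poly d"
proof (induction m)
  case (Suc m) then show ?case using Poly_mono[OF Poly_dir_deriv] by (metis diff_le_self funpow.simps(2) o_apply)
qed (simp add: assms)

lemma Poly_partial: "p \<in> Poly d \<Longrightarrow> partial a b p \<in> Poly d"
  unfolding partial_def by (intro Poly_iterated_dir_deriv)

lemma Poly_differentiable: "p \<in> Poly d \<Longrightarrow> p differentiable (at x)"
  using Poly_has_derivative unfolding differentiable_def by blast

lemma Poly_continuous: "p \<in> Poly d \<Longrightarrow> isCont p x"
  using Poly_differentiable differentiable_imp_continuous_within by blast

lemma dir_deriv_Poly_add:
  assumes "f \<in> Poly d" "g \<in> Poly d"
  shows "dir_deriv e (\<lambda>x. f x + g x) = (\<lambda>x. dir_deriv e f x + dir_deriv e g x)"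
  by (rule ext, subst dir_deriv_at[OF has_derivative_add[OF Poly_has_derivative[OF assms(1)] Poly_has_derivative[OF assms(2)]]])
     (simp add: dir_deriv_Poly[OF assms(1)] dir_deriv_Poly[OF assms(2)])

lemma dir_deriv_Poly_scale:
  assumes "f \<in> Poly d"
  shows "dir_deriv e (\<lambda>x. k * f x) = (\<lambda>x. k * dir_deriv e f x)"
  by (rule ext, subst dir_deriv_at[OF has_derivative_mult_right[OF Poly_has_derivative[OF assms(1)]]])
     (simp add: dir_deriv_Poly[OF assms(1)])

lemma dir_deriv_Poly_diff:
  assumes "f \<in> Poly d" "g \<in> Poly d"
  shows "dir_deriv e (\<lambda>x. f x - g x) = (\<lambda>x. dir_deriv e f x - dir_deriv e g x)"
  using dir_deriv_Poly_add[OF assms(1) Poly_scale[OF assms(2), of "-1"]] dir_deriv_Poly_scale[OF assms(2), of e "-1"]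
  by simp

lemma partial_Poly_add:
  assumes "f \<in> Poly d" "g \<in> Poly d"
  shows "partial a b (\<lambda>x. f x + g x) = (\<lambda>x. partial a b f x + partial a b g x)"
proof -
  note P = Poly_iterated_dir_deriv
  have L: "(dir_deriv e ^^ m) (\<lambda>x. f x + g x) = (\<lambda>x. (dir_deriv e ^^ m) f x + (dir_deriv e ^^ m) g x)"
    if "f \<in> Poly d" "g \<in> Poly d" for m f g e
    by (induction m) (simp_all add: dir_deriv_Poly_add[OF P[OF that(1)] P[OF that(2)]])
  show ?thesis unfolding partial_def L[OF assms] by (simp add: L[OF P[OF assms(1)] P[OF assms(2)]])
qed

lemma partial_Poly_scale:
  assumes "f \<in> Poly d"
  shows "partial a b (\<lambda>x. k * f x) = (\<lambda>x. k * partial a b f x)"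
proof -
  note P = Poly_iterated_dir_deriv
  have L: "(dir_deriv e ^^ m) (\<lambda>x. k * f x) = (\<lambda>x. k * (dir_deriv e ^^ m) f x)"
    if "f \<in> Poly d" for m f e
    by (induction m) (simp_all add: dir_deriv_Poly_scale[OF P[OF that(1)]])
  show ?thesis unfolding partial_def L[OF assms] by (simp add: L[OF P[OF assms(1)]])
qed

lemma partial_Poly_diff:
  assumes "f \<in> Poly d" "g \<in> Poly d"
  shows "partial a b (\<lambda>x. f x - g x) = (\<lambda>x. partial a b f x - partial a b g x)"
  using partial_Poly_add[OF assms(1) Poly_scale[OF assms(2), of "-1"]] partial_Poly_scale[OF assms(2), of a b "-1"]
  by simp

lemma dir_deriv_monomial:
  fixes x :: plane
  shows "dir_deriv e (\<lambda>x. (x $ 1) ^ i * (x $ 2) ^ j) x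
    = e $ 1 * (real i * ((x $ 1) ^ (i - 1) * (x $ 2) ^ j)) + e $ 2 * (real j * ((x $ 1) ^ i * (x $ 2) ^ (j - 1)))"
proof -
  have c: "((\<lambda>x::plane. x $ k) has_derivative (\<lambda>h. h $ k)) (at x)" for k x
    by (rule bounded_linear_imp_has_derivative[OF bounded_linear_vec_nth])
  have "((\<lambda>x. (x $ 1) ^ i * (x $ 2) ^ j) has_derivative (\<lambda>e. e $ 1 * (real i * ((x $ 1) ^ (i - 1) * (x $ 2) ^ j)) + e $ 2 * (real j * ((x $ 1) ^ i * (x $ 2) ^ (j - 1))))) (at x)"
    by (rule has_derivative_eq_rhs[OF has_derivative_mult[OF has_derivative_power[OF c] has_derivative_power[OF c]]])
       (simp add: fun_eq_iff algebra_simps)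
  then show ?thesis by (rule dir_deriv_at)
qed

lemma dir_deriv_commute_Poly:
  assumes "p \<in> Poly d"
  shows "dir_deriv e (dir_deriv f p) = dir_deriv f (dir_deriv e p)"
  using assms
proof (induction rule: Poly_induct)
  case zero
  have "dir_deriv e (\<lambda>x. 0) = (\<lambda>x. 0)" for e by (rule ext, rule dir_deriv_at[OF has_derivative_const])
  then show ?case by simp
next
  case (monomial i j)
  have *: "dir_deriv e (\<lambda>x. (x $ 1) ^ i * (x $ 2) ^ j)
    = (\<lambda>x. (e $ 1 * real i) * ((x $ 1) ^ (i - 1) * (x $ 2) ^ j) + (e $ 2 * real j) * ((x $ 1) ^ i * (x $ 2) ^ (j - 1)))" for e i j
    by (rule ext) (simp add: dir_deriv_monomial)
  have "dir_deriv e (dir_deriv f (\<lambda>x. (x $ 1) ^ i * (x $ 2) ^ j)) =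
      (\<lambda>x. (f $ 1 * real i) * dir_deriv e (\<lambda>x. (x $ 1) ^ (i - 1) * (x $ 2) ^ j) x + (f $ 2 * real j) * dir_deriv e (\<lambda>x. (x $ 1) ^ i * (x $ 2) ^ (j - 1)) x)" for e f
    unfolding *[of f] 
    by (subst dir_deriv_Poly_add[of _ "i + j"]; (intro Poly_scale Poly_monomial; simp)?)
       (subst dir_deriv_Poly_scale[of _ "i + j"], intro Poly_monomial, simp, 
        subst dir_deriv_Poly_scale[of _ "i + j"], intro Poly_monomial, simp, rule refl)
  then show ?case unfolding * by (simp add: fun_eq_iff algebra_simps)
next
  case (add f' g)
  then show ?case by (simp add: dir_deriv_Poly_add[OF add(1,2)] dir_deriv_Poly_add[OF Poly_dir_deriv[OF add(1)] Poly_dir_deriv[OF add(2)]])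
next
  case (scale k g)
  then show ?case by (simp add: dir_deriv_Poly_scale[OF scale(1)] dir_deriv_Poly_scale[OF Poly_dir_deriv[OF scale(1)]])
qed

text \<open>Only one of the two mixed second derivatives occurs among the partial derivatives, so this uses that
they commute.\<close>

lemma dir_deriv_dir_deriv_Poly:
  assumes "p \<in> Poly d"
  shows "dir_deriv e (dir_deriv f p) x = e $ 1 * f $ 1 * partial 2 0 p x
     + (e $ 1 * f $ 2 + e $ 2 * f $ 1) * partial 1 1 p x + e $ 2 * f $ 2 * partial 0 2 p x"
proof -
  note D = Poly_dir_deriv[OF assms]
  have f: "dir_deriv f p = (\<lambda>x. f $ 1 * dir_deriv (axis 1 1) p x + f $ 2 * dir_deriv (axis 2 1) p x)"
    by (rule ext) (simp add: dir_deriv_Poly[OF assms, of f] partial_simps)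
  have "dir_deriv e (dir_deriv f p) x = f $ 1 * dir_deriv e (dir_deriv (axis 1 1) p) x + f $ 2 * dir_deriv e (dir_deriv (axis 2 1) p) x"
    unfolding f by (simp add: dir_deriv_Poly_add[OF Poly_scale[OF D] Poly_scale[OF D]] dir_deriv_Poly_scale[OF D])
  then show ?thesis
    unfolding dir_deriv_Poly[OF D, of e] partial_simps
      dir_deriv_commute_Poly[OF assms, of "axis 2 1" "axis 1 1"] by (simp add: algebra_simps)
qed

section \<open>Unisolvent interpolation\<close>

text \<open>Gaussian elimination: an equation with a non-zero coefficient at the unknown \<open>k\<close> is solved for it,
which leaves one equation and one unknown less.\<close>

lemma underdetermined_system:
  fixes M :: "'f \<Rightarrow> 'i \<Rightarrow> real"
  assumes "finite F" "finite I" "card F < card I"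
  shows "\<exists>c. (\<exists>i\<in>I. c i \<noteq> 0) \<and> (\<forall>\<eta>\<in>F. (\<Sum>i\<in>I. c i * M \<eta> i) = 0)"
  using assms
proof (induction F arbitrary: I M rule: finite_induct)
  case empty
  then have "I \<noteq> {}" by auto
  then show ?case by (intro exI[of _ "\<lambda>_. 1"]) auto
next
  case (insert \<eta> F)
  show ?case
  proof (cases "\<forall>i\<in>I. M \<eta> i = 0")
    case True
    obtain c where "(\<exists>i\<in>I. c i \<noteq> 0) \<and> (\<forall>\<zeta>\<in>F. (\<Sum>i\<in>I. c i * M \<zeta> i) = 0)"
      using insert.IH[of I M] insert.prems insert.hyps by auto
    then show ?thesis using True by auto
  next
    case False
    then obtain k where k: "k \<in> I" "M \<eta> k \<noteq> 0" by blast
    let ?J = "I - {k}"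
    let ?N = "\<lambda>\<zeta> i. M \<zeta> i - M \<eta> i / M \<eta> k * M \<zeta> k"
    have "card F < card ?J" using insert k by simp
    then obtain c where c: "\<exists>i\<in>?J. c i \<noteq> 0" "\<And>\<zeta>. \<zeta> \<in> F \<Longrightarrow> (\<Sum>i\<in>?J. c i * ?N \<zeta> i) = 0"
      using insert.IH[of ?J ?N] insert.prems by auto
    define r where "r = - (\<Sum>i\<in>?J. c i * M \<eta> i) / M \<eta> k"
    have s: "(\<Sum>i\<in>I. (c(k := r)) i * M \<zeta> i) = r * M \<zeta> k + (\<Sum>i\<in>?J. c i * M \<zeta> i)" for \<zeta>
      using k insert.prems by (subst sum.remove[of I k]) (auto intro!: sum.cong)
    have "(\<Sum>i\<in>?J. c i * M \<zeta> i) = - r * M \<zeta> k" if "\<zeta> \<in> F" for \<zeta>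
    proof -
      have "(\<Sum>i\<in>?J. c i * ?N \<zeta> i) = (\<Sum>i\<in>?J. c i * M \<zeta> i) - (\<Sum>i\<in>?J. c i * M \<eta> i) / M \<eta> k * M \<zeta> k"
        by (simp add: algebra_simps sum_subtractf sum_distrib_left sum_distrib_right sum_divide_distrib)
      then show ?thesis using c(2)[OF that] by (simp add: r_def)
    qed
    then have "\<forall>\<zeta>\<in>insert \<eta> F. (\<Sum>i\<in>I. (c(k := r)) i * M \<zeta> i) = 0"
      unfolding s using k by (auto simp: r_def)
    moreover have "\<exists>i\<in>I. (c(k := r)) i \<noteq> 0" using c(1) by auto
    ultimately show ?thesis by blast
  qed
qed

text \<open>Without the functional \<open>\<eta>\<close> there are fewer conditions than coefficients, so some non-zero polynomial is
annihilated by all other functionals. By unisolvence \<open>\<eta>\<close> does not annihilate it as well. After scaling,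
these polynomials form a basis dual to the functionals.\<close>

lemma unisolvent_interpolation:
  fixes ev :: "'f \<Rightarrow> (plane \<Rightarrow> real) \<Rightarrow> real"
  assumes fin: "finite F" and card: "card F \<le> card (Sigma {..d} (\<lambda>i. {..d - i}))"
    and add: "\<And>\<eta> f g. \<lbrakk>\<eta> \<in> F; f \<in> Poly d; g \<in> Poly d\<rbrakk> \<Longrightarrow> ev \<eta> (\<lambda>x. f x + g x) = ev \<eta> f + ev \<eta> g"
    and scale: "\<And>\<eta> f k. \<lbrakk>\<eta> \<in> F; f \<in> Poly d\<rbrakk> \<Longrightarrow> ev \<eta> (\<lambda>x. k * f x) = k * ev \<eta> f"
    and unisolvent: "\<And>p. \<lbrakk>p \<in> Poly d; \<And>\<eta>. \<eta> \<in> F \<Longrightarrow> ev \<eta> p = 0\<rbrakk> \<Longrightarrow> p = (\<lambda>_. 0)"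
  shows "\<exists>!p. p \<in> Poly d \<and> (\<forall>\<eta>\<in>F. ev \<eta> p = y \<eta>)"
proof -
  let ?I = "Sigma {..d} (\<lambda>i. {..d - i})"
  let ?m = "\<lambda>z x::plane. (x $ 1) ^ fst z * (x $ 2) ^ snd z"
  have sum: "ev \<eta> (\<lambda>x. \<Sum>i\<in>J. c i * f i x) = (\<Sum>i\<in>J. c i * ev \<eta> (f i))"
    if "\<eta> \<in> F" "finite J" "\<And>i. i \<in> J \<Longrightarrow> f i \<in> Poly d" for J f \<eta> and c :: "'z \<Rightarrow> real"
    using that(2,3)
  proof (induction J rule: finite_induct)
    case empty
    then show ?case using scale[OF that(1) Poly_zero, of 0] by simp
  next
    case (insert i J)
    have "(\<lambda>x. \<Sum>i\<in>J. c i * f i x) \<in> Poly d" using insert by (intro Poly_sum Poly_scale) auto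
    then show ?case using insert add[OF that(1) Poly_scale[of "f i" d "c i"]] scale[OF that(1)] by simp
  qed
  have m: "?m z \<in> Poly d" if "z \<in> ?I" for z using that by (intro Poly_monomial) auto
  have dual: "\<exists>p\<in>Poly d. \<forall>\<zeta>\<in>F. ev \<zeta> p = (if \<zeta> = \<eta> then 1 else 0)" if "\<eta> \<in> F" for \<eta>
  proof -
    have "card (F - {\<eta>}) < card ?I" using card fin that by (metis card_Diff1_less le_less_trans nat_less_le)
    then obtain c where c: "\<exists>i\<in>?I. c i \<noteq> 0" "\<And>\<zeta>. \<zeta> \<in> F - {\<eta>} \<Longrightarrow> (\<Sum>z\<in>?I. c z * ev \<zeta> (?m z)) = 0"
      using underdetermined_system[of "F - {\<eta>}" ?I "\<lambda>\<zeta> z. ev \<zeta> (?m z)"] fin by auto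
    define p where "p = (\<lambda>x. \<Sum>z\<in>?I. c z * ?m z x)"
    have p: "p \<in> Poly d" unfolding p_def by (intro Poly_sum Poly_scale m) auto
    have ev: "ev \<zeta> p = (\<Sum>z\<in>?I. c z * ev \<zeta> (?m z))" if "\<zeta> \<in> F" for \<zeta>
      unfolding p_def by (rule sum[OF that]) (auto intro!: m)
    have z: "ev \<zeta> p = 0" if "\<zeta> \<in> F" "\<zeta> \<noteq> \<eta>" for \<zeta> using ev c(2) that by auto
    have nz: "ev \<eta> p \<noteq> 0"
    proof
      assume "ev \<eta> p = 0"
      then have 0: "p = (\<lambda>_. 0)" using z by (intro unisolvent[OF p]) metis
      have "(\<Sum>i\<le>d. \<Sum>j\<le>d - i. c (i, j) * (x $ 1) ^ i * (x $ 2) ^ j) = 0" for x :: plane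
      proof -
        have "p x = (\<Sum>i\<le>d. \<Sum>j\<le>d - i. c (i, j) * (x $ 1) ^ i * (x $ 2) ^ j)"
          unfolding p_def by (simp add: sum.Sigma split_def mult.assoc)
        then show ?thesis using 0 by simp
      qed
      from Poly_coefficients_zero[OF this] have "c (i, j) = 0" if "(i, j) \<in> ?I" for i j using that by auto
      then show False using c(1) by auto
    qed
    show ?thesis
    proof (rule bexI[OF _ Poly_scale[OF p, of "1 / ev \<eta> p"]], intro ballI)
      fix \<zeta> assume \<zeta>: "\<zeta> \<in> F"
      show "ev \<zeta> (\<lambda>x. 1 / ev \<eta> p * p x) = (if \<zeta> = \<eta> then 1 else 0)"
        unfolding scale[OF \<zeta> p] using z[OF \<zeta>] nz by auto
    qed
  qed
  then obtain b where b: "\<And>\<eta>. \<eta> \<in> F \<Longrightarrow> b \<eta> \<in> Poly d"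
     "\<And>\<eta> \<zeta>. \<lbrakk>\<eta> \<in> F; \<zeta> \<in> F\<rbrakk> \<Longrightarrow> ev \<zeta> (b \<eta>) = (if \<zeta> = \<eta> then 1 else 0)" by metis
  define p where "p = (\<lambda>x. \<Sum>\<eta>\<in>F. y \<eta> * b \<eta> x)"
  have p: "p \<in> Poly d" unfolding p_def by (intro Poly_sum Poly_scale b fin)
  have "ev \<zeta> p = y \<zeta>" if "\<zeta> \<in> F" for \<zeta>
  proof -
    have "ev \<zeta> p = (\<Sum>\<eta>\<in>F. y \<eta> * ev \<zeta> (b \<eta>))" unfolding p_def by (rule sum[OF that fin b(1)])
    also have "\<dots> = (\<Sum>\<eta>\<in>F. if \<eta> = \<zeta> then y \<eta> else 0)" by (rule sum.cong) (auto simp: b(2) that)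
    finally show ?thesis using that fin by simp
  qed
  moreover have "p' = p''" if "p' \<in> Poly d" "p'' \<in> Poly d" "\<And>\<eta>. \<eta> \<in> F \<Longrightarrow> ev \<eta> p' = ev \<eta> p''" for p' p''
  proof -
    have "(\<lambda>x. p' x + (- 1) * p'' x) = (\<lambda>_. 0)"
    proof (rule unisolvent[OF Poly_add[OF that(1) Poly_scale[OF that(2)]]])
      fix \<eta> assume "\<eta> \<in> F"
      then show "ev \<eta> (\<lambda>x. p' x + - 1 * p'' x) = 0"
        using add[OF _ that(1) Poly_scale[OF that(2)], of \<eta> "-1"] scale[OF _ that(2), of \<eta> "-1"] that(3) by simp
    qed
    then show ?thesis by (simp add: fun_eq_iff)
  qed
  ultimately show ?thesis using p by (intro ex1I[of _ p]) metis+
qed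

section \<open>Hermite interpolation on an edge\<close>

lemma power_sum_derivative:
  fixes f f' :: "real \<Rightarrow> real"
  assumes "\<And>t. f t = (\<Sum>i\<le>d. c i * t ^ i)" "\<And>t. (f has_real_derivative f' t) (at t)"
  shows "f' t = (\<Sum>i\<le>d. c i * (real i * t ^ (i - 1)))"
proof -
  have "f = (\<lambda>t. \<Sum>i\<le>d. c i * t ^ i)" using assms(1) by auto
  moreover have "((\<lambda>t. \<Sum>i\<le>d. c i * t ^ i) has_real_derivative (\<Sum>i\<le>d. c i * (real i * t ^ (i - 1)))) (at t)"
    by (auto intro!: derivative_eq_intros sum.cong)
  ultimately show ?thesis using assms(2) DERIV_unique by blast
qed

lemma power_sum_second_derivative:
  fixes f f' f'' :: "real \<Rightarrow> real"
  assumes "\<And>t. f t = (\<Sum>i\<le>d. c i * t ^ i)" "\<And>t. (f has_real_derivative f' t) (at t)"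
    "\<And>t. (f' has_real_derivative f'' t) (at t)"
  shows "f'' t = (\<Sum>i\<le>d. c i * (real i * (real (i - 1) * t ^ (i - 2))))"
proof -
  have "f' = (\<lambda>t. \<Sum>i\<le>d. c i * (real i * t ^ (i - 1)))"
    using power_sum_derivative[OF assms(1,2)] by auto
  moreover have "((\<lambda>t. \<Sum>i\<le>d. c i * (real i * t ^ (i - 1))) has_real_derivative
     (\<Sum>i\<le>d. c i * (real i * (real (i - 1) * t ^ (i - 2))))) (at t)"
    by (auto intro!: derivative_eq_intros sum.cong simp: numeral_2_eq_2)
  ultimately show ?thesis using assms(3) DERIV_unique by blast
qed

lemma sum_atMost_4: "(\<Sum>i\<le>4. g i) = g 0 + g 1 + g 2 + g 3 + (g 4 :: real)"
  and sum_atMost_5: "(\<Sum>i\<le>5. g i) = g 0 + g 1 + g 2 + g 3 + g 4 + (g 5 :: real)"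
  and sum_atMost_6: "(\<Sum>i\<le>6. g i) = g 0 + g 1 + g 2 + g 3 + g 4 + g 5 + (g 6 :: real)"
  and sum_atMost_3: "(\<Sum>i\<le>3. g i) = g 0 + g 1 + g 2 + (g 3 :: real)"
  and sum_atMost_2: "(\<Sum>i\<le>2. g i) = g 0 + g 1 + (g 2 :: real)"
  and sum_atMost_1: "(\<Sum>i\<le>Suc 0. g i) = g 0 + (g 1 :: real)"
  by (simp_all add: numeral_eq_Suc)

text \<open>A polynomial in one variable is zero if it has more zeros than its degree, counted with multiplicity.
The five cases below are the distributions of zeros that occur on edges. The conditions at \<open>0\<close> give the
lowest coefficients, and the others a regular linear system for the rest.\<close>

lemma hermite_degree_6:
  fixes f f' f'' :: "real \<Rightarrow> real"
  assumes f: "\<And>t. f t = (\<Sum>i\<le>6. c i * t ^ i)" and D: "\<And>t. (f has_real_derivative f' t) (at t)"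
    "\<And>t. (f' has_real_derivative f'' t) (at t)"
    and "f 0 = 0" "f' 0 = 0" "f'' 0 = 0" "f 1 = 0" "f' 1 = 0" "f'' 1 = 0" "f (1/2) = 0"
  shows "f t = 0"
proof -
  note f' = power_sum_derivative[OF f D(1)] and f'' = power_sum_second_derivative[OF f D]
  have 0: "c 0 = 0" "c 1 = 0" "c 2 = 0"
    using assms(4,5,6) unfolding f f' f'' sum_atMost_6 by simp_all
  have e: "c 3 + c 4 + c 5 + c 6 = 0" "3 * c 3 + 4 * c 4 + 5 * c 5 + 6 * c 6 = 0"
    "6 * c 3 + 12 * c 4 + 20 * c 5 + 30 * c 6 = 0" "8 * c 3 + 4 * c 4 + 2 * c 5 + c 6 = 0"
    using assms(7-10) 0 unfolding f f' f'' sum_atMost_6 by (simp_all add: field_simps)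
  have "c 3 = 0" "c 4 = 0" "c 5 = 0" "c 6 = 0" using e by linarith+
  then show ?thesis using 0 unfolding f sum_atMost_6 by simp
qed

lemma hermite_degree_5:
  fixes f f' f'' :: "real \<Rightarrow> real"
  assumes f: "\<And>t. f t = (\<Sum>i\<le>5. c i * t ^ i)" and D: "\<And>t. (f has_real_derivative f' t) (at t)"
    "\<And>t. (f' has_real_derivative f'' t) (at t)"
    and "f 0 = 0" "f' 0 = 0" "f'' 0 = 0" "f 1 = 0" "f' 1 = 0" "f'' 1 = 0"
  shows "f t = 0"
proof -
  note f' = power_sum_derivative[OF f D(1)] and f'' = power_sum_second_derivative[OF f D]
  have 0: "c 0 = 0" "c 1 = 0" "c 2 = 0"
    using assms(4,5,6) unfolding f f' f'' sum_atMost_5 by simp_all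
  have e: "c 3 + c 4 + c 5 = 0" "3 * c 3 + 4 * c 4 + 5 * c 5 = 0" "6 * c 3 + 12 * c 4 + 20 * c 5 = 0"
    using assms(7-9) 0 unfolding f f' f'' sum_atMost_5 by (simp_all add: field_simps)
  have "c 3 = 0" "c 4 = 0" "c 5 = 0" using e by linarith+
  then show ?thesis using 0 unfolding f sum_atMost_5 by simp
qed

lemma hermite_degree_5_quarters:
  fixes f f' :: "real \<Rightarrow> real"
  assumes f: "\<And>t. f t = (\<Sum>i\<le>5. c i * t ^ i)" and D: "\<And>t. (f has_real_derivative f' t) (at t)"
    and "f 0 = 0" "f' 0 = 0" "f 1 = 0" "f' 1 = 0" "f (1/4) = 0" "f (3/4) = 0"
  shows "f t = 0"
proof -
  note f' = power_sum_derivative[OF f D(1)]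
  have 0: "c 0 = 0" "c 1 = 0"
    using assms(3,4) unfolding f f' sum_atMost_5 by simp_all
  have e: "c 2 + c 3 + c 4 + c 5 = 0" "2 * c 2 + 3 * c 3 + 4 * c 4 + 5 * c 5 = 0"
    using assms(5,6) 0 unfolding f f' sum_atMost_5 by (simp_all add: field_simps)
  have e': "64 * c 2 + 16 * c 3 + 4 * c 4 + c 5 = 0" "576 * c 2 + 432 * c 3 + 324 * c 4 + 243 * c 5 = 0"
    using assms(7,8) 0 unfolding f f' sum_atMost_5 by (simp_all add: field_simps)
  have "c 2 = 0" "c 3 = 0" "c 4 = 0" "c 5 = 0" using e e' by linarith+
  then show ?thesis using 0 unfolding f sum_atMost_5 by simp
qed

lemma hermite_degree_4:
  fixes f f' :: "real \<Rightarrow> real"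
  assumes f: "\<And>t. f t = (\<Sum>i\<le>4. c i * t ^ i)" and D: "\<And>t. (f has_real_derivative f' t) (at t)"
    and "f 0 = 0" "f' 0 = 0" "f 1 = 0" "f' 1 = 0" "f (1/2) = 0"
  shows "f t = 0"
proof -
  note f' = power_sum_derivative[OF f D(1)]
  have 0: "c 0 = 0" "c 1 = 0"
    using assms(3,4) unfolding f f' sum_atMost_4 by simp_all
  have e: "c 2 + c 3 + c 4 = 0" "2 * c 2 + 3 * c 3 + 4 * c 4 = 0" "4 * c 2 + 2 * c 3 + c 4 = 0"
    using assms(5-7) 0 unfolding f f' sum_atMost_4 by (simp_all add: field_simps)
  have "c 2 = 0" "c 3 = 0" "c 4 = 0" using e by linarith+
  then show ?thesis using 0 unfolding f sum_atMost_4 by simp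
qed

lemma hermite_degree_4_osculating:
  fixes f f' f'' :: "real \<Rightarrow> real"
  assumes f: "\<And>t. f t = (\<Sum>i\<le>4. c i * t ^ i)" and D: "\<And>t. (f has_real_derivative f' t) (at t)"
    "\<And>t. (f' has_real_derivative f'' t) (at t)"
    and "f 0 = 0" "f' 0 = 0" "f'' 0 = 0" "f 1 = 0" "f' 1 = 0"
  shows "f t = 0"
proof -
  note f' = power_sum_derivative[OF f D(1)] and f'' = power_sum_second_derivative[OF f D]
  have 0: "c 0 = 0" "c 1 = 0" "c 2 = 0"
    using assms(4,5,6) unfolding f f' f'' sum_atMost_4 by simp_all
  have e: "c 3 + c 4 = 0" "3 * c 3 + 4 * c 4 = 0"
    using assms(7-8) 0 unfolding f f' f'' sum_atMost_4 by (simp_all add: field_simps)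
  have "c 3 = 0" "c 4 = 0" using e by linarith+
  then show ?thesis using 0 unfolding f sum_atMost_4 by simp
qed

lemma Poly_line_derivative:
  assumes "p \<in> Poly d"
  shows "((\<lambda>t. p (a + t *\<^sub>R e)) has_real_derivative dir_deriv e p (a + t *\<^sub>R e)) (at t)"
proof -
  have "((\<lambda>t. a + t *\<^sub>R e) has_derivative (\<lambda>h. h *\<^sub>R e)) (at t)"
    by (auto intro!: derivative_eq_intros)
  from has_derivative_compose[OF this Poly_has_derivative[OF assms]]
  have "((\<lambda>t. p (a + t *\<^sub>R e)) has_derivative (\<lambda>h. h * dir_deriv e p (a + t *\<^sub>R e))) (at t)"
    by (simp add: dir_deriv_Poly[OF assms, of e] algebra_simps)
  then show ?thesis by (simp add: has_field_derivative_def mult.commute[of _ "dir_deriv e p (a + t *\<^sub>R e)"] )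
qed

definition zero_2jet :: "(plane \<Rightarrow> real) \<Rightarrow> plane \<Rightarrow> bool" where
  "zero_2jet p v \<longleftrightarrow> (\<forall>i j. i + j \<le> 2 \<longrightarrow> partial i j p v = 0)"

definition zero_1jet :: "(plane \<Rightarrow> real) \<Rightarrow> plane \<Rightarrow> bool" where
  "zero_1jet p v \<longleftrightarrow> (\<forall>i j. i + j \<le> 1 \<longrightarrow> partial i j p v = 0)"

lemma zero_1jet_iff: "zero_1jet p v \<longleftrightarrow> p v = 0 \<and> partial 1 0 p v = 0 \<and> partial 0 1 p v = 0"
proof -
  have *: "i + j \<le> 1 \<longleftrightarrow> i = 0 \<and> j = 0 \<or> i = 1 \<and> j = 0 \<or> i = 0 \<and> j = 1" for i j :: nat by auto
  show ?thesis unfolding zero_1jet_def * by (metis partial_simps(1))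
qed

lemma zero_2jet_iff: "zero_2jet p v \<longleftrightarrow> zero_1jet p v \<and> partial 2 0 p v = 0 \<and> partial 1 1 p v = 0 \<and> partial 0 2 p v = 0"
proof -
  have *: "i + j \<le> 2 \<longleftrightarrow> i + j \<le> 1 \<or> i = 2 \<and> j = 0 \<or> i = 1 \<and> j = 1 \<or> i = 0 \<and> j = 2" for i j :: nat by auto
  show ?thesis unfolding zero_2jet_def zero_1jet_def * by blast
qed

lemma zero_1jet_dir:
  assumes "p \<in> Poly d" "zero_1jet p v" shows "dir_deriv e p v = 0"
  using assms by (simp add: dir_deriv_Poly zero_1jet_iff)

lemma zero_2jet_dir_dir:
  assumes "p \<in> Poly d" "zero_2jet p v" shows "dir_deriv e (dir_deriv f p) v = 0"
  using assms by (simp add: dir_deriv_dir_deriv_Poly zero_2jet_iff)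

lemma zero_1jet_from_basis:
  assumes p: "p \<in> Poly d" and "p v = 0" "dir_deriv e p v = 0" "dir_deriv \<nu> p v = 0" "norm \<nu> = 1" "\<nu> \<bullet> e = 0" "e \<noteq> 0"
  shows "zero_1jet p v"
proof -
  have "\<nu> \<noteq> 0" using assms(5) by auto
  have d: "\<nu> $ 1 * e $ 1 + \<nu> $ 2 * e $ 2 = 0" using assms(6) by (simp add: inner_vec_def sum_2)
  define D where "D = \<nu> $ 1 * e $ 2 - \<nu> $ 2 * e $ 1"
  have "D\<^sup>2 + (\<nu> $ 1 * e $ 1 + \<nu> $ 2 * e $ 2)\<^sup>2 = ((\<nu> $ 1)\<^sup>2 + (\<nu> $ 2)\<^sup>2) * ((e $ 1)\<^sup>2 + (e $ 2)\<^sup>2)"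
    unfolding D_def by algebra
  moreover have "(\<nu> $ 1)\<^sup>2 + (\<nu> $ 2)\<^sup>2 \<noteq> 0" using \<open>\<nu> \<noteq> 0\<close> by (simp add: vec_eq_iff forall_2 sum_power2_eq_zero_iff)
  moreover have "(e $ 1)\<^sup>2 + (e $ 2)\<^sup>2 \<noteq> 0" using \<open>e \<noteq> 0\<close> by (simp add: vec_eq_iff forall_2 sum_power2_eq_zero_iff)
  ultimately have D: "D \<noteq> 0" using d by auto
  have 1: "e $ 1 * partial 1 0 p v + e $ 2 * partial 0 1 p v = 0" "\<nu> $ 1 * partial 1 0 p v + \<nu> $ 2 * partial 0 1 p v = 0"
    using assms(3,4) by (simp_all add: dir_deriv_Poly[OF p])
  have "D * partial 1 0 p v = 0" "D * partial 0 1 p v = 0" unfolding D_def using 1 by algebra+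
  then show ?thesis using D assms(2) by (simp add: zero_1jet_iff)
qed

text \<open>The derivative along the line vanishes with the values, so the derivative across it completes the
gradient.\<close>

lemma zero_1jet_on_line:
  assumes p: "p \<in> Poly d" and f: "\<And>t. p (a + t *\<^sub>R e) = 0" and g: "\<And>t. dir_deriv \<nu> p (a + t *\<^sub>R e) = 0"
    and n: "norm \<nu> = 1" "\<nu> \<bullet> e = 0" "e \<noteq> 0"
  shows "zero_1jet p (a + t *\<^sub>R e)"
proof -
  have "(\<lambda>t. p (a + t *\<^sub>R e)) = (\<lambda>t. 0)" using f by auto
  then have "dir_deriv e p (a + t *\<^sub>R e) = 0"
    using Poly_line_derivative[OF p, of a e t] DERIV_const DERIV_unique by metis
  then show ?thesis using f g n by (intro zero_1jet_from_basis[OF p, of _ e \<nu>])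
qed

text \<open>On the edge, \<open>p\<close> has degree 6, with triple zeros at the endpoints and one more at the midpoint. Its
normal derivative has degree 5, with double zeros at the endpoints, because its tangential derivative
there is a second derivative of \<open>p\<close>, and two more at the quarter points.\<close>

lemma edge_zero_C1_degree_6:
  assumes p: "p \<in> Poly 6" and j: "zero_2jet p a" "zero_2jet p b" and m: "p (edge_point 2 a b) = 0"
    and \<nu>: "dir_deriv \<nu> p (edge_point 1 a b) = 0" "dir_deriv \<nu> p (edge_point 3 a b) = 0"
    and n: "norm \<nu> = 1" "\<nu> \<bullet> (b - a) = 0" "a \<noteq> b"
  shows "zero_1jet p (a + t *\<^sub>R (b - a))"
proof (rule zero_1jet_on_line[OF p _ _ n(1,2)])
  let ?e = "b - a"
  note P = Poly_dir_deriv[OF p]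
  have g5: "dir_deriv \<nu> p \<in> Poly 5" using P[of \<nu>] by simp
  obtain c where c: "\<And>t. p (a + t *\<^sub>R ?e) = (\<Sum>i\<le>6. c i * t ^ i)" using Poly_restrict_line[OF p] by blast
  obtain c' where c': "\<And>t. dir_deriv \<nu> p (a + t *\<^sub>R ?e) = (\<Sum>i\<le>5. c' i * t ^ i)" using Poly_restrict_line[OF g5] by blast
  have z1: "zero_1jet p a" "zero_1jet p b" using j by (simp_all add: zero_2jet_iff)
  have z: "p a = 0" "p b = 0" using z1 by (simp_all add: zero_1jet_iff)
  show "p (a + t *\<^sub>R ?e) = 0" for t
    by (rule hermite_degree_6[OF c Poly_line_derivative[OF p] Poly_line_derivative[OF P]])
       (use z m zero_1jet_dir[OF p] z1 zero_2jet_dir_dir[OF p] j in \<open>simp_all add: edge_point_def\<close>)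
  show "dir_deriv \<nu> p (a + t *\<^sub>R ?e) = 0" for t
    by (rule hermite_degree_5_quarters[OF c' Poly_line_derivative[OF P]])
       (use z \<nu> zero_1jet_dir[OF p] z1 zero_2jet_dir_dir[OF p] j in \<open>simp_all add: edge_point_def\<close>)
qed (use n in simp)

text \<open>With the degrees 5 and 4 of the values and of the normal derivative, the count needs, besides the
endpoints, only one zero of the normal derivative.\<close>

lemma edge_zero_C1_degree_5:
  assumes p: "p \<in> Poly 5" and j: "zero_2jet p a" "zero_2jet p b"
    and \<nu>: "dir_deriv \<nu> p (edge_point 2 a b) = 0"
    and n: "norm \<nu> = 1" "\<nu> \<bullet> (b - a) = 0" "a \<noteq> b"
  shows "zero_1jet p (a + t *\<^sub>R (b - a))"
proof (rule zero_1jet_on_line[OF p _ _ n(1,2)])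
  let ?e = "b - a"
  note P = Poly_dir_deriv[OF p]
  have g4: "dir_deriv \<nu> p \<in> Poly 4" using P[of \<nu>] by simp
  obtain c where c: "\<And>t. p (a + t *\<^sub>R ?e) = (\<Sum>i\<le>5. c i * t ^ i)" using Poly_restrict_line[OF p] by blast
  obtain c' where c': "\<And>t. dir_deriv \<nu> p (a + t *\<^sub>R ?e) = (\<Sum>i\<le>4. c' i * t ^ i)" using Poly_restrict_line[OF g4] by blast
  have z1: "zero_1jet p a" "zero_1jet p b" using j by (simp_all add: zero_2jet_iff)
  have z: "p a = 0" "p b = 0" using z1 by (simp_all add: zero_1jet_iff)
  show "p (a + t *\<^sub>R ?e) = 0" for t
    by (rule hermite_degree_5[OF c Poly_line_derivative[OF p] Poly_line_derivative[OF P]])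
       (use z zero_1jet_dir[OF p] z1 zero_2jet_dir_dir[OF p] j in \<open>simp_all add: edge_point_def\<close>)
  show "dir_deriv \<nu> p (a + t *\<^sub>R ?e) = 0" for t
    by (rule hermite_degree_4[OF c' Poly_line_derivative[OF P]])
       (use z \<nu> zero_1jet_dir[OF p] z1 zero_2jet_dir_dir[OF p] j in \<open>simp_all add: edge_point_def\<close>)
qed (use n in simp)

section \<open>Unisolvence on triangles\<close>

lemma Poly_affine_derivatives:
  assumes p: "p \<in> Poly d"
    and c: "\<And>s t. p (a + s *\<^sub>R e + t *\<^sub>R f) = (\<Sum>i\<le>d. \<Sum>j\<le>d - i. c i j * s ^ i * t ^ j)"
  shows "dir_deriv e p (a + s *\<^sub>R e + t *\<^sub>R f) = (\<Sum>i\<le>d. \<Sum>j\<le>d - i. c i j * (real i * s ^ (i - 1)) * t ^ j)"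
    and "dir_deriv f p (a + s *\<^sub>R e + t *\<^sub>R f) = (\<Sum>i\<le>d. \<Sum>j\<le>d - i. c i j * s ^ i * (real j * t ^ (j - 1)))"
proof -
  have "((\<lambda>s. p ((a + t *\<^sub>R f) + s *\<^sub>R e)) has_real_derivative dir_deriv e p ((a + t *\<^sub>R f) + s *\<^sub>R e)) (at s)"
    by (rule Poly_line_derivative[OF p])
  moreover have "(\<lambda>s. p ((a + t *\<^sub>R f) + s *\<^sub>R e)) = (\<lambda>s. (\<Sum>i\<le>d. \<Sum>j\<le>d - i. c i j * s ^ i * t ^ j))"
    using c by (simp add: add_ac)
  moreover have "((\<lambda>s. (\<Sum>i\<le>d. \<Sum>j\<le>d - i. c i j * s ^ i * t ^ j)) has_real_derivative
     (\<Sum>i\<le>d. \<Sum>j\<le>d - i. c i j * (real i * s ^ (i - 1)) * t ^ j)) (at s)"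
    by (auto intro!: derivative_eq_intros sum.cong)
  ultimately show "dir_deriv e p (a + s *\<^sub>R e + t *\<^sub>R f) = (\<Sum>i\<le>d. \<Sum>j\<le>d - i. c i j * (real i * s ^ (i - 1)) * t ^ j)"
    by (metis (no_types, lifting) DERIV_unique add.assoc add.commute)
  have "((\<lambda>t. p ((a + s *\<^sub>R e) + t *\<^sub>R f)) has_real_derivative dir_deriv f p ((a + s *\<^sub>R e) + t *\<^sub>R f)) (at t)"
    by (rule Poly_line_derivative[OF p])
  moreover have "((\<lambda>t. (\<Sum>i\<le>d. \<Sum>j\<le>d - i. c i j * s ^ i * t ^ j)) has_real_derivative
     (\<Sum>i\<le>d. \<Sum>j\<le>d - i. c i j * s ^ i * (real j * t ^ (j - 1)))) (at t)"
    by (auto intro!: derivative_eq_intros sum.cong)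
  ultimately show "dir_deriv f p (a + s *\<^sub>R e + t *\<^sub>R f) = (\<Sum>i\<le>d. \<Sum>j\<le>d - i. c i j * s ^ i * (real j * t ^ (j - 1)))"
    unfolding c by (metis (no_types, lifting) DERIV_unique)
qed

lemma power_sum_zero:
  fixes c :: "nat \<Rightarrow> real"
  assumes "\<And>t. (\<Sum>i\<le>d. c i * t ^ i) = 0" "i \<le> d" shows "c i = 0"
  using Transcendental.polyfun_eq_0[of c d] assms by blast

lemma sum_at_zero:
  fixes g :: "nat \<Rightarrow> real"
  shows "(\<Sum>i\<le>d. g i * 0 ^ i) = g 0"
  by (subst sum.atMost_shift) simp

text \<open>The coefficient arrays of polynomials that vanish, or whose transversal derivative vanishes, on one
of the two coordinate axes.\<close>

lemma vanishing_on_axis: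
  fixes c :: "nat \<Rightarrow> nat \<Rightarrow> real"
  shows "(\<And>t. (\<Sum>i\<le>d. \<Sum>j\<le>d - i. c i j * 0 ^ i * t ^ j) = 0) \<Longrightarrow> j \<le> d \<Longrightarrow> c 0 j = 0"
    and "(\<And>s. (\<Sum>i\<le>d. \<Sum>j\<le>d - i. c i j * s ^ i * 0 ^ j) = 0) \<Longrightarrow> i \<le> d \<Longrightarrow> c i 0 = 0"
    and "(\<And>t. (\<Sum>i\<le>d. \<Sum>j\<le>d - i. c i j * (real i * 0 ^ (i - 1)) * t ^ j) = 0) \<Longrightarrow> 1 \<le> d \<Longrightarrow> j \<le> d - 1 \<Longrightarrow> c 1 j = 0"
    and "(\<And>s. (\<Sum>i\<le>d. \<Sum>j\<le>d - i. c i j * s ^ i * (real j * 0 ^ (j - 1))) = 0) \<Longrightarrow> 1 \<le> d \<Longrightarrow> i \<le> d - 1 \<Longrightarrow> c i 1 = 0"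
proof -
  assume z: "\<And>t. (\<Sum>i\<le>d. \<Sum>j\<le>d - i. c i j * 0 ^ i * t ^ j) = 0" and j: "j \<le> d"
  have "(\<Sum>j\<le>d. c 0 j * t ^ j) = 0" for t
  proof -
    have "(\<Sum>i\<le>d. \<Sum>j\<le>d - i. c i j * 0 ^ i * t ^ j) = (\<Sum>i\<le>d. (\<Sum>j\<le>d - i. c i j * t ^ j) * 0 ^ i)"
      by (simp add: sum_distrib_right sum_distrib_left mult_ac)
    then show ?thesis unfolding sum_at_zero using z[of t] by simp
  qed
  then show "c 0 j = 0" using j by (rule power_sum_zero)
next
  assume z: "\<And>s. (\<Sum>i\<le>d. \<Sum>j\<le>d - i. c i j * s ^ i * 0 ^ j) = 0" and i: "i \<le> d"
  have "(\<Sum>i\<le>d. c i 0 * s ^ i) = 0" for s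
  proof -
    have "(\<Sum>i\<le>d. \<Sum>j\<le>d - i. c i j * s ^ i * 0 ^ j) = (\<Sum>i\<le>d. c i 0 * s ^ i)" by (simp only: sum_at_zero)
    then show ?thesis using z[of s] by simp
  qed
  then show "c i 0 = 0" using i by (rule power_sum_zero)
next
  assume z: "\<And>t. (\<Sum>i\<le>d. \<Sum>j\<le>d - i. c i j * (real i * 0 ^ (i - 1)) * t ^ j) = 0" and d: "1 \<le> d" and j: "j \<le> d - 1"
  have "(\<Sum>j\<le>d - 1. c 1 j * t ^ j) = 0" for t
  proof -
    have "(\<Sum>i\<le>d. \<Sum>j\<le>d - i. c i j * (real i * 0 ^ (i - 1)) * t ^ j) = (\<Sum>i\<le>d. if i = 1 then (\<Sum>j\<le>d - 1. c 1 j * t ^ j) else 0)"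
      by (rule sum.cong) (auto simp: power_0_left le_Suc_eq)
    then show ?thesis using z[of t] d by simp
  qed
  then show "c 1 j = 0" using j by (rule power_sum_zero)
next
  assume z: "\<And>s. (\<Sum>i\<le>d. \<Sum>j\<le>d - i. c i j * s ^ i * (real j * 0 ^ (j - 1))) = 0" and d: "1 \<le> d" and i: "i \<le> d - 1"
  have "(\<Sum>i\<le>d - 1. c i 1 * s ^ i) = 0" for s
  proof -
    have "(\<Sum>j\<le>d - i. c i j * s ^ i * (real j * 0 ^ (j - 1))) = (if i < d then c i 1 * s ^ i else 0)" if "i \<le> d" for i
    proof -
      have "(\<Sum>j\<le>d - i. c i j * s ^ i * (real j * 0 ^ (j - 1))) = (\<Sum>j\<le>d - i. if j = 1 then c i 1 * s ^ i else 0)"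
        by (rule sum.cong) (auto simp: power_0_left)
      then show ?thesis using that by auto
    qed
    then have "(\<Sum>i\<le>d. \<Sum>j\<le>d - i. c i j * s ^ i * (real j * 0 ^ (j - 1))) = (\<Sum>i\<le>d. if i < d then c i 1 * s ^ i else 0)"
      by (intro sum.cong) auto
    also have "\<dots> = (\<Sum>i\<in>{..<d}. c i 1 * s ^ i)"
      by (rule sum.mono_neutral_cong_right) auto
    finally have 0: "(\<Sum>i\<in>{..<d}. c i 1 * s ^ i) = 0" using z[of s] by simp
    then show ?thesis using d by (cases d) (simp_all add: lessThan_Suc_atMost)
  qed
  then show "c i 1 = 0" using i by (rule power_sum_zero)
qed

text \<open>The edges \<open>s = 0\<close> and \<open>t = 0\<close> leave \<open>s\<^sup>2 t\<^sup>2\<close> times a quadratic polynomial \<open>r\<close>. On the third edge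
\<open>s + t = 1\<close>, where \<open>r\<close> and its first derivatives vanish, three values of \<open>r\<close> and two of a derivative
determine the six coefficients of \<open>r\<close> up to a common factor, which makes \<open>r\<close> a multiple of
\<open>(1 - s - t)\<^sup>2\<close>.\<close>

lemma C1_zero_on_edges:
  assumes p: "p \<in> Poly 6"
    and z: "\<And>t. zero_1jet p (v1 + t *\<^sub>R (v2 - v1))" "\<And>t. zero_1jet p (v1 + t *\<^sub>R (v3 - v1))" "\<And>t. zero_1jet p (v2 + t *\<^sub>R (v3 - v2))"
  obtains k where "\<And>s t. p (v1 + s *\<^sub>R (v2 - v1) + t *\<^sub>R (v3 - v1)) = k * (s * t * (1 - s - t))\<^sup>2"
proof -
  define e f where "e = v2 - v1" and "f = v3 - v1"
  obtain c where c: "\<And>s t. p (v1 + s *\<^sub>R e + t *\<^sub>R f) = (\<Sum>i\<le>6. \<Sum>j\<le>6 - i. c i j * s ^ i * t ^ j)"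
    using Poly_affine_coordinates[OF p] by blast
  note D = Poly_affine_derivatives[OF p c]
  have z': "zero_1jet p (v1 + s *\<^sub>R e + 0 *\<^sub>R f)" "zero_1jet p (v1 + 0 *\<^sub>R e + s *\<^sub>R f)" "zero_1jet p (v1 + (1 - s) *\<^sub>R e + s *\<^sub>R f)" for s
  proof -
    show "zero_1jet p (v1 + s *\<^sub>R e + 0 *\<^sub>R f)" "zero_1jet p (v1 + 0 *\<^sub>R e + s *\<^sub>R f)"
      using z(1,2)[of s] by (simp_all add: e_def f_def)
    have "v1 + (1 - s) *\<^sub>R e + s *\<^sub>R f = v2 + s *\<^sub>R (v3 - v2)" by (simp add: e_def f_def algebra_simps)
    then show "zero_1jet p (v1 + (1 - s) *\<^sub>R e + s *\<^sub>R f)" using z(3) by simp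
  qed
  have v: "p x = 0" "dir_deriv g p x = 0" if "zero_1jet p x" for x g
    using that zero_1jet_dir[OF p that] by (simp_all add: zero_1jet_iff)
  have c0j: "c 0 j = 0" if "j \<le> 6" for j
    by (rule vanishing_on_axis(1)[OF _ that]) (unfold c[symmetric], rule v(1)[OF z'(2)])
  have ci0: "c i 0 = 0" if "i \<le> 6" for i
    by (rule vanishing_on_axis(2)[OF _ that]) (unfold c[symmetric], rule v(1)[OF z'(1)])
  have c1j: "c 1 j = 0" if "j \<le> 5" for j
  proof (rule vanishing_on_axis(3)[where d=6 and c=c])
    show "(\<Sum>i\<le>6. \<Sum>j\<le>6 - i. c i j * (real i * 0 ^ (i - 1)) * t ^ j) = 0" for t
      unfolding D(1)[symmetric] by (rule v(2)[OF z'(2)])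
  qed (use that in simp_all)
  have ci1: "c i 1 = 0" if "i \<le> 5" for i
  proof (rule vanishing_on_axis(4)[where d=6 and c=c])
    show "(\<Sum>i\<le>6. \<Sum>j\<le>6 - i. c i j * s ^ i * (real j * 0 ^ (j - 1))) = 0" for s
      unfolding D(2)[symmetric] by (rule v(2)[OF z'(1)])
  qed (use that in simp_all)
  have P: "p (v1 + s *\<^sub>R e + t *\<^sub>R f) = s\<^sup>2 * t\<^sup>2 * (c 2 2 + c 3 2 * s + c 2 3 * t + c 4 2 * s\<^sup>2 + c 3 3 * s * t + c 2 4 * t\<^sup>2)" for s t
    unfolding c sum_atMost_6
    using c0j[of 0] c0j[of 1] c0j[of 2] c0j[of 3] c0j[of 4] c0j[of 5] c0j[of 6]
      ci0[of 1] ci0[of 2] ci0[of 3] ci0[of 4] ci0[of 5] ci0[of 6]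
      c1j[of 1] c1j[of 2] c1j[of 3] c1j[of 4] c1j[of 5] ci1[of 2] ci1[of 3] ci1[of 4] ci1[of 5]
    by (simp add: sum_atMost_5 sum_atMost_4 sum_atMost_3 sum_atMost_2 sum_atMost_1)
      (simp add: algebra_simps eval_nat_numeral)
  have PD: "dir_deriv e p (v1 + s *\<^sub>R e + t *\<^sub>R f) = 2 * s * t\<^sup>2 * (c 2 2 + c 3 2 * s + c 2 3 * t + c 4 2 * s\<^sup>2 + c 3 3 * s * t + c 2 4 * t\<^sup>2)
      + s\<^sup>2 * t\<^sup>2 * (c 3 2 + 2 * c 4 2 * s + c 3 3 * t)" (is "_ = ?D") for s t
  proof -
    have "(\<lambda>s. p ((v1 + t *\<^sub>R f) + s *\<^sub>R e)) = (\<lambda>s. s\<^sup>2 * t\<^sup>2 * (c 2 2 + c 3 2 * s + c 2 3 * t + c 4 2 * s\<^sup>2 + c 3 3 * s * t + c 2 4 * t\<^sup>2))"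
      using P by (auto simp: add_ac)
    moreover have "((\<lambda>s. s\<^sup>2 * t\<^sup>2 * (c 2 2 + c 3 2 * s + c 2 3 * t + c 4 2 * s\<^sup>2 + c 3 3 * s * t + c 2 4 * t\<^sup>2)) has_real_derivative
        2 * s * t\<^sup>2 * (c 2 2 + c 3 2 * s + c 2 3 * t + c 4 2 * s\<^sup>2 + c 3 3 * s * t + c 2 4 * t\<^sup>2)
      + s\<^sup>2 * t\<^sup>2 * (c 3 2 + 2 * c 4 2 * s + c 3 3 * t)) (at s)"
      by (auto intro!: derivative_eq_intros simp: algebra_simps power2_eq_square)
    ultimately have "dir_deriv e p ((v1 + t *\<^sub>R f) + s *\<^sub>R e) = ?D"
      using Poly_line_derivative[OF p, of "v1 + t *\<^sub>R f" e s] DERIV_unique by simp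
    then show ?thesis by (simp add: add_ac)
  qed
  have val: "p (v1 + (1/2) *\<^sub>R e + (1/2) *\<^sub>R f) = 0" "p (v1 + (2/3) *\<^sub>R e + (1/3) *\<^sub>R f) = 0" "p (v1 + (1/3) *\<^sub>R e + (2/3) *\<^sub>R f) = 0"
    using v(1)[OF z'(3), of "1/2"] v(1)[OF z'(3), of "1/3"] v(1)[OF z'(3), of "2/3"] by simp_all
  have der: "dir_deriv e p (v1 + (1/2) *\<^sub>R e + (1/2) *\<^sub>R f) = 0" "dir_deriv e p (v1 + (2/3) *\<^sub>R e + (1/3) *\<^sub>R f) = 0"
    using v(2)[OF z'(3), of e "1/2"] v(2)[OF z'(3), of e "1/3"] by simp_all
  define k1 k2 k3 k4 k5 k6 where k: "k1 = c 2 2" "k2 = c 3 2" "k3 = c 2 3" "k4 = c 4 2" "k5 = c 3 3" "k6 = c 2 4"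
  have e: "4 * k1 + 2 * k2 + 2 * k3 + k4 + k5 + k6 = 0"
    "9 * k1 + 6 * k2 + 3 * k3 + 4 * k4 + 2 * k5 + k6 = 0"
    "9 * k1 + 3 * k2 + 6 * k3 + k4 + 2 * k5 + 4 * k6 = 0"
    using val unfolding P k[symmetric] by (simp_all add: power2_eq_square field_simps)
  have r1: "k1 + k2 * (1/2) + k3 * (1/2) + k4 * (1/2)\<^sup>2 + k5 * (1/2) * (1/2) + k6 * (1/2)\<^sup>2 = 0"
     "k1 + k2 * (2/3) + k3 * (1/3) + k4 * (2/3)\<^sup>2 + k5 * (2/3) * (1/3) + k6 * (1/3)\<^sup>2 = 0"
    using val unfolding P k[symmetric] by simp_all
  have e5: "k2 + k4 + k5 * (1/2) = 0" "k2 + (4/3) * k4 + (1/3) * k5 = 0"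
    using der unfolding PD k[symmetric] r1 by simp_all
  have "k2 = - 2 * k1" "k3 = - 2 * k1" "k4 = k1" "k5 = 2 * k1" "k6 = k1" using e e5 by linarith+
  then have "p (v1 + s *\<^sub>R e + t *\<^sub>R f) = k1 * (s * t * (1 - s - t))\<^sup>2" for s t
    unfolding P k[symmetric] by (simp add: power2_eq_square algebra_simps)
  then show ?thesis unfolding e_def f_def by (rule that)
qed

text \<open>The remaining multiple of \<open>(s t (1 - s - t))\<^sup>2\<close> is detected at the centroid.\<close>

lemma C1_zero_triangle_degree_6:
  assumes p: "p \<in> Poly 6"
    and z: "\<And>t. zero_1jet p (v1 + t *\<^sub>R (v2 - v1))" "\<And>t. zero_1jet p (v1 + t *\<^sub>R (v3 - v1))" "\<And>t. zero_1jet p (v2 + t *\<^sub>R (v3 - v2))"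
    and c: "p ((1/3) *\<^sub>R (v1 + v2 + v3)) = 0"
  shows "p (v1 + s *\<^sub>R (v2 - v1) + t *\<^sub>R (v3 - v1)) = 0"
proof -
  obtain k where k: "\<And>s t. p (v1 + s *\<^sub>R (v2 - v1) + t *\<^sub>R (v3 - v1)) = k * (s * t * (1 - s - t))\<^sup>2"
    using C1_zero_on_edges[OF p z] by blast
  have "(1/3) *\<^sub>R (v1 + v2 + v3) = v1 + (1/3) *\<^sub>R (v2 - v1) + (1/3) *\<^sub>R (v3 - v1)"
    by (simp add: vec_eq_iff field_simps)
  then have "k * ((1/3) * (1/3) * (1 - 1/3 - 1/3))\<^sup>2 = 0" using c k by metis
  then show ?thesis using k by simp
qed

text \<open>A non-zero multiple of \<open>(s t (1 - s - t))\<^sup>2\<close> has degree 6, already on the median \<open>s = t\<close>.\<close>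

lemma C1_zero_triangle_degree_5:
  assumes p: "p \<in> Poly 5"
    and z: "\<And>t. zero_1jet p (v1 + t *\<^sub>R (v2 - v1))" "\<And>t. zero_1jet p (v1 + t *\<^sub>R (v3 - v1))" "\<And>t. zero_1jet p (v2 + t *\<^sub>R (v3 - v2))"
  shows "p (v1 + s *\<^sub>R (v2 - v1) + t *\<^sub>R (v3 - v1)) = 0"
proof -
  have "p \<in> Poly 6" using p by (rule Poly_mono) simp
  then obtain k where k: "\<And>s t. p (v1 + s *\<^sub>R (v2 - v1) + t *\<^sub>R (v3 - v1)) = k * (s * t * (1 - s - t))\<^sup>2"
    using C1_zero_on_edges[OF _ z] by blast
  obtain c where c: "\<And>t. p (v1 + t *\<^sub>R ((v2 - v1) + (v3 - v1))) = (\<Sum>i\<le>5. c i * t ^ i)"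
    using Poly_restrict_line[OF p] by blast
  (* On the median, k * (t * t * (1 - 2 * t))^2 = k * (t^4 - 4 * t^5 + 4 * t^6). *)
  have "(\<Sum>i\<le>6. (if i = 4 then c 4 - k else if i = 5 then c 5 + 4 * k else if i = 6 then - 4 * k else c i) * t ^ i) = 0" for t
  proof -
    have "(\<Sum>i\<le>5. c i * t ^ i) = k * (t * t * (1 - t - t))\<^sup>2"
      using c[of t] k[of t t] by (simp only: scaleR_add_right add.assoc)
    then show ?thesis unfolding sum_atMost_6 sum_atMost_5 by (simp add: algebra_simps power2_eq_square eval_nat_numeral)
  qed
  from power_sum_zero[OF this, of 6] have "k = 0" by simp
  then show ?thesis using k by simp
qed

text \<open>On the straight edges \<open>s = 0\<close> and \<open>t = 0\<close>, of degree 4, there is a triple zero at \<open>v1\<close> and a double one at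
the other end, hence \<open>p = s t r\<close> with \<open>r\<close> quadratic. The remaining conditions at the vertices say that
\<open>r\<close> vanishes at all three of them, and at the interior point \<open>(\<sigma>, \<tau>)\<close> the polynomial \<open>r\<close> and its
first derivatives vanish. So \<open>r\<close> is a quadratic form around this point, and it is zero in the directions of
the three vertices, which are pairwise independent.\<close>

lemma pie_unisolvent:
  assumes p: "p \<in> Poly 4"
    and j: "zero_2jet p v1" "zero_1jet p v2" "zero_1jet p v3"
    and z: "zero_1jet p (v1 + \<sigma> *\<^sub>R (v2 - v1) + \<tau> *\<^sub>R (v3 - v1))" and c0: "0 < \<sigma>" "0 < \<tau>" "\<sigma> + \<tau> < 1"
  shows "p (v1 + s *\<^sub>R (v2 - v1) + t *\<^sub>R (v3 - v1)) = 0"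
proof -
  define e f where "e = v2 - v1" and "f = v3 - v1"
  obtain c where c: "\<And>s t. p (v1 + s *\<^sub>R e + t *\<^sub>R f) = (\<Sum>i\<le>4. \<Sum>j\<le>4 - i. c i j * s ^ i * t ^ j)"
    using Poly_affine_coordinates[OF p] by blast
  note D = Poly_affine_derivatives[OF p c]
  note Pd = Poly_dir_deriv[OF p]
  have j1: "zero_1jet p v1" using j by (simp add: zero_2jet_iff)
  have edge: "p (v1 + s *\<^sub>R (w - v1)) = 0" if w: "zero_1jet p w" for s w
  proof -
    obtain b where b: "\<And>t. p (v1 + t *\<^sub>R (w - v1)) = (\<Sum>i\<le>4. b i * t ^ i)" using Poly_restrict_line[OF p] by blast
    have "p w = 0" "p v1 = 0" using w j1 by (simp_all add: zero_1jet_iff)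
    show ?thesis
      by (rule hermite_degree_4_osculating[OF b Poly_line_derivative[OF p] Poly_line_derivative[OF Pd]])
         (use \<open>p w = 0\<close> \<open>p v1 = 0\<close> w zero_1jet_dir[OF p] j1 zero_2jet_dir_dir[OF p] j in simp_all)
  qed
  have c0j: "c 0 j = 0" if "j \<le> 4" for j
  proof (rule vanishing_on_axis(1)[OF _ that])
    fix t show "(\<Sum>i\<le>4. \<Sum>j\<le>4 - i. c i j * 0 ^ i * t ^ j) = 0"
      unfolding c[symmetric] using edge[OF j(3), of t] by (simp add: f_def)
  qed
  have ci0: "c i 0 = 0" if "i \<le> 4" for i
  proof (rule vanishing_on_axis(2)[OF _ that])
    fix s show "(\<Sum>i\<le>4. \<Sum>j\<le>4 - i. c i j * s ^ i * 0 ^ j) = 0"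
      unfolding c[symmetric] using edge[OF j(2), of s] by (simp add: e_def)
  qed
  note cz = c0j[of 0] c0j[of 1] c0j[of 2] c0j[of 3] c0j[of 4] ci0[of 1] ci0[of 2] ci0[of 3] ci0[of 4]
  have P: "p (v1 + s *\<^sub>R e + t *\<^sub>R f) = s * t * (c 1 1 + c 2 1 * s + c 1 2 * t + c 3 1 * s\<^sup>2 + c 2 2 * s * t + c 1 3 * t\<^sup>2)" for s t
    unfolding c sum_atMost_4 using cz
    by (simp add: sum_atMost_5 sum_atMost_4 sum_atMost_3 sum_atMost_2 sum_atMost_1)
      (simp add: algebra_simps eval_nat_numeral)
  have De: "dir_deriv e p (v1 + s *\<^sub>R e + t *\<^sub>R f) = t * (c 1 1 + 2 * c 2 1 * s + c 1 2 * t + 3 * c 3 1 * s\<^sup>2 + 2 * c 2 2 * s * t + c 1 3 * t\<^sup>2)" for s t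
    unfolding D(1) sum_atMost_4 using cz
    by (simp add: sum_atMost_5 sum_atMost_4 sum_atMost_3 sum_atMost_2 sum_atMost_1)
      (simp add: algebra_simps eval_nat_numeral)
  have Df: "dir_deriv f p (v1 + s *\<^sub>R e + t *\<^sub>R f) = s * (c 1 1 + c 2 1 * s + 2 * c 1 2 * t + c 3 1 * s\<^sup>2 + 2 * c 2 2 * s * t + 3 * c 1 3 * t\<^sup>2)" for s t
    unfolding D(2) sum_atMost_4 using cz
    by (simp add: sum_atMost_5 sum_atMost_4 sum_atMost_3 sum_atMost_2 sum_atMost_1)
      (simp add: algebra_simps eval_nat_numeral)
  define k1 k2 k3 k4 k5 k6 where k: "k1 = c 1 1" "k2 = c 2 1" "k3 = c 1 2" "k4 = c 3 1" "k5 = c 2 2" "k6 = c 1 3"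
  have k1: "k1 = 0"
  proof -
    have "((\<lambda>s. dir_deriv f p (v1 + s *\<^sub>R e)) has_real_derivative dir_deriv e (dir_deriv f p) (v1 + 0 *\<^sub>R e)) (at 0)"
      by (rule Poly_line_derivative[OF Pd])
    moreover have "(\<lambda>s. dir_deriv f p (v1 + s *\<^sub>R e)) = (\<lambda>s. s * (c 1 1 + c 2 1 * s + c 3 1 * s\<^sup>2))"
      using Df[of _ 0] by (auto simp: fun_eq_iff)
    moreover have "((\<lambda>s. s * (c 1 1 + c 2 1 * s + c 3 1 * s\<^sup>2)) has_real_derivative c 1 1) (at 0)"
      by (auto intro!: derivative_eq_intros)
    ultimately have "dir_deriv e (dir_deriv f p) (v1 + 0 *\<^sub>R e) = c 1 1" using DERIV_unique by simp
    then have "dir_deriv e (dir_deriv f p) v1 = c 1 1" by simp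
    then show ?thesis using zero_2jet_dir_dir[OF p j(1)] by (simp add: k)
  qed
  have k4: "k4 = - k2"
  proof -
    have "dir_deriv f p (v1 + 1 *\<^sub>R e + 0 *\<^sub>R f) = 0" using zero_1jet_dir[OF p j(2), of f] by (simp add: e_def)
    then show ?thesis unfolding Df k[symmetric] using k1 by simp
  qed
  have k6: "k6 = - k3"
  proof -
    have "dir_deriv e p (v1 + 0 *\<^sub>R e + 1 *\<^sub>R f) = 0" using zero_1jet_dir[OF p j(3), of e] by (simp add: f_def)
    then show ?thesis unfolding De k[symmetric] using k1 by simp
  qed
  have z0: "p (v1 + \<sigma> *\<^sub>R e + \<tau> *\<^sub>R f) = 0" "dir_deriv e p (v1 + \<sigma> *\<^sub>R e + \<tau> *\<^sub>R f) = 0" "dir_deriv f p (v1 + \<sigma> *\<^sub>R e + \<tau> *\<^sub>R f) = 0"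
    using z zero_1jet_dir[OF p z] by (simp_all add: zero_1jet_iff e_def f_def)
  have r: "k2 * \<sigma> + k3 * \<tau> - k2 * \<sigma>\<^sup>2 + k5 * \<sigma> * \<tau> - k3 * \<tau>\<^sup>2 = 0"
    using z0(1) c0 unfolding P k[symmetric] by (simp add: k1 k4 k6)
  have rs: "2 * k2 * \<sigma> + k3 * \<tau> - 3 * k2 * \<sigma>\<^sup>2 + 2 * k5 * \<sigma> * \<tau> - k3 * \<tau>\<^sup>2 = 0"
    using z0(2) c0 unfolding De k[symmetric] by (simp add: k1 k4 k6)
  have rt: "k2 * \<sigma> + 2 * k3 * \<tau> - k2 * \<sigma>\<^sup>2 + 2 * k5 * \<sigma> * \<tau> - 3 * k3 * \<tau>\<^sup>2 = 0"
    using z0(3) c0 unfolding Df k[symmetric] by (simp add: k1 k4 k6)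
  (* With r = k2 * (s - s^2) + k3 * (t - t^2) + k5 * s * t, the combination 2 * r - s * r_s - t * r_t
     is the linear part k2 * s + k3 * t of r. *)
  define X where "X = k2 * \<sigma>"
  have X: "k3 * \<tau> = - X" using r rs rt unfolding X_def by linarith
  have sq: "k2 * \<sigma>\<^sup>2 = X * \<sigma>" "k3 * \<tau>\<^sup>2 = - X * \<tau>"
    using X by (simp_all add: X_def power2_eq_square flip: mult.assoc)
  have "X - X * \<sigma> - X * \<tau> = 0" using r rs X sq X_def by linarith
  then have "X * (1 - \<sigma> - \<tau>) = 0" by (simp add: algebra_simps)
  then have "X = 0" using c0 by simp
  then have "k2 = 0" "k3 = 0" using X c0 by (simp_all add: X_def)
  moreover from this have "k5 = 0" using r c0 by simp
  ultimately show ?thesis using P[of s t] k1 k4 k6 unfolding e_def f_def k[symmetric] by simp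
qed

section \<open>The local interpolation problems\<close>

lemma eval_partial_Poly: assumes "p \<in> Poly d" shows "eval_partial a b x UNIV p = partial a b p x"
  using Poly_continuous[OF Poly_partial[OF assms, of a b]]
  by (auto simp: eval_partial_def isCont_def intro!: tendsto_Lim)

lemma eval_dir_Poly: assumes "p \<in> Poly d" shows "eval_dir e x UNIV p = dir_deriv e p x"
  using Poly_continuous[OF Poly_dir_deriv[OF assms, of e]]
  by (auto simp: eval_dir_def isCont_def intro!: tendsto_Lim)

text \<open>Linearity is required on polynomials only: a limit of derivatives of an arbitrary function need not
exist, and then it has an unspecified value.\<close>

definition linear_nodal :: "nat \<Rightarrow> nodal \<Rightarrow> bool" where
  "linear_nodal d \<eta> \<longleftrightarrow>
     (\<forall>f\<in>Poly d. \<forall>g\<in>Poly d. \<eta> UNIV (\<lambda>x. f x + g x) = \<eta> UNIV f + \<eta> UNIV g) \<and>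
     (\<forall>f\<in>Poly d. \<forall>k. \<eta> UNIV (\<lambda>x. k * f x) = k * \<eta> UNIV f)"

lemma linear_nodal_eval_partial: "linear_nodal d (eval_partial a b x)"
  unfolding linear_nodal_def
  by (auto simp: eval_partial_Poly[OF Poly_add] eval_partial_Poly[OF Poly_scale] eval_partial_Poly partial_Poly_add partial_Poly_scale)

lemma linear_nodal_eval_dir: "linear_nodal d (eval_dir e x)"
  unfolding linear_nodal_def
  by (auto simp: eval_dir_Poly[OF Poly_add] eval_dir_Poly[OF Poly_scale] eval_dir_Poly dir_deriv_Poly_add dir_deriv_Poly_scale)

lemma linear_nodal_jet: "\<eta> \<in> jet k x \<Longrightarrow> linear_nodal d \<eta>"
  unfolding jet_def by (auto simp: linear_nodal_eval_partial)

lemma linear_nodal_N_edge: "\<eta> \<in> N_edge \<nu> a b \<Longrightarrow> linear_nodal d \<eta>"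
  unfolding N_edge_def by (auto simp: linear_nodal_eval_partial linear_nodal_eval_dir)

lemma jet_eq_image: "jet k x = (\<lambda>(a, b). eval_partial a b x) ` Sigma {..k} (\<lambda>a. {..k - a})"
  unfolding jet_def by (auto simp: image_iff) (metis add.commute add_leD2 le_diff_conv2)

lemma card_index_sets:
  "card (Sigma {..4::nat} (\<lambda>a. {..4 - a})) = 15" "card (Sigma {..5::nat} (\<lambda>a. {..5 - a})) = 21"
  "card (Sigma {..6::nat} (\<lambda>a. {..6 - a})) = 28"
  by (simp_all add: numeral_eq_Suc)

lemma finite_jet [simp]: "finite (jet k x)"
  unfolding jet_eq_image by auto

lemma card_jet_2: "card (jet 2 x) \<le> 6" and card_jet_1: "card (jet 1 x) \<le> 3"
proof -
  have "card (Sigma {..2::nat} (\<lambda>a. {..2 - a})) = 6" "card (Sigma {..1::nat} (\<lambda>a. {..1 - a})) = 3"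
    by (simp_all add: numeral_eq_Suc)
  then show "card (jet 2 x) \<le> 6" "card (jet 1 x) \<le> 3" unfolding jet_eq_image
    by (metis (no_types, lifting) card_image_le finite_SigmaI finite_atMost)+
qed

lemma finite_N_edge [simp]: "finite (N_edge \<nu> a b)" and card_N_edge: "card (N_edge \<nu> a b) \<le> 3"
  unfolding N_edge_def by (auto simp: card_insert_if)

lemma edge_point_swap: "edge_point 2 a b = edge_point 2 b a" "edge_point 1 a b = edge_point 3 b a" "edge_point 3 a b = edge_point 1 b a"
  by (simp_all add: edge_point_def vec_eq_iff field_simps)

lemma N_edge_swap: "N_edge \<nu> a b = N_edge \<nu> b a"
  unfolding N_edge_def edge_point_swap[of a b] by (auto simp: insert_commute)

lemma zero_2jet_if_jet:
  assumes "p \<in> Poly d" "\<And>\<eta>. \<eta> \<in> jet 2 v \<Longrightarrow> \<eta> UNIV p = 0" shows "zero_2jet p v"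
  unfolding zero_2jet_def using assms(2) eval_partial_Poly[OF assms(1)] by (force simp: jet_def)

lemma zero_1jet_if_jet:
  assumes "p \<in> Poly d" "\<And>\<eta>. \<eta> \<in> jet 1 v \<Longrightarrow> \<eta> UNIV p = 0" shows "zero_1jet p v"
  unfolding zero_1jet_def using assms(2) eval_partial_Poly[OF assms(1)] by (force simp: jet_def)

text \<open>Twice the signed area of the triangle spanned by \<open>e\<close> and \<open>f\<close>, so its sign tells on which side of the
line of direction \<open>e\<close> the vector \<open>f\<close> points.\<close>

definition cross :: "plane \<Rightarrow> plane \<Rightarrow> real" where
  "cross e f = e $ 1 * f $ 2 - e $ 2 * f $ 1"

lemma parallel_if_cross_zero:
  assumes "cross e f = 0" "e \<noteq> 0" shows "\<exists>k. f = k *\<^sub>R e"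
proof (cases "e $ 1 = 0")
  case True
  then have e2: "e $ 2 \<noteq> 0" using assms(2) by (auto simp: vec_eq_iff forall_2)
  then have "f $ 1 = 0" using assms(1) True by (simp add: cross_def)
  then have "f = (f $ 2 / e $ 2) *\<^sub>R e" using True e2 by (simp add: vec_eq_iff forall_2)
  then show ?thesis by blast
next
  case False
  then have "f = (f $ 1 / e $ 1) *\<^sub>R e" using assms(1) by (simp add: cross_def vec_eq_iff forall_2 field_simps)
  then show ?thesis by blast
qed

lemma cramer:
  assumes "cross e f \<noteq> 0"
  shows "h = (cross h f / cross e f) *\<^sub>R e + (cross e h / cross e f) *\<^sub>R f"
proof -
  have "cross e f * h $ k = cross h f * e $ k + cross e h * f $ k" if "k = 1 \<or> k = 2" for k
    using that unfolding cross_def by (auto simp: algebra_simps)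
  from this[of 1] this[of 2] show ?thesis using assms by (simp add: vec_eq_iff forall_2 field_simps)
qed

lemma cross_nonzero_if_not_collinear:
  assumes "\<not> collinear {a, b, c}" shows "cross (b - a) (c - a) \<noteq> 0"
proof
  assume 0: "cross (b - a) (c - a) = 0"
  have "b - a \<noteq> 0" using assms by auto
  from parallel_if_cross_zero[OF 0 this] obtain k where "c - a = k *\<^sub>R (b - a)" by blast
  then have "collinear {0, b - a, c - a}" unfolding collinear_lemma by blast
  then have "collinear {b, a, c}" using collinear_3[of b a c] by (simp add: NO_MATCH_def)
  then show False using assms by (simp add: insert_commute)
qed

lemma affine_coordinates:
  assumes "\<not> collinear {a, b, c}"
  shows "x = a + (cross (x - a) (c - a) / cross (b - a) (c - a)) *\<^sub>R (b - a)
           + (cross (b - a) (x - a) / cross (b - a) (c - a)) *\<^sub>R (c - a)"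
  using cramer[OF cross_nonzero_if_not_collinear[OF assms], of "x - a"] by (simp add: algebra_simps)

lemma not_collinear_distinct:
  assumes "\<not> collinear {a, b, c}" shows "a \<noteq> b" "b \<noteq> c" "a \<noteq> c"
  using assms by (auto simp: insert_commute)

definition unit_normal :: "(plane set \<Rightarrow> plane) \<Rightarrow> plane \<Rightarrow> plane \<Rightarrow> bool" where
  "unit_normal \<nu> a b \<longleftrightarrow> norm (\<nu> {a, b}) = 1 \<and> \<nu> {a, b} \<bullet> (b - a) = 0"

theorem ordinary_interpolation:
  assumes nc: "\<not> collinear {v1, v2, v3}" and \<nu>: "unit_normal \<nu> v1 v2" "unit_normal \<nu> v2 v3" "unit_normal \<nu> v1 v3"
  shows "\<exists>!p. p \<in> Poly 5 \<and> (\<forall>\<eta>\<in>N_ordinary \<nu> v1 v2 v3. \<eta> UNIV p = y \<eta>)"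
proof (rule unisolvent_interpolation)
  let ?E = "{eval_dir (\<nu> {v1, v2}) (edge_point 2 v1 v2), eval_dir (\<nu> {v2, v3}) (edge_point 2 v2 v3),
      eval_dir (\<nu> {v1, v3}) (edge_point 2 v1 v3)}"
  show "finite (N_ordinary \<nu> v1 v2 v3)" unfolding N_ordinary_def by simp
  have "card (N_ordinary \<nu> v1 v2 v3) \<le> card (jet 2 v1 \<union> jet 2 v2 \<union> jet 2 v3) + card ?E"
    unfolding N_ordinary_def by (rule card_Un_le)
  also have "card (jet 2 v1 \<union> jet 2 v2 \<union> jet 2 v3) \<le> card (jet 2 v1 \<union> jet 2 v2) + card (jet 2 v3)" by (rule card_Un_le)
  also have "card (jet 2 v1 \<union> jet 2 v2) \<le> card (jet 2 v1) + card (jet 2 v2)" by (rule card_Un_le)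
  also have "card ?E \<le> 3" by (simp add: card_insert_if)
  finally show "card (N_ordinary \<nu> v1 v2 v3) \<le> card (Sigma {..5::nat} (\<lambda>a. {..5 - a}))"
    unfolding card_index_sets using card_jet_2[of v1] card_jet_2[of v2] card_jet_2[of v3] by simp
  have l: "linear_nodal 5 \<eta>" if "\<eta> \<in> N_ordinary \<nu> v1 v2 v3" for \<eta>
    using that unfolding N_ordinary_def by (auto simp: linear_nodal_jet linear_nodal_eval_dir)
  fix \<eta> f g k assume \<eta>: "\<eta> \<in> N_ordinary \<nu> v1 v2 v3" and f: "f \<in> Poly 5"
  show "\<eta> UNIV (\<lambda>x. f x + g x) = \<eta> UNIV f + \<eta> UNIV g" if "g \<in> Poly 5"
    using l[OF \<eta>] f that unfolding linear_nodal_def by blast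
  show "\<eta> UNIV (\<lambda>x. k * f x) = k * \<eta> UNIV f"
    using l[OF \<eta>] f unfolding linear_nodal_def by blast
next
  fix p assume p: "p \<in> Poly 5" and 0: "\<And>\<eta>. \<eta> \<in> N_ordinary \<nu> v1 v2 v3 \<Longrightarrow> \<eta> UNIV p = 0"
  have j: "zero_2jet p v1" "zero_2jet p v2" "zero_2jet p v3"
    by (rule zero_2jet_if_jet[OF p]; rule 0; simp add: N_ordinary_def)+
  have n: "dir_deriv (\<nu> {v1, v2}) p (edge_point 2 v1 v2) = 0"
    "dir_deriv (\<nu> {v2, v3}) p (edge_point 2 v2 v3) = 0"
    "dir_deriv (\<nu> {v1, v3}) p (edge_point 2 v1 v3) = 0"
    by (subst eval_dir_Poly[OF p, symmetric]; rule 0; simp add: N_ordinary_def)+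
  note d = not_collinear_distinct[OF nc] and \<nu>' = \<nu>[unfolded unit_normal_def]
  have "zero_1jet p (v1 + t *\<^sub>R (v2 - v1))" "zero_1jet p (v1 + t *\<^sub>R (v3 - v1))" "zero_1jet p (v2 + t *\<^sub>R (v3 - v2))" for t
    using edge_zero_C1_degree_5[OF p j(1,2) n(1)] edge_zero_C1_degree_5[OF p j(1,3) n(3)] edge_zero_C1_degree_5[OF p j(2,3) n(2)] \<nu>' d
    by blast+
  from C1_zero_triangle_degree_5[OF p this] show "p = (\<lambda>_. 0)"
    using affine_coordinates[OF nc] by (metis (no_types, lifting) ext)
qed

text \<open>The hypotheses on \<open>c\<close> place it in the interior of the triangle. The 6, 3, 3 and 3 functionals at the
four points match the dimension 15.\<close>

theorem pie_interpolation:
  assumes nc: "\<not> collinear {v1, v2, v3}" and c: "c = v1 + \<sigma> *\<^sub>R (v2 - v1) + \<tau> *\<^sub>R (v3 - v1)" "0 < \<sigma>" "0 < \<tau>" "\<sigma> + \<tau> < 1"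
  shows "\<exists>!p. p \<in> Poly 4 \<and> (\<forall>\<eta>\<in>jet 2 v1 \<union> jet 1 v2 \<union> jet 1 v3 \<union> jet 1 c. \<eta> UNIV p = y \<eta>)"
proof (rule unisolvent_interpolation)
  let ?N = "jet 2 v1 \<union> jet 1 v2 \<union> jet 1 v3 \<union> jet 1 c"
  show "finite ?N" by simp
  have "card ?N \<le> card (jet 2 v1 \<union> jet 1 v2 \<union> jet 1 v3) + card (jet 1 c)" by (rule card_Un_le)
  also have "card (jet 2 v1 \<union> jet 1 v2 \<union> jet 1 v3) \<le> card (jet 2 v1 \<union> jet 1 v2) + card (jet 1 v3)" by (rule card_Un_le)
  also have "card (jet 2 v1 \<union> jet 1 v2) \<le> card (jet 2 v1) + card (jet 1 v2)" by (rule card_Un_le)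
  finally show "card ?N \<le> card (Sigma {..4::nat} (\<lambda>a. {..4 - a}))"
    unfolding card_index_sets using card_jet_2[of v1] card_jet_1[of v2] card_jet_1[of v3] card_jet_1[of c] by simp
  have l: "linear_nodal 4 \<eta>" if "\<eta> \<in> ?N" for \<eta>
    using that by (auto simp: linear_nodal_jet)
  fix \<eta> f g k assume \<eta>: "\<eta> \<in> ?N" and f: "f \<in> Poly 4"
  show "\<eta> UNIV (\<lambda>x. f x + g x) = \<eta> UNIV f + \<eta> UNIV g" if "g \<in> Poly 4"
    using l[OF \<eta>] f that unfolding linear_nodal_def by blast
  show "\<eta> UNIV (\<lambda>x. k * f x) = k * \<eta> UNIV f"
    using l[OF \<eta>] f unfolding linear_nodal_def by blast
next
  fix p assume p: "p \<in> Poly 4" and 0: "\<And>\<eta>. \<eta> \<in> jet 2 v1 \<union> jet 1 v2 \<union> jet 1 v3 \<union> jet 1 c \<Longrightarrow> \<eta> UNIV p = 0"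
  have j: "zero_2jet p v1" by (rule zero_2jet_if_jet[OF p]; rule 0; simp)
  have j': "zero_1jet p v2" "zero_1jet p v3" "zero_1jet p (v1 + \<sigma> *\<^sub>R (v2 - v1) + \<tau> *\<^sub>R (v3 - v1))"
    by (rule zero_1jet_if_jet[OF p]; rule 0; simp add: c)+
  from pie_unisolvent[OF p j j' c(2-4)] show "p = (\<lambda>_. 0)"
    using affine_coordinates[OF nc] by (metis (no_types, lifting) ext)
qed

theorem buffer_interpolation:
  assumes nc: "\<not> collinear {v1, v2, v3}" and \<nu>: "unit_normal \<nu> v1 v2" "unit_normal \<nu> v2 v3" "unit_normal \<nu> v1 v3"
  shows "\<exists>!p. p \<in> Poly 6 \<and> p ((1 / 3) *\<^sub>R (v1 + v2 + v3)) = y0 \<and>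
           (\<forall>\<eta> \<in> N_edge \<nu> v2 v3 \<union> jet 2 v2 \<union> jet 2 v3. \<eta> UNIV p = y1 \<eta>) \<and>
           (\<forall>\<eta> \<in> N_edge \<nu> v1 v2 \<union> jet 2 v1. \<eta> UNIV p = y2 \<eta>) \<and>
           (\<forall>\<eta> \<in> N_edge \<nu> v1 v3. \<eta> UNIV p = y3 \<eta>)"
proof -
  define c where "c = (1 / 3) *\<^sub>R (v1 + v2 + v3)"
  define N1 N2 N3 where N: "N1 = N_edge \<nu> v2 v3 \<union> jet 2 v2 \<union> jet 2 v3" "N2 = N_edge \<nu> v1 v2 \<union> jet 2 v1" "N3 = N_edge \<nu> v1 v3"
  (* The functionals are tagged by the cell that supplies their values, so that the values form a
     function on the set of tagged functionals. *)
  define F where "F = {0::nat} \<times> {eval_partial 0 0 c} \<union> {1} \<times> N1 \<union> {2} \<times> N2 \<union> {3} \<times> N3"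
  define y where "y = (\<lambda>(k::nat, \<eta>). if k = 0 then y0 else if k = 1 then y1 \<eta> else if k = 2 then y2 \<eta> else y3 \<eta>)"
  have fin: "finite N1" "finite N2" "finite N3" unfolding N by simp_all
  have "\<exists>!p. p \<in> Poly 6 \<and> (\<forall>z\<in>F. snd z UNIV p = y z)"
  proof (rule unisolvent_interpolation)
    show "finite F" unfolding F_def using fin by simp
    have "card N1 \<le> card (N_edge \<nu> v2 v3 \<union> jet 2 v2) + card (jet 2 v3)" unfolding N by (rule card_Un_le)
    also have "card (N_edge \<nu> v2 v3 \<union> jet 2 v2) \<le> card (N_edge \<nu> v2 v3) + card (jet 2 v2)" by (rule card_Un_le)
    finally have 1: "card N1 \<le> 15" using card_jet_2[of v2] card_jet_2[of v3] card_N_edge[of \<nu> v2 v3] by simp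
    have "card N2 \<le> card (N_edge \<nu> v1 v2) + card (jet 2 v1)" unfolding N by (rule card_Un_le)
    then have 2: "card N2 \<le> 9" using card_jet_2[of v1] card_N_edge[of \<nu> v1 v2] by simp
    have 3: "card N3 \<le> 3" unfolding N by (rule card_N_edge)
    have "card F \<le> card ({0::nat} \<times> {eval_partial 0 0 c} \<union> {1} \<times> N1 \<union> {2} \<times> N2) + card ({3::nat} \<times> N3)" 
      unfolding F_def by (rule card_Un_le)
    also have "card ({0::nat} \<times> {eval_partial 0 0 c} \<union> {1} \<times> N1 \<union> {2} \<times> N2)
      \<le> card ({0::nat} \<times> {eval_partial 0 0 c} \<union> {1} \<times> N1) + card ({2::nat} \<times> N2)" by (rule card_Un_le)
    also have "card ({0::nat} \<times> {eval_partial 0 0 c} \<union> {1} \<times> N1)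
      \<le> card ({0::nat} \<times> {eval_partial 0 0 c}) + card ({1::nat} \<times> N1)" by (rule card_Un_le)
    finally show "card F \<le> card (Sigma {..6::nat} (\<lambda>a. {..6 - a}))"
      unfolding card_index_sets using 1 2 3 by (simp add: card_cartesian_product_singleton)
    have l: "linear_nodal 6 (snd z)" if "z \<in> F" for z
      using that unfolding F_def N by (auto simp: linear_nodal_jet linear_nodal_N_edge linear_nodal_eval_partial)
    fix \<eta> f g k assume \<eta>: "\<eta> \<in> F" and f: "f \<in> Poly 6"
    show "snd \<eta> UNIV (\<lambda>x. f x + g x) = snd \<eta> UNIV f + snd \<eta> UNIV g" if "g \<in> Poly 6"
      using l[OF \<eta>] f that unfolding linear_nodal_def by blast
    show "snd \<eta> UNIV (\<lambda>x. k * f x) = k * snd \<eta> UNIV f"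
      using l[OF \<eta>] f unfolding linear_nodal_def by blast
  next
    fix p assume p: "p \<in> Poly 6" and 0: "\<And>z. z \<in> F \<Longrightarrow> snd z UNIV p = 0"
    have Z: "\<eta> UNIV p = 0" if "\<eta> \<in> N1 \<union> N2 \<union> N3 \<union> {eval_partial 0 0 c}" for \<eta>
      using 0[of "(0, \<eta>)"] 0[of "(1, \<eta>)"] 0[of "(2, \<eta>)"] 0[of "(3, \<eta>)"] that unfolding F_def by auto
    have j: "zero_2jet p v1" "zero_2jet p v2" "zero_2jet p v3"
      by (rule zero_2jet_if_jet[OF p]; rule Z; simp add: N)+
    have ed: "p (edge_point 2 a b) = 0 \<and> dir_deriv (\<nu> {a, b}) p (edge_point 1 a b) = 0 \<and> dir_deriv (\<nu> {a, b}) p (edge_point 3 a b) = 0"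
      if "N_edge \<nu> a b \<subseteq> N1 \<union> N2 \<union> N3" for a b
    proof -
      have "\<eta> UNIV p = 0" if "\<eta> \<in> N_edge \<nu> a b" for \<eta> using Z that \<open>N_edge \<nu> a b \<subseteq> N1 \<union> N2 \<union> N3\<close> by blast
      from this[of "eval_partial 0 0 (edge_point 2 a b)"] this[of "eval_dir (\<nu> {a, b}) (edge_point 1 a b)"]
        this[of "eval_dir (\<nu> {a, b}) (edge_point 3 a b)"]
      show ?thesis by (simp add: N_edge_def eval_partial_Poly[OF p] eval_dir_Poly[OF p] partial_simps(1))
    qed
    have ed': "N_edge \<nu> v1 v2 \<subseteq> N1 \<union> N2 \<union> N3" "N_edge \<nu> v2 v3 \<subseteq> N1 \<union> N2 \<union> N3" "N_edge \<nu> v1 v3 \<subseteq> N1 \<union> N2 \<union> N3"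
      unfolding N by auto
    note ed12 = ed[OF ed'(1)] and ed23 = ed[OF ed'(2)] and ed13 = ed[OF ed'(3)]
    note d = not_collinear_distinct[OF nc] and \<nu>' = \<nu>[unfolded unit_normal_def]
    have "zero_1jet p (v1 + t *\<^sub>R (v2 - v1))" "zero_1jet p (v1 + t *\<^sub>R (v3 - v1))" "zero_1jet p (v2 + t *\<^sub>R (v3 - v2))" for t
      using edge_zero_C1_degree_6[OF p j(1,2)] edge_zero_C1_degree_6[OF p j(1,3)] edge_zero_C1_degree_6[OF p j(2,3)] ed12 ed13 ed23 \<nu>' d
      by blast+
    moreover have "p ((1 / 3) *\<^sub>R (v1 + v2 + v3)) = 0"
      using Z[of "eval_partial 0 0 c"] eval_partial_Poly[OF p, of 0 0 c] by (simp add: c_def partial_simps)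
    ultimately have "p (v1 + s *\<^sub>R (v2 - v1) + t *\<^sub>R (v3 - v1)) = 0" for s t
      by (rule C1_zero_triangle_degree_6[OF p])
    then show "p = (\<lambda>_. 0)"
      using affine_coordinates[OF nc] by (metis (no_types, lifting) ext)
  qed
  moreover have "p \<in> Poly 6 \<and> (\<forall>z\<in>F. snd z UNIV p = y z) \<longleftrightarrow> p \<in> Poly 6 \<and> p c = y0 \<and> (\<forall>\<eta>\<in>N1. \<eta> UNIV p = y1 \<eta>) \<and> (\<forall>\<eta>\<in>N2. \<eta> UNIV p = y2 \<eta>) \<and>
       (\<forall>\<eta>\<in>N3. \<eta> UNIV p = y3 \<eta>)" for p
  proof (rule conj_cong[OF refl])
    assume "p \<in> Poly 6"
    then have "eval_partial 0 0 c UNIV p = p c" by (simp add: eval_partial_Poly partial_simps)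
    then show "(\<forall>z\<in>F. snd z UNIV p = y z) \<longleftrightarrow> p c = y0 \<and> (\<forall>\<eta>\<in>N1. \<eta> UNIV p = y1 \<eta>) \<and> (\<forall>\<eta>\<in>N2. \<eta> UNIV p = y2 \<eta>) \<and>
       (\<forall>\<eta>\<in>N3. \<eta> UNIV p = y3 \<eta>)"
      unfolding F_def y_def by (simp add: ball_Un)
  qed
  ultimately show ?thesis unfolding N c_def by simp
qed

section \<open>Limits of derivatives at the closure\<close>

lemma at_within_open_nontrivial:
  fixes S :: "plane set"
  assumes "open S" "v \<in> closure S" shows "at v within S \<noteq> bot"
proof (cases "v \<in> S")
  case True
  then show ?thesis using assms(1) by (simp add: at_within_open_NO_MATCH at_neq_bot)
next
  case False
  then have "v islimpt S" using assms(2) by (simp add: closure_def)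
  then show ?thesis using trivial_limit_within by blast
qed

lemma Ck_closure_tendsto:
  assumes "open S" "v \<in> closure S" "Ck_closure k S f" "a + b \<le> k"
  shows "(partial a b f \<longlongrightarrow> eval_partial a b v S f) (at v within S)"
proof -
  obtain g where g: "continuous_on (closure S) g" "\<And>x. x \<in> S \<Longrightarrow> g x = partial a b f x"
    using assms(3,4) unfolding Ck_closure_def by blast
  have "(g \<longlongrightarrow> g v) (at v within S)"
    by (rule tendsto_within_subset[OF _ closure_subset]) (use g(1) assms(2) in \<open>simp add: continuous_on_def\<close>)
  then have "(partial a b f \<longlongrightarrow> g v) (at v within S)"
    by (rule Lim_transform_eventually) (auto simp: eventually_at_filter g)
  moreover from this have "eval_partial a b v S f = g v"
    unfolding eval_partial_def by (intro tendsto_Lim at_within_open_nontrivial assms)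
  ultimately show ?thesis by simp
qed

lemma dir_deriv_cong_open:
  assumes "open S" "x \<in> S" "\<And>y. y \<in> S \<Longrightarrow> f y = g y"
  shows "dir_deriv e f x = dir_deriv e g x"
proof -
  have "(f has_derivative D) (at x) \<longleftrightarrow> (g has_derivative D) (at x)" for D
    using has_derivative_transform_within_open[of f D x UNIV S g] has_derivative_transform_within_open[of g D x UNIV S f] assms
    by auto
  then show ?thesis unfolding dir_deriv_def frechet_derivative_def by simp
qed

lemma partial_cong_open:
  assumes S: "open S" and x: "x \<in> S" and eq: "\<And>y. y \<in> S \<Longrightarrow> f y = g y"
  shows "partial a b f x = partial a b g x"
proof -
  have "\<forall>x\<in>S. (dir_deriv e ^^ m) f x = (dir_deriv e ^^ m) g x" if "\<forall>x\<in>S. f x = g x" for m e f g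
    using that by (induction m) (auto intro: dir_deriv_cong_open[OF S])
  then show ?thesis unfolding partial_def using eq x by blast
qed

lemma dir_deriv_mult:
  assumes "f differentiable (at x)" "g differentiable (at x)"
  shows "dir_deriv e (\<lambda>x. f x * g x) x = dir_deriv e f x * g x + f x * dir_deriv e g x"
proof -
  have "(f has_derivative frechet_derivative f (at x)) (at x)" "(g has_derivative frechet_derivative g (at x)) (at x)"
    using assms frechet_derivative_works by blast+
  from dir_deriv_at[OF has_derivative_mult[OF this]] show ?thesis by (simp add: dir_deriv_def)
qed

lemma dir_deriv_add:
  assumes "f differentiable (at x)" "g differentiable (at x)"
  shows "dir_deriv e (\<lambda>x. f x + g x) x = dir_deriv e f x + dir_deriv e g x"
proof -
  have "(f has_derivative frechet_derivative f (at x)) (at x)" "(g has_derivative frechet_derivative g (at x)) (at x)"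
    using assms frechet_derivative_works by blast+
  from dir_deriv_at[OF has_derivative_add[OF this]] show ?thesis by (simp add: dir_deriv_def)
qed

text \<open>A formula in the two arrays of derivatives, so that it applies to limits of derivatives at boundary
points as well.\<close>

definition leibniz :: "(nat \<Rightarrow> nat \<Rightarrow> real) \<Rightarrow> (nat \<Rightarrow> nat \<Rightarrow> real) \<Rightarrow> nat \<Rightarrow> nat \<Rightarrow> real" where
  "leibniz F G a b = (\<Sum>i\<le>a. \<Sum>j\<le>b. of_nat (a choose i) * of_nat (b choose j) * F i j * G (a - i) (b - j))"

lemma order_two_cases:
  fixes a b :: nat
  assumes "a + b \<le> 2"
  shows "a = 0 \<and> b = 0 \<or> a = 1 \<and> b = 0 \<or> a = 0 \<and> b = 1 \<or> a = 2 \<and> b = 0 \<or> a = 1 \<and> b = 1 \<or> a = 0 \<and> b = 2"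
  using assms by auto

lemma Ck_on_differentiable:
  assumes "open S" "Ck_on (Suc k) S f" "x \<in> S" shows "f differentiable (at x)"
  using assms differentiable_on_eq_differentiable_at[OF assms(1), of f] by simp

lemma partial_mult:
  assumes S: "open S" and x: "x \<in> S" and f: "Ck_on 2 S f" and g: "Ck_on 2 S g" and ab: "a + b \<le> 2"
  shows "partial a b (\<lambda>x. f x * g x) x = leibniz (\<lambda>i j. partial i j f x) (\<lambda>i j. partial i j g x) a b"
proof -
  have d0: "f differentiable (at y)" "g differentiable (at y)" if "y \<in> S" for y
    using Ck_on_differentiable[OF S _ that, of "Suc 0"] f g by (simp_all add: numeral_2_eq_2)
  have d1: "dir_deriv (axis i 1) f differentiable (at y)" "dir_deriv (axis i 1) g differentiable (at y)" if "y \<in> S" for y i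
    using Ck_on_differentiable[OF S _ that, of 0] f g unfolding numeral_2_eq_2 Ck_on.simps(2) by blast+
  have 1: "dir_deriv e (\<lambda>x. f x * g x) y = dir_deriv e f y * g y + f y * dir_deriv e g y" if "y \<in> S" for e y
    by (rule dir_deriv_mult[OF d0[OF that]])
  have 2: "dir_deriv (axis k 1) (dir_deriv (axis i 1) (\<lambda>x. f x * g x)) x =
     dir_deriv (axis k 1) (dir_deriv (axis i 1) f) x * g x + dir_deriv (axis i 1) f x * dir_deriv (axis k 1) g x
     + dir_deriv (axis k 1) f x * dir_deriv (axis i 1) g x + f x * dir_deriv (axis k 1) (dir_deriv (axis i 1) g) x" for i k
  proof -
    have "dir_deriv (axis k 1) (dir_deriv (axis i 1) (\<lambda>x. f x * g x)) x
        = dir_deriv (axis k 1) (\<lambda>y. dir_deriv (axis i 1) f y * g y + f y * dir_deriv (axis i 1) g y) x"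
      by (rule dir_deriv_cong_open[OF S x 1])
    also have "\<dots> = dir_deriv (axis k 1) (\<lambda>y. dir_deriv (axis i 1) f y * g y) x + dir_deriv (axis k 1) (\<lambda>y. f y * dir_deriv (axis i 1) g y) x"
      by (rule dir_deriv_add; rule differentiable_mult; rule d0 d1; rule x)
    finally show ?thesis using d0[OF x] d1[OF x] by (simp add: dir_deriv_mult)
  qed
  from order_two_cases[OF ab] show ?thesis
    by (elim disjE conjE) (simp_all add: leibniz_def partial_simps sum_atMost_2 1[OF x] 2 numeral_2_eq_2[symmetric] algebra_simps)
qed

lemma Poly_Ck_on: "p \<in> Poly d \<Longrightarrow> Ck_on k S p"
proof (induction k arbitrary: p)
  case 0
  then show ?case using Poly_continuous continuous_at_imp_continuous_on by (metis Ck_on.simps(1))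
next
  case (Suc k)
  have "dir_deriv e p \<in> Poly d" for e using Poly_mono[OF Poly_dir_deriv[OF Suc.prems]] by simp
  then show ?case using Suc Poly_differentiable[OF Suc.prems] by (auto simp: differentiable_on_def intro: differentiable_at_withinI)
qed

text \<open>A derivative of order two of \<open>w\<close> or \<open>p\<close> occurs in the Leibniz rule for order two only with the factor
\<open>q v\<close>. If this is zero, then it is enough that \<open>p\<close> interpolates \<open>w\<close> to first order: the second
derivatives of \<open>w\<close> have limits at \<open>v\<close>, and their product with \<open>q\<close> tends to zero.\<close>

lemma jet_of_product:
  assumes S: "open S" "v \<in> closure S" and w: "Ck_closure 2 S w" and q: "q \<in> Poly d" and p: "p \<in> Poly e"
    and U: "\<And>x. x \<in> S \<Longrightarrow> U x = w x * q x"
    and lim: "(partial a b U \<longlongrightarrow> l) (at v within S)" and ab: "a + b \<le> 2"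
    and jet: "\<And>i j. i + j \<le> 2 \<Longrightarrow> i + j \<le> 1 \<or> q v \<noteq> 0 \<Longrightarrow> partial i j p v = eval_partial i j v S w"
  shows "partial a b (\<lambda>x. p x * q x) v = l"
proof -
  let ?W = "\<lambda>i j. eval_partial i j v S w" and ?Q = "\<lambda>i j. partial i j q v"
  have "partial a b U x = leibniz (\<lambda>i j. partial i j w x) (\<lambda>i j. partial i j q x) a b" if "x \<in> S" for x
    using partial_cong_open[OF S(1) that U] partial_mult[OF S(1) that _ Poly_Ck_on[OF q] ab] w unfolding Ck_closure_def by simp
  then have "((\<lambda>x. leibniz (\<lambda>i j. partial i j w x) (\<lambda>i j. partial i j q x) a b) \<longlongrightarrow> l) (at v within S)"
    by (intro Lim_transform_eventually[OF lim]) (auto simp: eventually_at_filter)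
  moreover have "((\<lambda>x. leibniz (\<lambda>i j. partial i j w x) (\<lambda>i j. partial i j q x) a b) \<longlongrightarrow> leibniz ?W ?Q a b) (at v within S)"
    unfolding leibniz_def
  proof (intro tendsto_sum tendsto_mult tendsto_const)
    fix i j assume "i \<in> {..a}" "j \<in> {..b}"
    then show "(partial i j w \<longlongrightarrow> ?W i j) (at v within S)" using ab by (intro Ck_closure_tendsto[OF S w]) auto
    show "(partial (a - i) (b - j) q \<longlongrightarrow> partial (a - i) (b - j) q v) (at v within S)"
      using Poly_continuous[OF Poly_partial[OF q]] continuous_at_imp_continuous_at_within continuous_within by blast
  qed
  ultimately have l: "l = leibniz ?W ?Q a b" using tendsto_unique at_within_open_nontrivial[OF S] by blast
  have "partial a b (\<lambda>x. p x * q x) v = leibniz (\<lambda>i j. partial i j p v) ?Q a b"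
    by (rule partial_mult[OF open_UNIV UNIV_I Poly_Ck_on[OF p] Poly_Ck_on[OF q] ab])
  also have "\<dots> = leibniz ?W ?Q a b" unfolding leibniz_def
  proof (intro sum.cong refl)
    fix i j assume ij: "i \<in> {..a}" "j \<in> {..b}"
    show "real (a choose i) * real (b choose j) * partial i j p v * partial (a - i) (b - j) q v =
          real (a choose i) * real (b choose j) * ?W i j * partial (a - i) (b - j) q v"
    proof (cases "i + j \<le> 1 \<or> q v \<noteq> 0")
      case True
      then show ?thesis using jet[of i j] ij ab by auto
    next
      case False
      then have "a - i = 0" "b - j = 0" using ij ab by auto
      then have "partial (a - i) (b - j) q v = 0" using False by (simp add: partial_simps)
      then show ?thesis by simp
    qed
  qed
  finally show ?thesis using l by simp
qed

text \<open>The open set where \<open>f\<close> and \<open>g\<close> differ is negligible, hence empty.\<close>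

lemma continuous_AE_eq_imp_eq:
  fixes f g :: "plane \<Rightarrow> real"
  assumes S: "open S" and f: "continuous_on S f" and g: "continuous_on S g" and ae: "AE x in lebesgue_on S. f x = g x" and x: "x \<in> S"
  shows "f x = g x"
proof (rule ccontr)
  assume ne: "f x \<noteq> g x"
  have "AE x in lebesgue. x \<in> S \<longrightarrow> f x = g x"
    using ae AE_restrict_space_iff[of S lebesgue "\<lambda>x. f x = g x"] sets_completionI_sets[of S lborel] borel_open[OF S] by simp
  then obtain N where N': "{x \<in> space lebesgue. \<not> (x \<in> S \<longrightarrow> f x = g x)} \<subseteq> N"
     "emeasure lebesgue N = 0" "N \<in> sets lebesgue"
    by (rule AE_E)
  have N: "{x. \<not> (x \<in> S \<longrightarrow> f x = g x)} \<subseteq> N" using N'(1) by simp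
  have "N \<in> null_sets lebesgue" using N'(2,3) by (rule null_setsI)
  then have neg: "negligible N" by (simp only: negligible_iff_null_sets)
  let ?V = "{y \<in> S. f y - g y \<noteq> 0}"
  have "?V = S \<inter> (\<lambda>y. f y - g y) -` (- {0})" by auto
  then have "open ?V"
    using continuous_open_preimage[OF continuous_on_diff[OF f g] S, of "- {0}"] by (simp only: open_Compl closed_singleton)
  have "?V \<subseteq> N" using N by auto
  then have "negligible ?V" using neg negligible_subset by blast
  then have "?V = {}" using open_not_negligible[OF \<open>open ?V\<close>] by blast
  then show False using ne x by auto
qed

section \<open>Pasting over a finite closed cover\<close>

text \<open>A closed set that does not contain \<open>x\<close> stays away from \<open>x\<close>, so the filter at \<open>x\<close> is the supremum of the
filters within the members that contain \<open>x\<close>.\<close>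

lemma filterlim_finite_closed_cover:
  fixes R :: "'i \<Rightarrow> 'a::topological_space set"
  assumes I: "finite I" and R: "\<And>i. i \<in> I \<Longrightarrow> closed (R i)" and S: "open S" "x \<in> S" "S \<subseteq> (\<Union>i\<in>I. R i)"
    and lim: "\<And>i. i \<in> I \<Longrightarrow> x \<in> R i \<Longrightarrow> filterlim f F (at x within (R i \<inter> S))"
  shows "filterlim f F (at x)"
proof -
  have 1: "filterlim f F (at x within (R i \<inter> S))" if "i \<in> I" for i
  proof (cases "x \<in> R i")
    case False
    then have "at x within (R i \<inter> S) = bot"
      using R[OF that] closed_limpt[of "R i"] islimpt_subset[of x "R i \<inter> S" "R i"] trivial_limit_within[of x "R i \<inter> S"] by auto
    then show ?thesis unfolding filterlim_def by simp
  qed (use lim that in blast)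
  have 0: "filterlim f F bot" unfolding filterlim_def by simp
  have "filterlim f F (at x within (\<Union>i\<in>J. R i \<inter> S))" if "finite J" "J \<subseteq> I" for J
    using that by (induction J rule: finite_induct) (auto simp: at_within_union intro!: filterlim_sup 0 1)
  from this[OF I order_refl] have "filterlim f F (at x within (\<Union>i\<in>I. R i \<inter> S))" .
  moreover have "(\<Union>i\<in>I. R i \<inter> S) = S" using S(3) by auto
  ultimately show ?thesis using at_within_open[OF S(2,1)] by simp
qed

text \<open>Differentiability of a piecewise function is thereby a matter of the pieces at the single point
\<open>x\<close>, whatever the shape of the sets \<open>R i\<close>.\<close>

lemma has_derivative_finite_closed_cover:
  fixes R :: "'i \<Rightarrow> 'a::real_normed_vector set"
  assumes I: "finite I" and R: "\<And>i. i \<in> I \<Longrightarrow> closed (R i)" and S: "open S" "x \<in> S" "S \<subseteq> (\<Union>i\<in>I. R i)"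
    and D: "\<And>i. i \<in> I \<Longrightarrow> x \<in> R i \<Longrightarrow> (P i has_derivative D) (at x)"
    and eq: "\<And>i y. i \<in> I \<Longrightarrow> x \<in> R i \<Longrightarrow> y \<in> R i \<inter> S \<Longrightarrow> f y = P i y"
  shows "(f has_derivative D) (at x)"
proof -
  have D': "(f has_derivative D) (at x within (R i \<inter> S))" if "i \<in> I" "x \<in> R i" for i
    by (rule has_derivative_transform[OF _ eq[OF that] has_derivative_at_withinI[OF D[OF that]]]) (use that S(2) in auto)
  obtain i where i: "i \<in> I" "x \<in> R i" using S by blast
  have "bounded_linear D" using has_derivative_bounded_linear[OF D[OF i]] .
  moreover have "((\<lambda>y. (1 / norm (y - x)) *\<^sub>R (f y - (f x + D (y - x)))) \<longlongrightarrow> 0) (at x)"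
    by (rule filterlim_finite_closed_cover[OF I R S]) (use D' in \<open>auto simp: has_derivative_within\<close>)
  ultimately show ?thesis by (simp add: has_derivative_within)
qed

section \<open>Cells and their inscribed disks\<close>

text \<open>The distance to the complement attains its maximum on the compact set, so a largest disk exists, and
its radius is positive since the interior contains some disk.\<close>

lemma inscribed_center_interior:
  fixes R :: "plane set"
  assumes R: "compact R" "interior R \<noteq> {}"
  shows "inscribed_center R \<in> interior R"
proof -
  let ?d = "\<lambda>x. infdist x (- R)"
  have ne: "R \<noteq> {}" using R(2) interior_subset by blast
  have nc: "- R \<noteq> {}" using compact_imp_bounded[OF R(1)] not_bounded_UNIV by (metis Compl_empty_eq double_complement)
  have "continuous_on R ?d" by (intro continuous_intros)
  then obtain c where c: "c \<in> R" "\<And>x. x \<in> R \<Longrightarrow> ?d x \<le> ?d c"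
    using continuous_attains_sup[OF R(1) ne] by blast
  have sub: "cball c (?d c) \<subseteq> R"
  proof -
    have "ball c (?d c) \<subseteq> R"
    proof
      fix y assume "y \<in> ball c (?d c)"
      then show "y \<in> R" using infdist_le[of y "- R" c] by (cases "y \<in> R") auto
    qed
    then have "closure (ball c (?d c)) \<subseteq> R" using compact_imp_closed[OF R(1)] closure_minimal by blast
    then show ?thesis
    proof (cases "?d c = 0")
      case True then show ?thesis using c by simp
    next
      case False
      then have "0 < ?d c" using infdist_nonneg[of c "- R"] by linarith
      then show ?thesis using \<open>closure (ball c (?d c)) \<subseteq> R\<close> by (simp add: closure_ball)
    qed
  qed
  have max: "r' \<le> ?d c" if "cball c' r' \<subseteq> R" for c' r'
  proof (cases "r' < 0")
    case True then show ?thesis using infdist_nonneg[of c "- R"] by linarith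
  next
    case False
    then have "c' \<in> R" using that by auto
    have "r' \<le> dist c' y" if "y \<in> - R" for y using that \<open>cball c' r' \<subseteq> R\<close> by (force simp: subset_iff not_le)
    then have "r' \<le> ?d c'" unfolding infdist_notempty[OF nc] by (intro cINF_greatest[OF nc]) auto
    then show ?thesis using c(2)[OF \<open>c' \<in> R\<close>] by linarith
  qed
  have "\<exists>r. cball (inscribed_center R) r \<subseteq> R \<and> (\<forall>c' r'. cball c' r' \<subseteq> R \<longrightarrow> r' \<le> r)"
    unfolding inscribed_center_def by (rule someI[of _ c]) (use sub max in blast)
  then obtain r where r: "cball (inscribed_center R) r \<subseteq> R" "\<And>c' r'. cball c' r' \<subseteq> R \<Longrightarrow> r' \<le> r" by blast
  obtain x where "x \<in> interior R" using R(2) by blast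
  then obtain e where "0 < e" "cball x e \<subseteq> R" using mem_interior_cball by blast
  then have "0 < r" using r(2) by force
  then show ?thesis using r(1) mem_interior_cball by blast
qed

lemma closed_region: "closed (region \<gamma> (Straight a b c))"
  by (simp add: compact_imp_closed finite_imp_compact_convex_hull)

lemma closed_region_pie:
  assumes "continuous_on {s..t} (\<gamma> j)" shows "closed (region \<gamma> (Pie v j s t))"
proof -
  have "compact (pie_boundary \<gamma> v j s t)"
    unfolding pie_boundary_def by (intro compact_Un compact_segment compact_continuous_image assms) auto
  then have "open (outside (pie_boundary \<gamma> v j s t))" by (intro open_outside compact_imp_closed)
  then show ?thesis by (simp add: union_with_inside closed_Compl)
qed

lemma interior_triangle_coordinates:
  fixes a b c :: plane
  assumes "\<not> collinear {a, b, c}" "x \<in> interior (convex hull {a, b, c})"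
  obtains \<sigma> \<tau> where "x = a + \<sigma> *\<^sub>R (b - a) + \<tau> *\<^sub>R (c - a)" "0 < \<sigma>" "0 < \<tau>" "\<sigma> + \<tau> < 1"
proof -
  obtain u v w where "0 < u" "0 < v" "0 < w" "u + v + w = 1" "u *\<^sub>R a + v *\<^sub>R b + w *\<^sub>R c = x"
    using assms(2) unfolding interior_convex_hull_3_minimal[OF assms(1), simplified] by auto
  moreover have "u *\<^sub>R a = a - v *\<^sub>R a - w *\<^sub>R a"
  proof -
    have "u = 1 - v - w" using \<open>u + v + w = 1\<close> by simp
    then show ?thesis by (simp add: scaleR_diff_left)
  qed
  ultimately show ?thesis by (intro that[of v w]) (auto simp: algebra_simps)
qed

lemma triangle_edge_if_not_interior:
  fixes a b c :: plane
  assumes "\<not> collinear {a, b, c}" "x \<in> convex hull {a, b, c}" "x \<notin> interior (convex hull {a, b, c})"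
  shows "x \<in> closed_segment a b \<union> closed_segment b c \<union> closed_segment a c"
proof -
  obtain u v w where uvw: "0 \<le> u" "0 \<le> v" "0 \<le> w" "u + v + w = 1" "x = u *\<^sub>R a + v *\<^sub>R b + w *\<^sub>R c"
    using assms(2) unfolding convex_hull_3 by blast
  have "u = 0 \<or> v = 0 \<or> w = 0"
  proof (rule ccontr)
    assume "\<not> (u = 0 \<or> v = 0 \<or> w = 0)"
    then have "0 < u" "0 < v" "0 < w" using uvw by auto
    then have "x \<in> interior (convex hull {a, b, c})"
      unfolding interior_convex_hull_3_minimal[OF assms(1), simplified] using uvw by blast
    then show False using assms(3) by simp
  qed
  moreover have seg: "s *\<^sub>R y + t *\<^sub>R z \<in> closed_segment y z" if "0 \<le> s" "0 \<le> t" "s + t = 1" for s t and y z :: plane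
    using that unfolding closed_segment_def by (auto intro!: exI[of _ t] simp: eq_diff_eq[symmetric])
  moreover have "x \<in> closed_segment b c" if "u = 0" using seg[of v w b c] uvw that by simp
  moreover have "x \<in> closed_segment a c" if "v = 0" using seg[of u w a c] uvw that by simp
  moreover have "x \<in> closed_segment a b" if "w = 0" using seg[of u v a b] uvw that by simp
  ultimately show ?thesis by blast
qed

section \<open>Planar geometry\<close>

lemma cross_linear: "cross e (f + g) = cross e f + cross e g" "cross e (f - g) = cross e f - cross e g" "cross e (r *\<^sub>R f) = r * cross e f" "cross e e = 0"
  by (simp_all add: cross_def algebra_simps)

lemma cross_zero_if_collinear:
  assumes "collinear {a, b, x}" shows "cross (b - a) (x - a) = 0"
proof -
  have "collinear {b, a, x}" using assms by (simp add: insert_commute)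
  then have "collinear {0, b - a, x - a}" using collinear_3[of b a x] by (simp add: NO_MATCH_def)
  then have "b - a = 0 \<or> x - a = 0 \<or> (\<exists>c. x - a = c *\<^sub>R (b - a))" unfolding collinear_lemma .
  then show ?thesis
  proof (elim disjE exE)
    fix c assume "x - a = c *\<^sub>R (b - a)"
    then show ?thesis by (simp add: cross_linear)
  qed (simp_all add: cross_def)
qed

lemma closed_segment_collinear:
  assumes "x \<in> closed_segment a b" "y \<in> closed_segment a b" "z \<in> closed_segment a b"
  shows "collinear {x, y, z}"
  by (rule collinear_subset[OF collinear_closed_segment[of a b]]) (use assms in auto)

lemma not_in_opposite_edge:
  assumes "\<not> collinear {a, b, c}" shows "c \<notin> closed_segment a b"
  using closed_segment_collinear[of a a b b c] assms by auto

lemma triangle_memI: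
  fixes a b c :: plane
  assumes "0 \<le> s" "0 \<le> t" "s + t \<le> 1"
  shows "a + s *\<^sub>R (b - a) + t *\<^sub>R (c - a) \<in> convex hull {a, b, c}"
  unfolding convex_hull_3_alt using assms by blast

lemma triangle_cross:
  fixes a b c :: plane
  assumes "x \<in> convex hull {a, b, c}"
  obtains t where "0 \<le> t" "cross (b - a) (x - a) = t * cross (b - a) (c - a)"
proof -
  obtain s t where "x = a + s *\<^sub>R (b - a) + t *\<^sub>R (c - a)" "0 \<le> t"
    using assms unfolding convex_hull_3_alt by blast
  then show ?thesis by (intro that[of t]) (simp_all add: cross_linear)
qed

text \<open>From the midpoint of the common edge, a small step towards \<open>c\<close> stays in both triangles.\<close>

lemma triangles_same_side_overlap:
  fixes a b c c' :: plane
  assumes "cross (b - a) (c - a) * cross (b - a) (c' - a) > 0"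
  shows "\<exists>x \<in> convex hull {a, b, c} \<inter> convex hull {a, b, c'}. cross (b - a) (x - a) \<noteq> 0"
proof -
  let ?D = "cross (b - a) (c - a)" and ?D' = "cross (b - a) (c' - a)"
  have D: "?D \<noteq> 0" "?D' \<noteq> 0" using assms by auto
  define \<alpha> \<beta> where "\<alpha> = cross (c - a) (c' - a) / ?D'" and "\<beta> = ?D / ?D'"
  have \<beta>: "0 < \<beta>" using assms unfolding \<beta>_def by (simp add: zero_less_mult_iff zero_less_divide_iff)
  have c: "c - a = \<alpha> *\<^sub>R (b - a) + \<beta> *\<^sub>R (c' - a)" unfolding \<alpha>_def \<beta>_def by (rule cramer[OF D(2)])
  (* Small enough that the coordinates of the midpoint, 1/2 and 0, change by at most 1/2 in the second
     triangle. *)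
  define \<epsilon> where "\<epsilon> = 1 / (2 * (1 + \<bar>\<alpha>\<bar> + \<beta>))"
  have \<epsilon>: "0 < \<epsilon>" "\<epsilon> * (1 + \<bar>\<alpha>\<bar> + \<beta>) = 1/2" unfolding \<epsilon>_def using \<beta> by (auto simp: field_simps add_pos_nonneg intro!: divide_pos_pos)
  have \<epsilon>': "\<epsilon> + \<epsilon> * \<bar>\<alpha>\<bar> + \<epsilon> * \<beta> = 1/2" "0 \<le> \<epsilon> * \<beta>" "0 \<le> \<epsilon> * \<bar>\<alpha>\<bar>" "\<bar>\<epsilon> * \<alpha>\<bar> = \<epsilon> * \<bar>\<alpha>\<bar>"
    using \<epsilon> \<beta> by (simp_all add: algebra_simps abs_mult)
  define x where "x = a + (1/2 - \<epsilon>/2) *\<^sub>R (b - a) + \<epsilon> *\<^sub>R (c - a)"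
  have "x \<in> convex hull {a, b, c}"
    unfolding x_def by (rule triangle_memI) (use \<epsilon>(1) \<epsilon>' in linarith)+
  moreover have "x = a + (1/2 - \<epsilon>/2 + \<epsilon> * \<alpha>) *\<^sub>R (b - a) + (\<epsilon> * \<beta>) *\<^sub>R (c' - a)"
    unfolding x_def c by (simp add: algebra_simps)
  then have "x \<in> convex hull {a, b, c'}"
    by (simp only:) (rule triangle_memI; use \<epsilon>(1) \<epsilon>' in linarith)
  moreover have "cross (b - a) (x - a) = \<epsilon> * ?D" unfolding x_def by (simp add: cross_linear)
  then have "cross (b - a) (x - a) \<noteq> 0" using \<epsilon>(1) D by simp
  ultimately show ?thesis by blast
qed

lemma triple_eq: "{a, b} = {x, y} \<Longrightarrow> {a, b, z} = {x, y, z}"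
  by (auto simp: doubleton_eq_iff)

section \<open>Incidence\<close>

context curved_triangulation
begin

lemma arc_continuous: "j < n \<Longrightarrow> continuous_on {0..1} (\<gamma> j)"
  using regular(1) differentiable_imp_continuous_on by blast

lemma arc_in_frontier: "j < n \<Longrightarrow> t \<in> {0..1} \<Longrightarrow> \<gamma> j t \<in> frontier \<Omega>"
  unfolding boundary by blast

lemma pie_parameters:
  assumes "Pie v j s t \<in> \<T>"
  shows "j < n" "0 \<le> s" "s < t" "t \<le> 1" "\<not> collinear {v, \<gamma> j s, \<gamma> j t}"
  using proper[OF assms] by auto

lemma straight_not_collinear: "Straight a b c \<in> \<T> \<Longrightarrow> \<not> collinear {a, b, c}"
  using proper by force

lemma region_closed: "T \<in> \<T> \<Longrightarrow> closed (region \<gamma> T)"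
proof (cases T)
  case (Pie v j s t)
  assume "T \<in> \<T>"
  then have "continuous_on {s..t} (\<gamma> j)" using arc_continuous pie_parameters[of v j s t] Pie
    by (meson atLeastatMost_subset_iff continuous_on_subset)
  then show ?thesis using closed_region_pie Pie by metis
qed (metis closed_region)

lemma region_subset: "T \<in> \<T> \<Longrightarrow> region \<gamma> T \<subseteq> closure \<Omega>"
  using cover by blast

text \<open>For each cell, any of its straight edges can serve as the base opposite to the third vertex.\<close>

lemma edge_triangle:
  assumes "T \<in> \<T>" "{a, b} \<in> straight_edges \<gamma> T"
  shows "\<exists>c. vertices \<gamma> T = {a, b, c} \<and> \<not> collinear {a, b, c}"
proof (cases T)
  case (Straight x y z)
  note nc = straight_not_collinear[OF assms(1)[unfolded Straight]]
  have "{a, b} = {x, y} \<or> {a, b} = {y, z} \<or> {a, b} = {x, z}" using assms(2) Straight by simp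
  then show ?thesis
  proof (elim disjE)
    assume "{a, b} = {x, y}" then have "{a, b, z} = {x, y, z}" by (rule triple_eq)
    then show ?thesis using nc Straight by (intro exI[of _ z]) auto
  next
    assume "{a, b} = {y, z}" then have "{a, b, x} = {x, y, z}" using triple_eq[of a b y z x] by (simp add: insert_commute)
    then show ?thesis using nc Straight by (intro exI[of _ x]) auto
  next
    assume "{a, b} = {x, z}" then have "{a, b, y} = {x, y, z}" using triple_eq[of a b x z y] by (simp add: insert_commute)
    then show ?thesis using nc Straight by (intro exI[of _ y]) auto
  qed
next
  case (Pie v j s t)
  note nc = pie_parameters(5)[OF assms(1)[unfolded Pie]]
  have "{a, b} = {v, \<gamma> j s} \<or> {a, b} = {v, \<gamma> j t}" using assms(2) Pie by simp
  then show ?thesis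
  proof (elim disjE)
    assume "{a, b} = {v, \<gamma> j s}" then have "{a, b, \<gamma> j t} = {v, \<gamma> j s, \<gamma> j t}" by (rule triple_eq)
    then show ?thesis using nc Pie by (intro exI[of _ "\<gamma> j t"]) auto
  next
    assume "{a, b} = {v, \<gamma> j t}" then have "{a, b, \<gamma> j s} = {v, \<gamma> j s, \<gamma> j t}" using triple_eq[of a b v "\<gamma> j t" "\<gamma> j s"] by (simp add: insert_commute)
    then show ?thesis using nc Pie by (intro exI[of _ "\<gamma> j s"]) auto
  qed
qed

lemma edge_vertices:
  assumes "T \<in> \<T>" "{a, b} \<in> straight_edges \<gamma> T"
  shows "a \<noteq> b" "a \<in> vertices \<gamma> T" "b \<in> vertices \<gamma> T"
  using edge_triangle[OF assms] by auto

lemma vertex_on_edge: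
  assumes "T \<in> \<T>" "{a, b} \<in> straight_edges \<gamma> T" "v \<in> vertices \<gamma> T" "v \<in> closed_segment a b"
  shows "v = a \<or> v = b"
  using edge_triangle[OF assms(1,2)] assms(3,4) not_in_opposite_edge by auto

lemma vertices_in_region: assumes "T \<in> \<T>" shows "vertices \<gamma> T \<subseteq> region \<gamma> T"
proof (cases T)
  case (Straight a b c)
  then show ?thesis using hull_subset[of "{a, b, c}" convex] by simp
next
  case (Pie v j s t)
  then show ?thesis using pie_parameters[of v j s t] assms by (auto simp: pie_boundary_def)
qed

lemma common_point:
  assumes "T \<in> \<T>" "T' \<in> \<T>" "T \<noteq> T'" "x \<in> region \<gamma> T" "x \<in> region \<gamma> T'"
  shows "x \<in> vertices \<gamma> T \<inter> vertices \<gamma> T' \<or>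
    (\<exists>a b. {a, b} \<in> straight_edges \<gamma> T \<and> {a, b} \<in> straight_edges \<gamma> T' \<and> x \<in> closed_segment a b)"
proof -
  have x: "x \<in> region \<gamma> T \<inter> region \<gamma> T'" using assms(4,5) by blast
  from conforming[OF assms(1-3)] show ?thesis
  proof (elim disjE bexE exE conjE)
    fix v assume "v \<in> vertices \<gamma> T \<inter> vertices \<gamma> T'" "region \<gamma> T \<inter> region \<gamma> T' = {v}"
    then show ?thesis using x by simp
  next
    fix a b assume "{a, b} \<in> straight_edges \<gamma> T \<inter> straight_edges \<gamma> T'" "region \<gamma> T \<inter> region \<gamma> T' = closed_segment a b"
    then show ?thesis using x by blast
  qed (use x in simp)
qed

lemma vertex_in_region_is_vertex:
  assumes "T \<in> \<T>" "T' \<in> \<T>" "v \<in> vertices \<gamma> T" "v \<in> region \<gamma> T'"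
  shows "v \<in> vertices \<gamma> T'"
proof (cases "T = T'")
  case False
  have "v \<in> region \<gamma> T" using assms vertices_in_region by blast
  from common_point[OF assms(1,2) False this assms(4)] show ?thesis
    using vertex_on_edge[OF assms(1)] edge_vertices[OF assms(2)] assms(3) by blast
qed (use assms in simp)

lemma cell_cases:
  assumes "T \<in> \<T>"
  obtains (pie) v j s t where "T = Pie v j s t" "T \<in> pies \<T>"
    | (buffer) a b c where "T = Straight a b c" "T \<in> buffers \<gamma> \<T>"
    | (ordinary) a b c where "T = Straight a b c" "T \<in> ordinary \<gamma> \<T>"
proof (cases T)
  case (Straight a b c)
  then have "T \<notin> pies \<T>" by (simp add: pies_def)
  then show ?thesis using assms buffer[OF Straight] ordinary[OF Straight] by (auto simp: ordinary_def)
next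
  case (Pie v j s t)
  then show ?thesis using pie assms by (simp add: pies_def)
qed

lemma ordinary_cell: "T \<in> ordinary \<gamma> \<T> \<Longrightarrow> T \<in> \<T> \<and> T \<notin> pies \<T> \<and> T \<notin> buffers \<gamma> \<T>"
  by (auto simp: ordinary_def)

lemma pie_cell: "T \<in> pies \<T> \<Longrightarrow> T \<in> \<T> \<and> is_pie T"
  by (auto simp: pies_def)

lemma buffer_cell: "T \<in> buffers \<gamma> \<T> \<Longrightarrow> T \<in> \<T> \<and> \<not> is_pie T"
  by (auto simp: buffers_def)

lemma pie_edge_meets_frontier:
  assumes "T \<in> pies \<T>" "{a, b} \<in> straight_edges \<gamma> T" shows "a \<in> frontier \<Omega> \<or> b \<in> frontier \<Omega>"
proof -
  obtain v j s t where T: "T = Pie v j s t" "T \<in> \<T>" using pie_cell[OF assms(1)] by (cases T) auto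
  have "\<gamma> j s \<in> frontier \<Omega>" "\<gamma> j t \<in> frontier \<Omega>"
    using pie_parameters[OF T(2)[unfolded T(1)]] by (auto intro!: arc_in_frontier)
  moreover have "{a, b} = {v, \<gamma> j s} \<or> {a, b} = {v, \<gamma> j t}" using assms(2) T by simp
  ultimately show ?thesis by (metis doubleton_eq_iff)
qed

lemma pie_neighbour_is_buffer:
  assumes "T \<in> pies \<T>" "T' \<in> \<T>" "T \<noteq> T'" "e \<in> straight_edges \<gamma> T" "e \<in> straight_edges \<gamma> T'"
  shows "T' \<in> buffers \<gamma> \<T>"
proof -
  have sh: "share_edge \<gamma> T' T" unfolding share_edge_def using assms by blast
  have "T' \<notin> pies \<T>" using cond_C[of T' T] sh assms(1) by blast
  then show ?thesis unfolding buffers_def using assms sh by (auto simp: pies_def)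
qed

lemma pie_neighbour_unique:
  assumes "T \<in> pies \<T>" "T' \<in> pies \<T>" "e \<in> straight_edges \<gamma> T" "e \<in> straight_edges \<gamma> T'"
  shows "T = T'"
  using cond_C[OF assms(1,2)] assms(3,4) unfolding share_edge_def by blast

lemma vertex_in_domain:
  assumes "T \<in> \<T>" "v \<in> vertices \<gamma> T" "v \<notin> frontier \<Omega>" shows "v \<in> \<Omega>"
  using assms vertices_in_region region_subset domain(1) by (auto simp: frontier_def interior_open)

lemma straight_edge_triangle:
  assumes "Straight x y z \<in> \<T>" "{a, b} \<in> straight_edges \<gamma> (Straight x y z)"
  shows "\<exists>c. region \<gamma> (Straight x y z) = convex hull {a, b, c} \<and> cross (b - a) (c - a) \<noteq> 0"
  using edge_triangle[OF assms] cross_nonzero_if_not_collinear by auto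

text \<open>An overlap would contain both endpoints of the edge and a point off its line, but the common part of
two cells lies in a segment.\<close>

lemma straight_neighbours_opposite:
  assumes T: "T \<in> \<T>" "T' \<in> \<T>" "T \<noteq> T'" and e: "{a, b} \<in> straight_edges \<gamma> T"
    and r: "region \<gamma> T = convex hull {a, b, c}" "region \<gamma> T' = convex hull {a, b, c'}"
  shows "\<not> cross (b - a) (c - a) * cross (b - a) (c' - a) > 0"
proof
  assume "cross (b - a) (c - a) * cross (b - a) (c' - a) > 0"
  then obtain x where x: "x \<in> region \<gamma> T \<inter> region \<gamma> T'" "cross (b - a) (x - a) \<noteq> 0"
    using triangles_same_side_overlap unfolding r by blast
  have ab: "a \<in> region \<gamma> T \<inter> region \<gamma> T'" "b \<in> region \<gamma> T \<inter> region \<gamma> T'" "a \<noteq> b"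
    unfolding r using hull_subset[of "{a, b, c}" convex] hull_subset[of "{a, b, c'}" convex] edge_vertices[OF T(1) e] by auto
  from conforming[OF T] obtain v w where "a \<in> closed_segment v w" "b \<in> closed_segment v w" "x \<in> closed_segment v w"
  proof (elim disjE bexE exE conjE)
    fix v assume "region \<gamma> T \<inter> region \<gamma> T' = {v}"
    then have "a = b" using ab(1,2) by simp
    then show ?thesis using ab(3) by simp
  next
    fix v w assume "region \<gamma> T \<inter> region \<gamma> T' = closed_segment v w"
    then show ?thesis using that ab x(1) by blast
  qed (use x in simp)
  then have "collinear {a, b, x}" by (rule closed_segment_collinear)
  then show False using cross_zero_if_collinear x(2) by blast
qed

text \<open>Existence: near \<open>v2\<close> the edge runs inside \<open>\<Omega>\<close>, and points just beyond it lie in other cells; these are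
finitely many closed sets, so one of them contains points of the edge itself and therefore the edge. It is not
pie-shaped, as the endpoints are interior, and not a buffer triangle by condition (F). Uniqueness: of three
triangles with a common edge, two would be on the same side of it.\<close>

lemma ordinary_neighbour_of_buffer:
  assumes B: "Straight v1 v2 v3 \<in> buffers \<gamma> \<T>"
  shows "\<exists>!T. T \<in> ordinary \<gamma> \<T> \<and> {v2, v3} \<in> straight_edges \<gamma> T"
proof -
  let ?B = "Straight v1 v2 v3"
  have BT: "?B \<in> \<T>" using buffer_cell[OF B] by blast
  have eB: "{v2, v3} \<in> straight_edges \<gamma> ?B" by simp
  have fr: "v2 \<notin> frontier \<Omega>" "v3 \<notin> frontier \<Omega>" using buffer_vertices[OF B] by auto
  have nc: "\<not> collinear {v1, v2, v3}" by (rule straight_not_collinear[OF BT])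
  then have "\<not> collinear {v2, v3, v1}" by (simp add: insert_commute)
  then have D: "cross (v3 - v2) (v1 - v2) \<noteq> 0" by (rule cross_nonzero_if_not_collinear)
  have rB: "region \<gamma> ?B = convex hull {v2, v3, v1}" by (simp add: insert_commute)
  have "v2 \<in> \<Omega>" using vertex_in_domain[OF BT] fr by simp
  then obtain e where e: "0 < e" "ball v2 e \<subseteq> \<Omega>" using domain(1) open_contains_ball by blast
  define \<delta> where "\<delta> = min (1/2) (e / (2 * norm (v3 - v2)))"
  have n23: "norm (v3 - v2) > 0" using not_collinear_distinct[OF nc] by simp
  have \<delta>: "0 < \<delta>" "\<delta> < 1" "\<delta> * norm (v3 - v2) < e"
  proof -
    show "0 < \<delta>" "\<delta> < 1" unfolding \<delta>_def using e n23 by auto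
    have "\<delta> * norm (v3 - v2) \<le> e / (2 * norm (v3 - v2)) * norm (v3 - v2)"
      unfolding \<delta>_def using n23 by (intro mult_right_mono) auto
    then show "\<delta> * norm (v3 - v2) < e" using n23 e by simp
  qed
  define x where "x = v2 + \<delta> *\<^sub>R (v3 - v2)"
  have x\<Omega>: "x \<in> \<Omega>" using e(2) \<delta> unfolding x_def by (auto simp: dist_norm)
  have cx: "cross (v3 - v2) (x - v2) = 0" unfolding x_def by (simp add: cross_linear)
  have xne: "x \<noteq> v2" "x \<noteq> v3"
  proof -
    show "x \<noteq> v2" using \<delta> n23 by (auto simp: x_def)
    have "x - v3 = (\<delta> - 1) *\<^sub>R (v3 - v2)" by (simp add: x_def algebra_simps)
    then show "x \<noteq> v3" using \<delta> n23 by auto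
  qed
  let ?F = "\<Union>T\<in>\<T> - {?B}. region \<gamma> T"
  have xF: "x \<in> ?F"
  proof (rule ccontr)
    assume "x \<notin> ?F"
    moreover have "closed ?F" using finite_cells region_closed by (intro closed_UN) auto
    ultimately have "open (\<Omega> - ?F)" "x \<in> \<Omega> - ?F" using open_Diff[OF domain(1)] x\<Omega> by blast+
    then obtain r where r: "0 < r" "ball x r \<subseteq> \<Omega> - ?F" by (rule openE)
    (* Just beyond the edge, seen from v1. *)
    define y where "y = x - (r / (2 * norm (v1 - v2))) *\<^sub>R (v1 - v2)"
    have n12: "norm (v1 - v2) > 0" using not_collinear_distinct[OF nc] by simp
    have "y \<in> ball x r" using r n12 by (simp add: y_def dist_norm)
    then have y: "y \<in> \<Omega>" "y \<notin> ?F" using r by auto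
    then have "y \<in> closure \<Omega>" using closure_subset by blast
    then have "y \<in> region \<gamma> ?B" using y(2) unfolding cover[symmetric] by blast
    then obtain t where t: "0 \<le> t" "cross (v3 - v2) (y - v2) = t * cross (v3 - v2) (v1 - v2)"
      unfolding rB by (rule triangle_cross)
    have "y - v2 = (x - v2) - (r / (2 * norm (v1 - v2))) *\<^sub>R (v1 - v2)" by (simp add: y_def)
    then have "cross (v3 - v2) (y - v2) = - (r / (2 * norm (v1 - v2))) * cross (v3 - v2) (v1 - v2)"
      by (simp only: cross_linear(2)[of _ "x - v2"] cross_linear(3) cx)
    then have "t = - (r / (2 * norm (v1 - v2)))" using t(2) D by (metis mult_right_cancel)
    then show False using t(1) r(1) n12 by (simp add: divide_less_0_iff field_simps)
  qed
  then obtain T where T: "T \<in> \<T>" "T \<noteq> ?B" "x \<in> region \<gamma> T" by blast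
  have xB: "x \<in> region \<gamma> ?B"
    unfolding rB x_def using triangle_memI[of \<delta> 0 v2 v3 v1] \<delta> by simp
  have xe: "x \<notin> closed_segment v1 v2" "x \<notin> closed_segment v1 v3" "x \<noteq> v1"
  proof -
    show "x \<notin> closed_segment v1 v2"
    proof
      assume "x \<in> closed_segment v1 v2"
      then obtain r where r: "x - v2 = r *\<^sub>R (v1 - v2)" by (auto simp: closed_segment_def algebra_simps intro: that[of "1 - _"])
      then have "r = 0" using cx D by (simp add: cross_linear)
      then show False using r xne by simp
    qed
    show "x \<notin> closed_segment v1 v3"
    proof
      assume "x \<in> closed_segment v1 v3"
      then obtain r where r: "x - v3 = r *\<^sub>R (v1 - v3)" by (auto simp: closed_segment_def algebra_simps intro: that[of "1 - _"])
      have "x - v2 = (v3 - v2) + r *\<^sub>R ((v1 - v2) - (v3 - v2))" using r by (simp add: algebra_simps)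
      moreover have "cross e (e + r *\<^sub>R (f - e)) = r * cross e f" for e f by (simp add: cross_linear algebra_simps)
      ultimately have "r = 0" using cx D by (metis mult_eq_0_iff)
      then show False using r xne by simp
    qed
    then show "x \<noteq> v1" by auto
  qed
  have eT: "{v2, v3} \<in> straight_edges \<gamma> T"
  proof -
    have "x \<notin> vertices \<gamma> ?B" using xe xne by simp
    then obtain a b where ab: "{a, b} \<in> straight_edges \<gamma> ?B" "{a, b} \<in> straight_edges \<gamma> T" "x \<in> closed_segment a b"
      using common_point[OF BT T(1) T(2)[symmetric] xB T(3)] by blast
    have seg: "{a, b} = {c, d} \<Longrightarrow> x \<in> closed_segment c d" for c d
      using ab(3) by (auto simp: doubleton_eq_iff closed_segment_commute)
    show ?thesis using ab(1,2) seg xe by (auto; metis)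
  qed
  have "T \<notin> pies \<T>" using pie_edge_meets_frontier[OF _ eT] fr by blast
  moreover have "T \<notin> buffers \<gamma> \<T>" using cond_F[OF B, of T] T(2) eB eT unfolding share_edge_def by blast
  ultimately have "T \<in> ordinary \<gamma> \<T>" using T(1) by (simp add: ordinary_def)
  moreover have "T' = T''" if oe: "T' \<in> ordinary \<gamma> \<T>" "{v2, v3} \<in> straight_edges \<gamma> T'" "T'' \<in> ordinary \<gamma> \<T>" "{v2, v3} \<in> straight_edges \<gamma> T''" for T' T''
  proof (rule ccontr)
    assume ne: "T' \<noteq> T''"
    have c: "\<exists>c. region \<gamma> X = convex hull {v2, v3, c} \<and> cross (v3 - v2) (c - v2) \<noteq> 0 \<and> X \<in> \<T> \<and> X \<noteq> ?B"
      if "X \<in> ordinary \<gamma> \<T>" "{v2, v3} \<in> straight_edges \<gamma> X" for X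
    proof -
      have X: "X \<in> \<T>" "\<not> is_pie X" "X \<noteq> ?B" using ordinary_cell[OF that(1)] B by (auto simp: pies_def)
      then obtain a b c where "X = Straight a b c" by (cases X) auto
      then show ?thesis using straight_edge_triangle X that(2) by blast
    qed
    obtain c' where c': "region \<gamma> T' = convex hull {v2, v3, c'}" "cross (v3 - v2) (c' - v2) \<noteq> 0" "T' \<in> \<T>" "T' \<noteq> ?B"
      using c[OF oe(1,2)] by blast
    obtain c'' where c'': "region \<gamma> T'' = convex hull {v2, v3, c''}" "cross (v3 - v2) (c'' - v2) \<noteq> 0" "T'' \<in> \<T>" "T'' \<noteq> ?B"
      using c[OF oe(3,4)] by blast
    have "\<not> cross (v3 - v2) (c' - v2) * cross (v3 - v2) (c'' - v2) > 0"
      by (rule straight_neighbours_opposite[OF c'(3) c''(3) ne oe(2) c'(1) c''(1)])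
    moreover have "\<not> cross (v3 - v2) (v1 - v2) * cross (v3 - v2) (c' - v2) > 0"
      by (rule straight_neighbours_opposite[OF BT c'(3) c'(4)[symmetric] eB rB c'(1)])
    moreover have "\<not> cross (v3 - v2) (v1 - v2) * cross (v3 - v2) (c'' - v2) > 0"
      by (rule straight_neighbours_opposite[OF BT c''(3) c''(4)[symmetric] eB rB c''(1)])
    ultimately show False using D c'(2) c''(2) unfolding zero_less_mult_iff by linarith
  qed
  ultimately show ?thesis using eT by blast
qed

end

section \<open>The pieces of the interpolant\<close>

locale spline_interpolation = auxiliary_domains n \<Omega> \<gamma> q \<T> A
  for n :: nat and \<Omega> :: "plane set" and \<gamma> :: "nat \<Rightarrow> real \<Rightarrow> plane" and q :: "nat \<Rightarrow> plane \<Rightarrow> real"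
    and \<T> :: "cell set" and A :: "nat \<Rightarrow> plane set" +
  fixes \<nu> :: "plane set \<Rightarrow> plane" and u :: "plane \<Rightarrow> real"
  assumes normals: "edge_normals \<gamma> \<T> \<nu>"
    and u_C3: "\<exists>U. Ck_version 3 \<Omega> u U"
    and quotient_C2: "\<And>j. j < n \<Longrightarrow> \<exists>w. Ck_version 2 (A j) (\<lambda>x. u x / q j x) w"
begin

abbreviation U :: "plane \<Rightarrow> real" where "U \<equiv> Ck_rep 3 \<Omega> u"
abbreviation W :: "nat \<Rightarrow> plane \<Rightarrow> real" where "W j \<equiv> Ck_rep 2 (A j) (\<lambda>x. u x / q j x)"
abbreviation I :: "cell \<Rightarrow> plane \<Rightarrow> real" where "I \<equiv> I_cell \<Omega> \<gamma> q A \<T> \<nu> u"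
abbreviation U_jet :: "nat \<Rightarrow> nat \<Rightarrow> plane \<Rightarrow> real" where "U_jet a b v \<equiv> eval_partial a b v \<Omega> U"

lemma U_version: "Ck_version 3 \<Omega> u U"
  unfolding Ck_rep_def by (rule someI_ex[OF u_C3])

lemma W_version: "j < n \<Longrightarrow> Ck_version 2 (A j) (\<lambda>x. u x / q j x) (W j)"
  unfolding Ck_rep_def by (rule someI_ex[OF quotient_C2])

lemma edge_normal:
  "T \<in> \<T> \<Longrightarrow> {a, b} \<in> straight_edges \<gamma> T \<Longrightarrow> unit_normal \<nu> a b"
  using normals unfolding edge_normals_def unit_normal_def by blast

lemma aux_positive: assumes "j < n" "x \<in> A j" shows "q j x > 0"
proof (rule aux_c[OF assms(1)])
  have "x \<in> \<Omega>" using aux_domain assms by blast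
  then have "x \<notin> frontier \<Omega>" using domain(1) by (simp add: frontier_def interior_open)
  then show "x \<in> closure (A j) - closed_arc \<gamma> j" using arc_in_frontier assms closure_subset by blast
qed

text \<open>In \<open>A j\<close> the polynomial \<open>q\<^sub>j\<close> is positive, so the two sides agree almost everywhere with \<open>u\<close>, and both
are continuous.\<close>

lemma U_factorization: assumes j: "j < n" and x: "x \<in> A j" shows "U x = W j x * q j x"
proof (rule continuous_AE_eq_imp_eq[OF _ _ _ _ x])
  have A: "open (A j)" "A j \<subseteq> \<Omega>" using aux_domain[OF j] by auto
  show "open (A j)" by fact
  have "U differentiable_on \<Omega>" using U_version unfolding Ck_version_def Ck_closure_def by (simp add: numeral_3_eq_3)
  then show "continuous_on (A j) U"
    using A(2) continuous_on_subset differentiable_imp_continuous_on by blast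
  have "W j differentiable_on A j" using W_version[OF j] unfolding Ck_version_def Ck_closure_def by (simp add: numeral_2_eq_2)
  moreover have "continuous_on (A j) (q j)"
    using q_quadratic[OF j] Poly_continuous continuous_at_imp_continuous_on by blast
  ultimately show "continuous_on (A j) (\<lambda>x. W j x * q j x)"
    by (intro continuous_on_mult[OF differentiable_imp_continuous_on])
  have leb: "A j \<inter> space lebesgue \<in> sets lebesgue" "\<Omega> \<inter> space lebesgue \<in> sets lebesgue"
    using sets_completionI_sets[of _ lborel] borel_open[OF A(1)] borel_open[OF domain(1)] by simp_all
  have "AE x in lebesgue_on \<Omega>. U x = u x" "AE x in lebesgue_on (A j). W j x = u x / q j x"
    using U_version W_version[OF j] unfolding Ck_version_def by blast+
  then have "AE x in lebesgue. x \<in> \<Omega> \<longrightarrow> U x = u x" "AE x in lebesgue. x \<in> A j \<longrightarrow> W j x = u x / q j x"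
    by (simp_all only: AE_restrict_space_iff[OF leb(1)] AE_restrict_space_iff[OF leb(2)])
  then have "AE x in lebesgue. x \<in> A j \<longrightarrow> U x = W j x * q j x"
  proof eventually_elim
    case (elim x)
    show ?case
    proof
      assume "x \<in> A j"
      then have "U x = u x" "W j x = u x / q j x" "q j x > 0" using elim A(2) aux_positive[OF j] by blast+
      then show "U x = W j x * q j x" by simp
    qed
  qed
  then show "AE x in lebesgue_on (A j). U x = W j x * q j x"
    by (simp only: AE_restrict_space_iff[OF leb(1)])
qed

lemma U_tendsto:
  assumes "v \<in> closure \<Omega>" "a + b \<le> 2" shows "(partial a b U \<longlongrightarrow> U_jet a b v) (at v within \<Omega>)"
  using U_version assms by (intro Ck_closure_tendsto[OF domain(1), of v 3]) (auto simp: Ck_version_def)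

lemma q_zero_closed_arc: assumes j: "j < n" and t: "t \<in> {0..1}" shows "q j (\<gamma> j t) = 0"
proof -
  have "continuous_on UNIV (q j)"
    using q_quadratic[OF j] Poly_continuous continuous_at_imp_continuous_on by blast
  then have "continuous_on {0..1} (\<lambda>t. q j (\<gamma> j t))"
    using continuous_on_compose2 arc_continuous[OF j] by blast
  then show ?thesis
    using continuous_constant_on_closure[of "{0<..<1::real}" "\<lambda>t. q j (\<gamma> j t)" 0 t] q_zero[OF j] t by auto
qed

text \<open>The center of the inscribed disk is interior to the straightened triangle, as unisolvence
requires.\<close>

lemma pie_piece:
  assumes T: "Pie v j s t \<in> \<T>"
  shows "\<exists>p\<in>Poly 4. I (Pie v j s t) = (\<lambda>x. p x * q j x) \<and> (\<forall>\<eta>\<in>N_pie \<gamma> v j s t. \<eta> UNIV p = \<eta> (A j) (W j))"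
proof -
  let ?R = "region \<gamma> (Pie v j s t) \<inter> straightened \<gamma> (Pie v j s t)"
  let ?c = "inscribed_center ?R"
  have hull: "straightened \<gamma> (Pie v j s t) = convex hull {v, \<gamma> j s, \<gamma> j t}" by (simp add: straightened_def)
  note nc = pie_parameters(5)[OF T]
  have "compact (convex hull {v, \<gamma> j s, \<gamma> j t})" by (rule finite_imp_compact_convex_hull) simp
  then have "compact ?R" unfolding hull by (rule closed_Int_compact[OF region_closed[OF T]])
  moreover have "interior ?R \<noteq> {}" by (rule pie_disk) (simp add: pies_def T)
  ultimately have "?c \<in> interior ?R" by (rule inscribed_center_interior)
  then have "?c \<in> interior (convex hull {v, \<gamma> j s, \<gamma> j t})" unfolding hull using interior_mono by blast
  then obtain \<sigma> \<tau> where c: "?c = v + \<sigma> *\<^sub>R (\<gamma> j s - v) + \<tau> *\<^sub>R (\<gamma> j t - v)" "0 < \<sigma>" "0 < \<tau>" "\<sigma> + \<tau> < 1"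
    by (rule interior_triangle_coordinates[OF nc])
  define P where "P = (\<lambda>p. p \<in> Poly 4 \<and> (\<forall>\<eta>\<in>N_pie \<gamma> v j s t. \<eta> UNIV p = \<eta> (A j) (W j)))"
  have "\<exists>!p. P p" unfolding N_pie_def P_def by (rule pie_interpolation[OF nc c])
  then have p: "P (The P)" by (rule theI')
  have "I (Pie v j s t) = (\<lambda>x. The P x * q j x)" by (simp add: I_pie_def P_def)
  then show ?thesis using p unfolding P_def by blast
qed

lemma pie_Poly: assumes "Pie v j s t \<in> \<T>" shows "I (Pie v j s t) \<in> Poly 6"
proof -
  obtain p where p: "p \<in> Poly 4" "I (Pie v j s t) = (\<lambda>x. p x * q j x)" using pie_piece[OF assms] by blast
  have "q j \<in> Poly 2" using q_quadratic pie_parameters(1)[OF assms] by blast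
  from Poly_mult[OF p(1) this] show ?thesis unfolding p(2) by simp
qed

text \<open>The apex carries the second derivatives of \<open>u / q\<^sub>j\<close>; at the two vertices on the arc only first
derivatives are available, but \<open>q\<^sub>j\<close> is zero. The limits are taken within \<open>A j\<close> and agree with those
within \<open>\<Omega>\<close>, where \<open>u\<close> is three times continuously differentiable up to the boundary.\<close>

lemma pie_jet:
  assumes T: "Pie v j s t \<in> \<T>" and z: "z \<in> vertices \<gamma> (Pie v j s t)" and ab: "a + b \<le> 2"
  shows "partial a b (I (Pie v j s t)) z = U_jet a b z"
proof -
  obtain p where p: "p \<in> Poly 4" "I (Pie v j s t) = (\<lambda>x. p x * q j x)"
    "\<And>\<eta>. \<eta> \<in> N_pie \<gamma> v j s t \<Longrightarrow> \<eta> UNIV p = \<eta> (A j) (W j)" using pie_piece[OF T] by blast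
  note par = pie_parameters[OF T]
  have q: "q j \<in> Poly 2" using q_quadratic par(1) by blast
  have A: "open (A j)" "A j \<subseteq> \<Omega>" using aux_domain[OF par(1)] by auto
  have zA: "z \<in> closure (A j)" using aux_e[OF T] vertices_in_region[OF T] z by blast
  then have "z \<in> closure \<Omega>" using closure_mono[OF A(2)] by blast
  then have lim: "(partial a b U \<longlongrightarrow> U_jet a b z) (at z within A j)"
    using tendsto_within_subset[OF U_tendsto[OF _ ab] A(2)] by blast
  show ?thesis unfolding p(2)
  proof (rule jet_of_product[OF A(1) zA _ q p(1) U_factorization[OF par(1)] lim ab])
    show "Ck_closure 2 (A j) (W j)" using W_version[OF par(1)] unfolding Ck_version_def by blast
    fix i k :: nat assume ik: "i + k \<le> 2" "i + k \<le> 1 \<or> q j z \<noteq> 0"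
    have "eval_partial i k z \<in> N_pie \<gamma> v j s t"
    proof (cases "z = v")
      case True
      then show ?thesis using ik unfolding N_pie_def jet_def by blast
    next
      case False
      then have z': "z = \<gamma> j s \<or> z = \<gamma> j t" using z by simp
      then have "q j z = 0" using q_zero_closed_arc[OF par(1)] par by auto
      then show ?thesis using ik z' unfolding N_pie_def jet_def by blast
    qed
    from p(3)[OF this] show "partial i k p z = eval_partial i k z (A j) (W j)" by (simp add: eval_partial_Poly[OF p(1)])
  qed
qed

lemma ordinary_eq: "Straight v1 v2 v3 \<notin> buffers \<gamma> \<T> \<Longrightarrow> I (Straight v1 v2 v3) = I_ordinary \<Omega> \<nu> u v1 v2 v3"
  by simp

lemma ordinary_piece:
  assumes T: "Straight v1 v2 v3 \<in> ordinary \<gamma> \<T>"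
  shows "I (Straight v1 v2 v3) \<in> Poly 5"
    and "\<And>\<eta>. \<eta> \<in> N_ordinary \<nu> v1 v2 v3 \<Longrightarrow> \<eta> UNIV (I (Straight v1 v2 v3)) = \<eta> \<Omega> U"
proof -
  have T': "Straight v1 v2 v3 \<in> \<T>" "Straight v1 v2 v3 \<notin> buffers \<gamma> \<T>" using ordinary_cell[OF T] by auto
  have "unit_normal \<nu> v1 v2" "unit_normal \<nu> v2 v3" "unit_normal \<nu> v1 v3" by (rule edge_normal[OF T'(1)]; simp)+
  from theI'[OF ordinary_interpolation[OF straight_not_collinear[OF T'(1)] this, of "\<lambda>\<eta>. \<eta> \<Omega> U"]]
  have "I_ordinary \<Omega> \<nu> u v1 v2 v3 \<in> Poly 5 \<and>
    (\<forall>\<eta>\<in>N_ordinary \<nu> v1 v2 v3. \<eta> UNIV (I_ordinary \<Omega> \<nu> u v1 v2 v3) = \<eta> \<Omega> U)"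
    unfolding I_ordinary_def .
  then show "I (Straight v1 v2 v3) \<in> Poly 5"
    "\<And>\<eta>. \<eta> \<in> N_ordinary \<nu> v1 v2 v3 \<Longrightarrow> \<eta> UNIV (I (Straight v1 v2 v3)) = \<eta> \<Omega> U"
    unfolding ordinary_eq[OF T'(2)] by blast+
qed

lemma ordinary_straight:
  assumes "T \<in> ordinary \<gamma> \<T>" obtains v1 v2 v3 where "T = Straight v1 v2 v3"
  using ordinary_cell[OF assms] by (cases T) (auto simp: pies_def)

lemma ordinary_Poly: "T \<in> ordinary \<gamma> \<T> \<Longrightarrow> I T \<in> Poly 5"
  using ordinary_piece(1) ordinary_straight by metis

lemma ordinary_jet:
  assumes T: "T \<in> ordinary \<gamma> \<T>" and z: "z \<in> vertices \<gamma> T" and ab: "a + b \<le> 2"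
  shows "partial a b (I T) z = U_jet a b z"
proof -
  obtain v1 v2 v3 where S: "T = Straight v1 v2 v3" by (rule ordinary_straight[OF T])
  have "eval_partial a b z \<in> N_ordinary \<nu> v1 v2 v3" using z ab unfolding S N_ordinary_def jet_def by auto
  from ordinary_piece(2)[OF T[unfolded S] this] show ?thesis
    using eval_partial_Poly[OF ordinary_piece(1)[OF T[unfolded S]]] S by simp
qed

lemma ordinary_edge:
  assumes T: "T \<in> ordinary \<gamma> \<T>" and e: "{a, b} \<in> straight_edges \<gamma> T"
  shows "dir_deriv (\<nu> {a, b}) (I T) (edge_point 2 a b) = eval_dir (\<nu> {a, b}) (edge_point 2 a b) \<Omega> U"
proof -
  obtain v1 v2 v3 where S: "T = Straight v1 v2 v3" by (rule ordinary_straight[OF T])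
  have "eval_dir (\<nu> {a, b}) (edge_point 2 a b) \<in> N_ordinary \<nu> v1 v2 v3"
    using e edge_point_swap(1) unfolding S N_ordinary_def by (auto simp: doubleton_eq_iff insert_commute)
  from ordinary_piece(2)[OF T[unfolded S] this] show ?thesis
    using eval_dir_Poly[OF ordinary_piece(1)[OF T[unfolded S]]] S by simp
qed

lemma buffer_piece:
  assumes B: "Straight v1 v2 v3 \<in> buffers \<gamma> \<T>"
  obtains T1 T2 T3 where "T1 \<in> ordinary \<gamma> \<T>" "T2 \<in> pies \<T>" "T3 \<in> pies \<T>"
    "{v2, v3} \<in> straight_edges \<gamma> T1" "{v1, v2} \<in> straight_edges \<gamma> T2" "{v1, v3} \<in> straight_edges \<gamma> T3"
    "I (Straight v1 v2 v3) \<in> Poly 6"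
    "\<And>\<eta>. \<eta> \<in> N_edge \<nu> v2 v3 \<union> jet 2 v2 \<union> jet 2 v3 \<Longrightarrow> \<eta> UNIV (I (Straight v1 v2 v3)) = \<eta> UNIV (I T1)"
    "\<And>\<eta>. \<eta> \<in> N_edge \<nu> v1 v2 \<union> jet 2 v1 \<Longrightarrow> \<eta> UNIV (I (Straight v1 v2 v3)) = \<eta> UNIV (I T2)"
    "\<And>\<eta>. \<eta> \<in> N_edge \<nu> v1 v3 \<Longrightarrow> \<eta> UNIV (I (Straight v1 v2 v3)) = \<eta> UNIV (I T3)"
proof -
  have BT: "Straight v1 v2 v3 \<in> \<T>" using buffer_cell[OF B] by blast
  define T1 T2 T3 where T: "T1 = (THE T. T \<in> ordinary \<gamma> \<T> \<and> {v2, v3} \<in> straight_edges \<gamma> T)"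
     "T2 = (THE T. T \<in> pies \<T> \<and> {v1, v2} \<in> straight_edges \<gamma> T)"
     "T3 = (THE T. T \<in> pies \<T> \<and> {v1, v3} \<in> straight_edges \<gamma> T)"
  have T1: "T1 \<in> ordinary \<gamma> \<T> \<and> {v2, v3} \<in> straight_edges \<gamma> T1"
    unfolding T by (rule theI'[OF ordinary_neighbour_of_buffer[OF B]])
  have "\<exists>!T. T \<in> pies \<T> \<and> {v1, v2} \<in> straight_edges \<gamma> T" "\<exists>!T. T \<in> pies \<T> \<and> {v1, v3} \<in> straight_edges \<gamma> T"
    using buffer_edges[OF B] pie_neighbour_unique by blast+
  from theI'[OF this(1)] theI'[OF this(2)]
  have T2: "T2 \<in> pies \<T> \<and> {v1, v2} \<in> straight_edges \<gamma> T2" and T3: "T3 \<in> pies \<T> \<and> {v1, v3} \<in> straight_edges \<gamma> T3"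
    unfolding T by blast+
  have o: "I_outer \<Omega> \<gamma> q A \<nu> u T1 = I T1" "I_outer \<Omega> \<gamma> q A \<nu> u T2 = I T2" "I_outer \<Omega> \<gamma> q A \<nu> u T3 = I T3"
    using T1 T2 T3 ordinary_cell[of T1] pie_cell[of T2] pie_cell[of T3] by (cases T1; cases T2; cases T3; auto simp: pies_def)+
  have "unit_normal \<nu> v1 v2" "unit_normal \<nu> v2 v3" "unit_normal \<nu> v1 v3" by (rule edge_normal[OF BT]; simp)+
  note ex1 = buffer_interpolation[OF straight_not_collinear[OF BT] this]
  have eq: "I (Straight v1 v2 v3) = (THE p. p \<in> Poly 6 \<and> p ((1 / 3) *\<^sub>R (v1 + v2 + v3)) = eval_partial 0 0 ((1 / 3) *\<^sub>R (v1 + v2 + v3)) \<Omega> U \<and>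
           (\<forall>\<eta> \<in> N_edge \<nu> v2 v3 \<union> jet 2 v2 \<union> jet 2 v3. \<eta> UNIV p = \<eta> UNIV (I T1)) \<and>
           (\<forall>\<eta> \<in> N_edge \<nu> v1 v2 \<union> jet 2 v1. \<eta> UNIV p = \<eta> UNIV (I T2)) \<and>
           (\<forall>\<eta> \<in> N_edge \<nu> v1 v3. \<eta> UNIV p = \<eta> UNIV (I T3)))"
    using B by (simp only: I_cell.simps I_buffer_def Let_def T[symmetric] o if_True)
  have "I (Straight v1 v2 v3) \<in> Poly 6 \<and> I (Straight v1 v2 v3) ((1 / 3) *\<^sub>R (v1 + v2 + v3)) = eval_partial 0 0 ((1 / 3) *\<^sub>R (v1 + v2 + v3)) \<Omega> U \<and>
           (\<forall>\<eta> \<in> N_edge \<nu> v2 v3 \<union> jet 2 v2 \<union> jet 2 v3. \<eta> UNIV (I (Straight v1 v2 v3)) = \<eta> UNIV (I T1)) \<and>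
           (\<forall>\<eta> \<in> N_edge \<nu> v1 v2 \<union> jet 2 v1. \<eta> UNIV (I (Straight v1 v2 v3)) = \<eta> UNIV (I T2)) \<and>
           (\<forall>\<eta> \<in> N_edge \<nu> v1 v3. \<eta> UNIV (I (Straight v1 v2 v3)) = \<eta> UNIV (I T3))"
    unfolding eq by (rule theI'[OF ex1])
  then show ?thesis using T1 T2 T3 by (intro that[of T1 T2 T3]) blast+
qed

lemma buffer_Poly: "T \<in> buffers \<gamma> \<T> \<Longrightarrow> I T \<in> Poly 6"
  by (cases T) (use buffer_piece buffer_cell in blast, use buffer_cell in force)

lemma piece_Poly: assumes "T \<in> \<T>" shows "I T \<in> Poly 6"
  using assms
proof (cases rule: cell_cases)
  case (pie v j s t) then show ?thesis using pie_Poly assms by simp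
next
  case buffer then show ?thesis using buffer_Poly by blast
next
  case ordinary
  then have "I T \<in> Poly 5" using ordinary_Poly by blast
  then show ?thesis by (rule Poly_mono) simp
qed

lemma buffer_jet:
  assumes B: "Straight v1 v2 v3 \<in> buffers \<gamma> \<T>" and z: "z \<in> {v1, v2, v3}" and ab: "a + b \<le> 2"
  shows "partial a b (I (Straight v1 v2 v3)) z = U_jet a b z"
proof -
  obtain T1 T2 T3 where T: "T1 \<in> ordinary \<gamma> \<T>" "T2 \<in> pies \<T>" "T3 \<in> pies \<T>"
    "{v2, v3} \<in> straight_edges \<gamma> T1" "{v1, v2} \<in> straight_edges \<gamma> T2" 
    "I (Straight v1 v2 v3) \<in> Poly 6"
    "\<And>\<eta>. \<eta> \<in> N_edge \<nu> v2 v3 \<union> jet 2 v2 \<union> jet 2 v3 \<Longrightarrow> \<eta> UNIV (I (Straight v1 v2 v3)) = \<eta> UNIV (I T1)"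
    "\<And>\<eta>. \<eta> \<in> N_edge \<nu> v1 v2 \<union> jet 2 v1 \<Longrightarrow> \<eta> UNIV (I (Straight v1 v2 v3)) = \<eta> UNIV (I T2)"
    by (rule buffer_piece[OF B]) blast
  have T1: "T1 \<in> \<T>" and T2: "T2 \<in> \<T>" "is_pie T2" using ordinary_cell[OF T(1)] pie_cell[OF T(2)] by auto
  have e: "eval_partial a b z \<in> jet 2 z" using ab unfolding jet_def by blast
  have jets: "partial a b (I (Straight v1 v2 v3)) z = partial a b (I T') z"
    if "eval_partial a b z UNIV (I (Straight v1 v2 v3)) = eval_partial a b z UNIV (I T')" "T' \<in> \<T>" for T'
    using that by (simp only: eval_partial_Poly[OF T(6)] eval_partial_Poly[OF piece_Poly[OF that(2)]])
  show ?thesis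
  proof (cases "z = v1")
    case True
    have "z \<in> vertices \<gamma> T2" using edge_vertices[OF T2(1) T(5)] True by simp
    then have "partial a b (I T2) z = U_jet a b z" using T2 pie_jet ab by (cases T2) auto
    then show ?thesis using jets[of T2] T(8) e True T2 by simp
  next
    case False
    then have "z = v2 \<or> z = v3" using z by simp
    then have "z \<in> vertices \<gamma> T1" "eval_partial a b z UNIV (I (Straight v1 v2 v3)) = eval_partial a b z UNIV (I T1)"
      using edge_vertices[OF T1 T(4)] T(7) e by auto
    then show ?thesis using jets[of T1] ordinary_jet[OF T(1) _ ab] T1 by simp
  qed
qed

lemma piece_jet:
  assumes "T \<in> \<T>" "z \<in> vertices \<gamma> T" "a + b \<le> 2"
  shows "partial a b (I T) z = U_jet a b z"
  using assms(1)
proof (cases rule: cell_cases)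
  case (pie v j s t) then show ?thesis using pie_jet assms by metis
next
  case (buffer v1 v2 v3) then show ?thesis using buffer_jet[of v1 v2 v3 z a b] assms by simp
next
  case ordinary then show ?thesis using ordinary_jet assms by blast
qed

section \<open>Smoothness across edges\<close>

text \<open>The neighbour across the edge is the very cell from which the buffer triangle takes its data there. In
particular an ordinary triangle cannot be adjacent along one of the two edges at the boundary vertex, as
these already belong to pie-shaped triangles.\<close>

lemma buffer_edge_data:
  assumes B: "B \<in> buffers \<gamma> \<T>" and T: "T \<in> \<T>" "T \<noteq> B" and e: "{a, b} \<in> straight_edges \<gamma> B" "{a, b} \<in> straight_edges \<gamma> T"
    and \<eta>: "\<eta> \<in> N_edge \<nu> a b"
  shows "\<eta> UNIV (I B) = \<eta> UNIV (I T)"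
proof -
  obtain v1 v2 v3 where S: "B = Straight v1 v2 v3" using buffer_cell[OF B] by (cases B) auto
  have BT: "B \<in> \<T>" using buffer_cell[OF B] by blast
  have fr: "v2 \<notin> frontier \<Omega>" "v3 \<notin> frontier \<Omega>" using buffer_vertices B S by blast+
  obtain T1 T2 T3 where N: "T1 \<in> ordinary \<gamma> \<T>" "T2 \<in> pies \<T>" "T3 \<in> pies \<T>"
    "{v2, v3} \<in> straight_edges \<gamma> T1" "{v1, v2} \<in> straight_edges \<gamma> T2" "{v1, v3} \<in> straight_edges \<gamma> T3"
    and data: "\<And>\<eta>. \<eta> \<in> N_edge \<nu> v2 v3 \<union> jet 2 v2 \<union> jet 2 v3 \<Longrightarrow> \<eta> UNIV (I (Straight v1 v2 v3)) = \<eta> UNIV (I T1)"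
    "\<And>\<eta>. \<eta> \<in> N_edge \<nu> v1 v2 \<union> jet 2 v1 \<Longrightarrow> \<eta> UNIV (I (Straight v1 v2 v3)) = \<eta> UNIV (I T2)"
    "\<And>\<eta>. \<eta> \<in> N_edge \<nu> v1 v3 \<Longrightarrow> \<eta> UNIV (I (Straight v1 v2 v3)) = \<eta> UNIV (I T3)"
    by (rule buffer_piece[OF B[unfolded S]]) blast
  have nb: "T \<notin> buffers \<gamma> \<T>" using cond_F[OF B, of T] T(2) e unfolding share_edge_def by blast
  have swap: "\<eta> \<in> N_edge \<nu> c d" if "{a, b} = {c, d}" for c d
    using that \<eta> N_edge_swap[of \<nu> a b] by (auto simp: doubleton_eq_iff)
  have pie: "T = P" if "P \<in> pies \<T>" "{a, b} \<in> straight_edges \<gamma> P" for P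
    using pie_neighbour_is_buffer[OF that(1) T(1) _ that(2) e(2)] nb by blast
  have "{a, b} = {v1, v2} \<or> {a, b} = {v2, v3} \<or> {a, b} = {v1, v3}" using e(1) S by simp
  then show ?thesis
  proof (elim disjE)
    assume ab: "{a, b} = {v1, v2}"
    then show ?thesis using pie[OF N(2)] N(5) data(2) swap[OF ab] S by simp
  next
    assume ab: "{a, b} = {v1, v3}"
    then show ?thesis using pie[OF N(3)] N(6) data(3) swap[OF ab] S by simp
  next
    assume ab: "{a, b} = {v2, v3}"
    then have eT: "{v2, v3} \<in> straight_edges \<gamma> T" using e(2) by simp
    then have "T \<notin> pies \<T>" using pie_edge_meets_frontier fr by blast
    then have "T \<in> ordinary \<gamma> \<T>" using T(1) nb by (simp add: ordinary_def)
    then have "T = T1" using ordinary_neighbour_of_buffer[OF B[unfolded S]] eT N(1,4) by blast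
    then show ?thesis using data(1) swap[OF ab] S by simp
  qed
qed

lemma zero_2jet_vertex:
  assumes "T \<in> \<T>" "T' \<in> \<T>" "v \<in> vertices \<gamma> T" "v \<in> vertices \<gamma> T'"
  shows "zero_2jet (\<lambda>x. I T x - I T' x) v"
  unfolding zero_2jet_def using assms
  by (simp add: partial_Poly_diff[OF piece_Poly piece_Poly] piece_jet)

lemma ordinary_or_buffer_edge:
  assumes "T \<in> \<T>" "T' \<in> \<T>" "T \<noteq> T'" "e \<in> straight_edges \<gamma> T" "e \<in> straight_edges \<gamma> T'"
  shows "T \<in> buffers \<gamma> \<T> \<or> T' \<in> buffers \<gamma> \<T> \<or> T \<in> ordinary \<gamma> \<T> \<and> T' \<in> ordinary \<gamma> \<T>"
  using pie_neighbour_is_buffer[of T T' e] pie_neighbour_is_buffer[of T' T e] assms unfolding ordinary_def by blast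

text \<open>A difference that involves a buffer triangle has degree 6 and the data of \<open>N_edge\<close> in common; otherwise both
cells are ordinary and share the normal derivative at the midpoint.\<close>

lemma edge_C1:
  assumes T: "T \<in> \<T>" "T' \<in> \<T>" "T \<noteq> T'" and e: "{a, b} \<in> straight_edges \<gamma> T" "{a, b} \<in> straight_edges \<gamma> T'"
    and x: "x \<in> closed_segment a b"
  shows "zero_1jet (\<lambda>x. I T x - I T' x) x"
proof -
  let ?D = "\<lambda>x. I T x - I T' x"
  obtain t where t: "x = a + t *\<^sub>R (b - a)" using x by (auto simp: closed_segment_def algebra_simps)
  have p6: "?D \<in> Poly 6" by (intro Poly_diff piece_Poly T)
  note ev = edge_vertices[OF T(1) e(1)] edge_vertices[OF T(2) e(2)]
  have j: "zero_2jet ?D a" "zero_2jet ?D b" using zero_2jet_vertex[OF T(1,2)] ev by auto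
  have n: "norm (\<nu> {a, b}) = 1" "\<nu> {a, b} \<bullet> (b - a) = 0" using edge_normal[OF T(1) e(1)] unfolding unit_normal_def by auto
  from ordinary_or_buffer_edge[OF T e] consider "T \<in> buffers \<gamma> \<T> \<or> T' \<in> buffers \<gamma> \<T>" | "T \<in> ordinary \<gamma> \<T>" "T' \<in> ordinary \<gamma> \<T>" by blast
  then show ?thesis
  proof cases
    case 1
    have N: "\<eta> UNIV (I T) = \<eta> UNIV (I T')" if "\<eta> \<in> N_edge \<nu> a b" for \<eta>
      using 1 buffer_edge_data[of T T'] buffer_edge_data[of T' T] T e that by metis
    note P = piece_Poly[OF T(1)] piece_Poly[OF T(2)]
    have "?D (edge_point 2 a b) = 0"
      using N[of "eval_partial 0 0 (edge_point 2 a b)"] by (simp add: N_edge_def eval_partial_Poly[OF P(1)] eval_partial_Poly[OF P(2)] partial_simps)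
    moreover have "dir_deriv (\<nu> {a, b}) ?D (edge_point k a b) = 0" if "k = 1 \<or> k = 3" for k
      using N[of "eval_dir (\<nu> {a, b}) (edge_point k a b)"] that
      by (auto simp: N_edge_def eval_dir_Poly[OF P(1)] eval_dir_Poly[OF P(2)] dir_deriv_Poly_diff[OF P])
    ultimately show ?thesis unfolding t using edge_zero_C1_degree_6[OF p6 j _ _ _ n ev(1)] by blast
  next
    case 2
    have p5: "?D \<in> Poly 5" by (intro Poly_diff ordinary_Poly 2)
    have "dir_deriv (\<nu> {a, b}) ?D (edge_point 2 a b) = 0"
      using ordinary_edge[OF 2(1) e(1)] ordinary_edge[OF 2(2) e(2)]
      by (simp add: dir_deriv_Poly_diff[OF ordinary_Poly[OF 2(1)] ordinary_Poly[OF 2(2)]])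
    then show ?thesis unfolding t using edge_zero_C1_degree_5[OF p5 j _ n ev(1)] by blast
  qed
qed

lemma common_point_C1:
  assumes T: "T \<in> \<T>" "T' \<in> \<T>" and x: "x \<in> region \<gamma> T" "x \<in> region \<gamma> T'"
  shows "zero_1jet (\<lambda>x. I T x - I T' x) x"
proof (cases "T = T'")
  case True
  then show ?thesis using partial_Poly_diff[OF piece_Poly[OF T(1)] piece_Poly[OF T(1)]] by (simp add: zero_1jet_def)
next
  case False
  from common_point[OF T False x] show ?thesis
  proof
    assume "x \<in> vertices \<gamma> T \<inter> vertices \<gamma> T'"
    then show ?thesis using zero_2jet_vertex[OF T] by (simp add: zero_2jet_iff)
  next
    assume "\<exists>a b. {a, b} \<in> straight_edges \<gamma> T \<and> {a, b} \<in> straight_edges \<gamma> T' \<and> x \<in> closed_segment a b"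
    then show ?thesis using edge_C1[OF T False] by blast
  qed
qed

end

section \<open>Zeros of the conics\<close>

text \<open>With infinitely many zeros on the line the polynomial would vanish on it entirely, and the linear form
\<open>\<tau>\<close> defining the line would split off.\<close>

lemma irreducible_quadratic_zeros_on_line:
  assumes q: "q \<in> Poly 2 - Poly 1" "irreducible_Poly q" and ab: "a \<noteq> b"
  shows "finite {x \<in> closed_segment a b. q x = 0}"
proof -
  let ?e = "b - a"
  (* Any direction transversal to the line serves as second coordinate direction. *)
  let ?f = "rot90 ?e"
  have q2: "q \<in> Poly 2" using q(1) by blast
  obtain c where c: "\<And>t. q (a + t *\<^sub>R ?e) = (\<Sum>i\<le>2. c i * t ^ i)" using Poly_restrict_line[OF q2] by blast
  have "\<exists>i\<le>2. c i \<noteq> 0"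
  proof (rule ccontr)
    assume "\<not> (\<exists>i\<le>2. c i \<noteq> 0)"
    then have line: "q (a + t *\<^sub>R ?e) = 0" for t unfolding c by simp
    let ?D = "cross ?e ?f"
    have D: "?D \<noteq> 0"
    proof -
      have "?D = (?e $ 1)\<^sup>2 + (?e $ 2)\<^sup>2" by (simp add: cross_def rot90_def power2_eq_square algebra_simps)
      then show ?thesis using ab by (auto simp: vec_eq_iff forall_2 sum_power2_eq_zero_iff)
    qed
    obtain d where d: "\<And>s t. q (a + s *\<^sub>R ?e + t *\<^sub>R ?f) = (\<Sum>i\<le>2. \<Sum>j\<le>2 - i. d i j * s ^ i * t ^ j)"
      using Poly_affine_coordinates[OF q2] by blast
    have di0: "d i 0 = 0" if "i \<le> 2" for i
    proof (rule vanishing_on_axis(2)[OF _ that])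
      fix s show "(\<Sum>i\<le>2. \<Sum>j\<le>2 - i. d i j * s ^ i * 0 ^ j) = 0"
        unfolding d[symmetric] using line[of s] by simp
    qed
    have Q: "q (a + s *\<^sub>R ?e + t *\<^sub>R ?f) = t * (d 0 1 + d 1 1 * s + d 0 2 * t)" for s t
      unfolding d sum_atMost_2 using di0[of 0] di0[of 1] di0[of 2]
      by (simp add: sum_atMost_2 sum_atMost_1 algebra_simps power2_eq_square)
    define \<sigma> \<tau> where "\<sigma> = (\<lambda>x. cross (x - a) ?f / ?D)" and "\<tau> = (\<lambda>x. cross ?e (x - a) / ?D)"
    have lin: "(\<lambda>x. (r * (x $ 1 - a $ 1) + s * (x $ 2 - a $ 2)) / ?D) \<in> Poly 1" for r s
    proof -
      have "(\<lambda>x. (r / ?D) * (x $ 1 - a $ 1) + (s / ?D) * (x $ 2 - a $ 2)) \<in> Poly 1"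
        by (intro Poly_add Poly_scale Poly_diff Poly_const Poly_coord order_refl)
      then show ?thesis by (simp add: add_divide_distrib)
    qed
    have st_eq: "\<sigma> = (\<lambda>x. (?f $ 2 * (x $ 1 - a $ 1) + (- ?f $ 1) * (x $ 2 - a $ 2)) / ?D)"
      "\<tau> = (\<lambda>x. ((- ?e $ 2) * (x $ 1 - a $ 1) + ?e $ 1 * (x $ 2 - a $ 2)) / ?D)"
      unfolding \<sigma>_def \<tau>_def cross_def[of "_ - a" ?f] cross_def[of ?e "_ - a"]
      by - (rule ext, rule arg_cong2[where f = "(/)", OF _ refl], simp add: algebra_simps)+
    have st: "\<sigma> \<in> Poly 1" "\<tau> \<in> Poly 1" unfolding st_eq by (rule lin)+
    define m where "m = (\<lambda>x. d 0 1 + d 1 1 * \<sigma> x + d 0 2 * \<tau> x)"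
    have m: "m \<in> Poly 1" unfolding m_def by (intro Poly_add Poly_scale Poly_const st)
    have "q x = \<tau> x * m x" for x
    proof -
      have "x = a + \<sigma> x *\<^sub>R ?e + \<tau> x *\<^sub>R ?f"
        using cramer[OF D, of "x - a"] unfolding \<sigma>_def \<tau>_def by (simp add: add.assoc)
      then have "q x = q (a + \<sigma> x *\<^sub>R ?e + \<tau> x *\<^sub>R ?f)" by simp
      then show ?thesis unfolding Q m_def .
    qed
    then have eq: "q = (\<lambda>x. \<tau> x * m x)" by auto
    then have "\<tau> \<in> Poly 0 \<or> m \<in> Poly 0" using q(2) st(2) m unfolding irreducible_Poly_def by blast
    then have "q \<in> Poly 1"
      unfolding eq using Poly_mult[of \<tau> 0 m 1] Poly_mult[of \<tau> 1 m 0] m st(2) by auto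
    then show False using q(1) by blast
  qed
  then obtain i where "i \<le> 2" "c i \<noteq> 0" by blast
  then have "finite {t. (\<Sum>i\<le>2. c i * t ^ i) = 0}" using Transcendental.polyfun_finite_roots[of c 2] by blast
  then have "finite ((\<lambda>t. a + t *\<^sub>R ?e) ` {t. (\<Sum>i\<le>2. c i * t ^ i) = 0})" by simp
  moreover have "{x \<in> closed_segment a b. q x = 0} \<subseteq> (\<lambda>t. a + t *\<^sub>R ?e) ` {t. (\<Sum>i\<le>2. c i * t ^ i) = 0}"
  proof
    fix x assume x: "x \<in> {x \<in> closed_segment a b. q x = 0}"
    then obtain t where t: "x = a + t *\<^sub>R ?e" by (auto simp: closed_segment_def algebra_simps)
    then show "x \<in> (\<lambda>t. a + t *\<^sub>R ?e) ` {t. (\<Sum>i\<le>2. c i * t ^ i) = 0}" using x c[of t] by auto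
  qed
  ultimately show ?thesis by (rule finite_subset[rotated])
qed

context curved_triangulation
begin

text \<open>In \<open>\<Omega>\<close> the polynomial is positive near \<open>x\<close> but, its gradient at \<open>x\<close> being non-zero, it is negative on
open sets arbitrarily close to \<open>x\<close>, and these contain no point of the closure of \<open>\<Omega>\<close>.\<close>

lemma arc_not_interior:
  assumes j: "j < n" and x: "x \<in> open_arc \<gamma> j"
  shows "x \<notin> interior (closure \<Omega>)"
proof
  assume "x \<in> interior (closure \<Omega>)"
  then obtain r where r: "0 < r" "ball x r \<subseteq> closure \<Omega>" using mem_interior by blast
  obtain \<epsilon> where \<epsilon>: "0 < \<epsilon>" "\<forall>y \<in> \<Omega> \<inter> ball x \<epsilon>. q j y > 0" using q_near[OF j x] by blast
  have q: "q j \<in> Poly 2" using q_quadratic[OF j] by blast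
  let ?g = "gradient (q j) x"
  have g: "?g $ 1 = partial 1 0 (q j) x" "?g $ 2 = partial 0 1 (q j) x"
    by (simp_all add: gradient_def partial_simps)
  have "dir_deriv (- ?g) (q j) x = - ((?g $ 1)\<^sup>2 + (?g $ 2)\<^sup>2)"
    unfolding dir_deriv_Poly[OF q] g[symmetric] by (simp add: power2_eq_square)
  moreover have "(?g $ 1)\<^sup>2 + (?g $ 2)\<^sup>2 > 0"
    using q_gradient[OF j x] by (simp add: sum_power2_gt_zero_iff vec_eq_iff forall_2)
  (* Moving against the gradient, the polynomial decreases from its value 0 at x. *)
  ultimately have neg: "dir_deriv (- ?g) (q j) x < 0" by simp
  have D: "((\<lambda>t. q j (x + t *\<^sub>R (- ?g))) has_real_derivative dir_deriv (- ?g) (q j) (x + 0 *\<^sub>R (- ?g))) (at 0)"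
    by (rule Poly_line_derivative[OF q])
  have "\<exists>d>0. \<forall>h>0. h < d \<longrightarrow> q j (x + (0 + h) *\<^sub>R (- ?g)) < q j (x + 0 *\<^sub>R (- ?g))"
    by (rule DERIV_neg_dec_right[OF D]) (use neg in simp)
  then obtain d where d: "0 < d" "\<forall>h>0. h < d \<longrightarrow> q j (x + (0 + h) *\<^sub>R (- ?g)) < q j (x + 0 *\<^sub>R (- ?g))" by blast
  define \<rho> where "\<rho> = min r \<epsilon>"
  define h where "h = min (d / 2) (\<rho> / (2 * norm ?g))"
  have ng: "norm ?g > 0" using q_gradient[OF j x] by simp
  have \<rho>: "0 < \<rho>" unfolding \<rho>_def using r \<epsilon> by simp
  have h: "0 < h" "h < d" unfolding h_def using d(1) \<rho> ng by auto
  have "h * norm ?g \<le> \<rho> / (2 * norm ?g) * norm ?g" unfolding h_def using ng by (intro mult_right_mono) auto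
  then have hn: "h * norm ?g < \<rho>" using ng \<rho> by simp
  let ?y = "x + h *\<^sub>R (- ?g)"
  have y: "?y \<in> ball x \<rho>" using hn h(1) by (simp add: dist_norm)
  let ?V = "ball x \<rho> \<inter> q j -` {..<0}"
  have "continuous_on (ball x \<rho>) (q j)" using Poly_continuous[OF q] by (simp add: continuous_at_imp_continuous_on)
  then have "open ?V" by (rule continuous_open_preimage) simp_all
  moreover have "?y \<in> ?V"
  proof -
    have "q j (x + (0 + h) *\<^sub>R (- ?g)) < q j (x + 0 *\<^sub>R (- ?g))" using d(2) h by blast
    then show ?thesis using y q_zero[OF j x] by simp
  qed
  moreover have "?y \<in> closure \<Omega>" using y r(2) unfolding \<rho>_def by auto
  ultimately obtain z where "z \<in> \<Omega>" "z \<in> ?V" using open_Int_closure_eq_empty[of ?V \<Omega>] by blast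
  then show False using \<epsilon>(2) unfolding \<rho>_def by force
qed

text \<open>Points of the arc in straight triangles are not interior to them, so they lie on edges; the edges are
finitely many, and each contains finitely many zeros of the conic.\<close>

lemma arc_covered_by_pies_up_to_finite:
  assumes j: "j < n"
  shows "finite {t \<in> {0<..<1}. \<forall>T\<in>pies \<T>. \<gamma> j t \<notin> region \<gamma> T}" (is "finite ?B")
proof -
  define E where "E = {(a, b). \<exists>T\<in>\<T>. {a, b} \<in> straight_edges \<gamma> T}"
  have "E \<subseteq> (\<Union>T\<in>\<T>. vertices \<gamma> T \<times> vertices \<gamma> T)"
  proof (clarsimp simp: E_def)
    fix a b T assume "T \<in> \<T>" "{a, b} \<in> straight_edges \<gamma> T"
    then show "\<exists>T\<in>\<T>. a \<in> vertices \<gamma> T \<and> b \<in> vertices \<gamma> T" using edge_vertices(2,3) by (intro bexI[of _ T] conjI)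
  qed
  moreover have "finite (vertices \<gamma> T)" for T by (cases T) auto
  ultimately have "finite E" using finite_cells by (meson finite_SigmaI finite_UN finite_subset)
  define Z where "Z = (\<Union>(a, b)\<in>E. {x \<in> closed_segment a b. q j x = 0})"
  have "finite {x \<in> closed_segment a b. q j x = 0}" if "(a, b) \<in> E" for a b
    using irreducible_quadratic_zeros_on_line[of "q j" a b] q_quadratic[OF j] edge_vertices(1) that unfolding E_def by blast
  then have Z: "finite Z" unfolding Z_def using \<open>finite E\<close> by auto
  have sub: "\<gamma> j ` ?B \<subseteq> Z"
  proof
    fix x assume "x \<in> \<gamma> j ` ?B"
    then obtain t where t: "t \<in> {0<..<1}" "\<forall>T\<in>pies \<T>. \<gamma> j t \<notin> region \<gamma> T" "x = \<gamma> j t" by blast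
    have arc: "x \<in> open_arc \<gamma> j" using t by blast
    have "x \<in> frontier \<Omega>" using arc_in_frontier[OF j, of t] t by auto
    then have "x \<in> closure \<Omega>" by (simp add: frontier_def)
    then obtain T where T: "T \<in> \<T>" "x \<in> region \<gamma> T" using cover by blast
    then have "T \<notin> pies \<T>" using t by blast
    then obtain a b c where S: "T = Straight a b c" using T(1) by (cases T) (auto simp: pies_def)
    have "x \<notin> interior (region \<gamma> T)" using arc_not_interior[OF j arc] interior_mono[OF region_subset[OF T(1)]] by blast
    then have "x \<in> closed_segment a b \<union> closed_segment b c \<union> closed_segment a c"
      using triangle_edge_if_not_interior straight_not_collinear T S by simp
    moreover have "(a, b) \<in> E" "(b, c) \<in> E" "(a, c) \<in> E" unfolding E_def using T(1) S by (auto intro!: bexI[of _ T])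
    ultimately show "x \<in> Z" unfolding Z_def using q_zero[OF j arc] by blast
  qed
  have "inj_on (\<gamma> j) ?B"
  proof (rule inj_onI)
    fix s t assume "s \<in> ?B" "t \<in> ?B" "\<gamma> j s = \<gamma> j t"
    then show "s = t" using simple[OF j j, of s t] by auto
  qed
  then show ?thesis using finite_subset[OF sub Z] finite_imageD by blast
qed

end

section \<open>The interpolant\<close>

context spline_interpolation
begin

abbreviation S :: "plane \<Rightarrow> real" where "S \<equiv> I_tri \<Omega> \<gamma> q A \<T> \<nu> u"

lemma interpolant_on_cell:
  assumes T: "T \<in> \<T>" and x: "x \<in> region \<gamma> T"
  shows "S x = I T x"
proof -
  let ?T = "SOME T. T \<in> \<T> \<and> x \<in> region \<gamma> T"
  have "?T \<in> \<T> \<and> x \<in> region \<gamma> ?T" by (rule someI[of _ T]) (use T x in blast)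
  then have "zero_1jet (\<lambda>x. I ?T x - I T x) x" using common_point_C1 T x by blast
  then show ?thesis by (simp add: zero_1jet_iff I_tri_def)
qed

lemma cells_cover: "\<Omega> \<subseteq> (\<Union>T\<in>\<T>. region \<gamma> T)"
  using cover closure_subset by blast

lemma cell_at: assumes "x \<in> \<Omega>" obtains T where "T \<in> \<T>" "x \<in> region \<gamma> T"
  using cells_cover assms by blast

lemma dir_deriv_pieces_agree:
  assumes "T \<in> \<T>" "T' \<in> \<T>" "x \<in> region \<gamma> T" "x \<in> region \<gamma> T'"
  shows "dir_deriv e (I T) x = dir_deriv e (I T') x"
  using zero_1jet_dir[OF Poly_diff[OF piece_Poly piece_Poly] common_point_C1[OF assms], of e] assms(1,2)
  by (simp add: dir_deriv_Poly_diff[OF piece_Poly piece_Poly])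

lemma interpolant_has_derivative:
  assumes T: "T \<in> \<T>" "x \<in> region \<gamma> T" and x: "x \<in> \<Omega>"
  shows "(S has_derivative (\<lambda>h. dir_deriv h (I T) x)) (at x)"
proof (rule has_derivative_finite_closed_cover[OF finite_cells region_closed domain(1) x cells_cover])
  fix T' assume T': "T' \<in> \<T>" "x \<in> region \<gamma> T'"
  have "(\<lambda>h. dir_deriv h (I T) x) = (\<lambda>h. dir_deriv h (I T') x)" using dir_deriv_pieces_agree T T' by blast
  then show "(I T' has_derivative (\<lambda>h. dir_deriv h (I T) x)) (at x)"
    using Poly_has_derivative_dir[OF piece_Poly[OF T'(1)], of x] by simp
  show "S y = I T' y" if "y \<in> region \<gamma> T' \<inter> \<Omega>" for y using interpolant_on_cell T'(1) that by blast
qed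

lemma dir_deriv_interpolant:
  assumes "T \<in> \<T>" "x \<in> region \<gamma> T" "x \<in> \<Omega>" shows "dir_deriv e S x = dir_deriv e (I T) x"
  by (rule dir_deriv_at[OF interpolant_has_derivative[OF assms]])

lemma interpolant_C1: "Ck_on 1 \<Omega> S"
proof -
  have "S differentiable_on \<Omega>"
    unfolding differentiable_on_eq_differentiable_at[OF domain(1)]
    using cell_at interpolant_has_derivative unfolding differentiable_def by metis
  moreover have "continuous_on \<Omega> (dir_deriv e S)" for e
    unfolding continuous_on_eq_continuous_at[OF domain(1)]
  proof
    fix x assume x: "x \<in> \<Omega>"
    show "isCont (dir_deriv e S) x" unfolding isCont_def
    proof (rule filterlim_finite_closed_cover[OF finite_cells region_closed domain(1) x cells_cover])
      fix T assume T: "T \<in> \<T>" "x \<in> region \<gamma> T"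
      have "isCont (dir_deriv e (I T)) x" by (rule Poly_continuous[OF Poly_dir_deriv[OF piece_Poly[OF T(1)]]])
      then have "(dir_deriv e (I T) \<longlongrightarrow> dir_deriv e S x) (at x within region \<gamma> T \<inter> \<Omega>)"
        unfolding dir_deriv_interpolant[OF T x] using tendsto_within_subset[of _ _ x UNIV] by (simp add: isCont_def)
      then show "(dir_deriv e S \<longlongrightarrow> dir_deriv e S x) (at x within region \<gamma> T \<inter> \<Omega>)"
        by (rule Lim_transform_eventually)
           (simp add: eventually_at_filter dir_deriv_interpolant[OF T(1)])
    qed
  qed
  ultimately show ?thesis by simp
qed

lemma interpolant_S15: "S \<in> S15 \<Omega> \<gamma> \<T>"
proof -
  have "\<exists>p\<in>Poly 5. \<forall>x\<in>region \<gamma> T. S x = p x" if "T \<in> ordinary \<gamma> \<T>" for T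
    using ordinary_Poly[OF that] interpolant_on_cell ordinary_cell[OF that] by blast
  moreover have "\<exists>p\<in>Poly 6. \<forall>x\<in>region \<gamma> T. S x = p x" if "T \<in> pies \<T> \<union> buffers \<gamma> \<T>" for T
    using piece_Poly interpolant_on_cell that pie_cell buffer_cell by (metis Un_iff)
  ultimately show ?thesis unfolding S15_def using interpolant_C1 by blast
qed

text \<open>Every cell containing \<open>v\<close> has it as a vertex, so all pieces around \<open>v\<close> have the second derivatives of
\<open>u\<close> there.\<close>

lemma gradient_differentiable_at_vertex:
  assumes v: "v \<in> interior_vertices \<Omega> \<gamma> \<T>"
  shows "gradient S differentiable (at v)"
proof -
  obtain T where T: "T \<in> \<T>" "v \<in> vertices \<gamma> T" and v\<Omega>: "v \<in> \<Omega>" using v unfolding interior_vertices_def by blast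
  let ?D = "\<lambda>e h. h $ 1 * e $ 1 * U_jet 2 0 v + (h $ 1 * e $ 2 + h $ 2 * e $ 1) * U_jet 1 1 v + h $ 2 * e $ 2 * U_jet 0 2 v"
  have "(dir_deriv e S has_derivative ?D e) (at v)" for e
  proof (rule has_derivative_finite_closed_cover[OF finite_cells region_closed domain(1) v\<Omega> cells_cover])
    fix T' assume T': "T' \<in> \<T>" "v \<in> region \<gamma> T'"
    note p = piece_Poly[OF T'(1)]
    have v': "v \<in> vertices \<gamma> T'" by (rule vertex_in_region_is_vertex[OF T(1) T'(1) T(2) T'(2)])
    have "(dir_deriv e (I T') has_derivative (\<lambda>h. dir_deriv h (dir_deriv e (I T')) v)) (at v)"
      by (rule Poly_has_derivative_dir[OF Poly_dir_deriv[OF p]])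
    then show "(dir_deriv e (I T') has_derivative ?D e) (at v)"
      by (simp add: dir_deriv_dir_deriv_Poly[OF p] piece_jet[OF T'(1) v'] del: One_nat_def)
    show "dir_deriv e S y = dir_deriv e (I T') y" if "y \<in> region \<gamma> T' \<inter> \<Omega>" for y
      using dir_deriv_interpolant T'(1) that by blast
  qed
  then have d: "dir_deriv e S differentiable (at v)" for e unfolding differentiable_def by blast
  have "gradient S = (\<lambda>x. dir_deriv (axis 1 1) S x *\<^sub>R axis 1 1 + dir_deriv (axis 2 1) S x *\<^sub>R axis 2 1)"
    by (simp add: fun_eq_iff gradient_def vec_eq_iff forall_2)
  then show ?thesis using d by (simp add: differentiable_add differentiable_scaleR)
qed

text \<open>A pie-shaped cell lies in the closure of \<open>A j\<close>, which meets the boundary of \<open>\<Omega>\<close> only in the arc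
where \<open>q\<^sub>j\<close> vanishes.\<close>

lemma interpolant_zero_on_pie:
  assumes T: "T \<in> pies \<T>" and x: "x \<in> region \<gamma> T" "x \<in> frontier \<Omega>"
  shows "S x = 0"
proof -
  obtain v j s t where S: "T = Pie v j s t" and T': "T \<in> \<T>" using pie_cell[OF T] by (cases T) auto
  have j: "j < n" using pie_parameters(1) T' S by blast
  have A: "open (A j)" "A j \<subseteq> \<Omega>" using aux_domain[OF j] by auto
  have "x \<in> closure (A j)" using aux_e T' S x(1) by blast
  moreover have "x \<notin> A j" using x(2) A(2) domain(1) by (auto simp: frontier_def interior_open)
  ultimately have "x \<in> frontier (A j)" using A(1) by (simp add: frontier_def interior_open)
  then have "x \<in> closed_arc \<gamma> j" using aux_a[OF j] x(2) by blast
  then have "q j x = 0" using q_zero_closed_arc[OF j] by blast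
  moreover obtain p where "I T = (\<lambda>x. p x * q j x)" using pie_piece T' S by blast
  ultimately show ?thesis using interpolant_on_cell[OF T' x(1)] by simp
qed

lemma interpolant_continuous: "continuous_on (closure \<Omega>) S"
  unfolding cover[symmetric]
proof (rule continuous_on_closed_Union[OF finite_cells region_closed])
  fix T assume T: "T \<in> \<T>"
  have "continuous_on (region \<gamma> T) (I T)"
    using Poly_continuous[OF piece_Poly[OF T]] continuous_at_imp_continuous_on by blast
  then show "continuous_on (region \<gamma> T) S"
    by (rule continuous_on_eq) (simp add: interpolant_on_cell[OF T])
qed

text \<open>Every parameter is a limit of parameters whose points lie in pie-shaped cells.\<close>

lemma interpolant_zero_on_frontier:
  assumes "x \<in> frontier \<Omega>" shows "S x = 0"
proof -
  obtain j t where j: "j < n" and t: "t \<in> {0..1}" "x = \<gamma> j t" using assms boundary by blast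
  let ?B = "{t \<in> {0<..<1}. \<forall>T\<in>pies \<T>. \<gamma> j t \<notin> region \<gamma> T}"
  let ?G = "{0<..<1} - ?B"
  have G: "S (\<gamma> j s) = 0" if "s \<in> ?G" for s
    using interpolant_zero_on_pie arc_in_frontier[OF j] that by auto
  have "t islimpt {0<..<1}"
  proof (cases "t \<in> {0<..<1}")
    case True
    then show ?thesis by (intro interior_limit_point) (simp add: interior_open)
  next
    case False
    have "t \<in> closure {0<..<1::real}" using t(1) by simp
    then show ?thesis using False unfolding closure_def by blast
  qed
  then have "t islimpt (?B \<union> ?G)" by (rule islimpt_subset) blast
  then have "t islimpt ?G" using islimpt_Un_finite[OF arc_covered_by_pies_up_to_finite[OF j]] by blast
  then have tG: "t \<in> closure ?G" unfolding closure_def by blast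
  have "closure ?G \<subseteq> {0..1}" by (rule closure_minimal) auto
  moreover have "continuous_on {0..1} (\<lambda>t. S (\<gamma> j t))"
  proof (rule continuous_on_compose2[OF interpolant_continuous arc_continuous[OF j]])
    show "\<gamma> j ` {0..1} \<subseteq> closure \<Omega>" using arc_in_frontier[OF j] by (auto simp: frontier_def)
  qed
  ultimately have "continuous_on (closure ?G) (\<lambda>t. S (\<gamma> j t))" using continuous_on_subset by blast
  from continuous_constant_on_closure[OF this G tG] show ?thesis using t(2) by simp
qed

theorem interpolant_in_spline_space: "S \<in> S125_0 \<Omega> \<gamma> \<T>"
  unfolding S125_0_def S125_I_def
  using interpolant_S15 gradient_differentiable_at_vertex interpolant_zero_on_frontier by blast

end

theorem theorem1:
  fixes n :: nat and \<Omega> :: "plane set"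
    and \<gamma> :: "nat \<Rightarrow> real \<Rightarrow> plane" and q :: "nat \<Rightarrow> plane \<Rightarrow> real"
    and \<T> :: "cell set" and A :: "nat \<Rightarrow> plane set"
    and \<nu> :: "plane set \<Rightarrow> plane" and u :: "plane \<Rightarrow> real"
  assumes domain: "curved_domain n \<Omega> \<gamma> q"
    and triangulation: "curved_triangulation n \<Omega> \<gamma> q \<T>"
    and auxiliary: "auxiliary_domains n \<Omega> \<gamma> q \<T> A"
    and normals: "edge_normals \<gamma> \<T> \<nu>"
    and u: "u \<in> sobolev 5 \<Omega> \<inter> sobolev_H10 n \<gamma> \<Omega>"
    and u_C3: "\<exists>U. Ck_version 3 \<Omega> u U"
    and quotient_C2: "\<forall>j<n. \<exists>w. Ck_version 2 (A j) (\<lambda>x. u x / q j x) w"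
  shows "I_tri \<Omega> \<gamma> q A \<T> \<nu> u \<in> S125_0 \<Omega> \<gamma> \<T>"
proof -
  interpret spline_interpolation n \<Omega> \<gamma> q \<T> A \<nu> u
    by (intro spline_interpolation.intro auxiliary spline_interpolation_axioms.intro normals u_C3)
       (use quotient_C2 in blast)
  show ?thesis by (rule interpolant_in_spline_space)
qed

end
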